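(* Assume Hypothesis (H). Then for every $\mu>0$: (1) if $\sum_{x\in\mathbb Z^d}\hat v(x)\ge0$, then $\sigma_{disc}(\hat{\bf h}_\mu)\cap(\mathfrak e_{\max},+\infty)\neq\emptyset$; (2) if $\sum_{x\in\mathbb Z^d}\hat v(x)\le0$, then $\sigma_{disc}(\hat{\bf h}_\mu)\cap(-\infty,\mathfrak e_{\min})\neq\emptyset$. Moreover, there exists $\mu_o=\mu_o(\mathfrak e,\hat v)>0$ such that for every $\mu\in(0,\mu_o)$: (a) if $\sum_x\hat v(x)>0$, then $\sigma_{disc}(\hat{\bf h}_\mu)\cap(\mathfrak e_{\max},+\infty)$ is a singleton $\{E(\mu)\}$ and $\sigma_{disc}(\hat{\bf h}_\mu)\cap(-\infty,\mathfrak e_{\min})=\emptyset$; (b) if $\sum_x\hat v(x)<0$, then $\sigma_{disc}(\hat{\bf h}_\mu)\cap(-\infty,\mathfrak e_{\min})$ is a singleton $\{e(\mu)\}$ and $\sigma_{disc}(\hat{\bf h}_\mu)\cap(\mathfrak e_{\max},+\infty)=\emptyset$; (c) if $\sum_x\hat v(x)=0$, then $\sigma_{disc}(\hat{\bf h}_\mu)\cap(\mathfrak e_{\max},+\infty)$ and $\sigma_{disc}(\hat{\bf h}_\mu)\cap(-\infty,\mathfrak e_{\min})$ are singletons $\{E(\mu)\}$ and $\{e(\mu)\}$ respectively.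
   Context: Let $d\in\{1,2\}$ and $\mathbb T^d=(-\pi,\pi]^d$ with normalized Haar measure $dp$. Let $\hat{\mathfrak e}\in\ell^1(\mathbb Z^d)$ with $\overline{\hat{\mathfrak e}(-x)}=\hat{\mathfrak e}(x)$, and $\hat v:\mathbb Z^d\to\mathbb R$. On $\ell^2(\mathbb Z^d)$ define $(\hat{\bf h}_0\hat f)(x)=\sum_{y}\hat{\mathfrak e}(y)\hat f(x+y)$, $(\hat{\bf v}\hat f)(x)=\hat v(x)\hat f(x)$, $\hat{\bf h}_\mu=\hat{\bf h}_0+\mu\hat{\bf v}$. Let $\mathfrak e(p)=\sum_x\hat{\mathfrak e}(x)e^{ix\cdot p}$ (continuous, real), $\mathfrak e_{\min}=\min\mathfrak e$, $\mathfrak e_{\max}=\max\mathfrak e$. Hypothesis (H): (a) $\mathfrak e$ has a unique minimum point $p_0$ and a unique maximum point $p^0$, is $C^2$ near both, and both are non-degenerate; (b) there exists $\gamma\in(0,1)$ with $0<\sum_{x}|x|^{2-d+\gamma}|\hat v(x)|<\infty$. Then $\sigma_{ess}(\hat{\bf h}_\mu)=[\mathfrak e_{\min},\mathfrak e_{\max}]$; $\sigma_{disc}$ denotes the discrete spectrum. *)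

theory Defs
  imports "HOL-Analysis.Analysis"
begin

definition l2 :: "('a \<Rightarrow> complex) set" where
  "l2 = {f. (\<lambda>x. (cmod (f x))^2) summable_on UNIV}"

text \<open>Spectrum of an operator acting on l2: the complement of the resolvent set,
  i.e. the set of \<open>z\<close> such that \<open>H - z\<close> is not a bijection of l2 onto l2
  (for bounded operators the inverse is then automatically bounded).\<close>
definition op_spectrum :: "(('a \<Rightarrow> complex) \<Rightarrow> ('a \<Rightarrow> complex)) \<Rightarrow> complex set" where
  "op_spectrum H =
     {z. \<not> (\<forall>g\<in>l2. \<exists>!f. f \<in> l2 \<and> (\<forall>x. H f x - z * f x = g x))}"

definition op_eigenspace ::
  "(('a \<Rightarrow> complex) \<Rightarrow> ('a \<Rightarrow> complex)) \<Rightarrow> complex \<Rightarrow> ('a \<Rightarrow> complex) set" where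
  "op_eigenspace H z = {f \<in> l2. \<forall>x. H f x = z * f x}"

definition fin_dim_fun_space :: "('a \<Rightarrow> complex) set \<Rightarrow> bool" where
  "fin_dim_fun_space S \<longleftrightarrow>
     (\<exists>B. finite B \<and> S \<subseteq> {(\<lambda>x. \<Sum>b\<in>B. c b * b x) | c. True})"

definition disc_spectrum :: "(('a \<Rightarrow> complex) \<Rightarrow> ('a \<Rightarrow> complex)) \<Rightarrow> complex set" where
  "disc_spectrum H =
     {z \<in> op_spectrum H.
        (\<exists>\<epsilon>>0. op_spectrum H \<inter> ball z \<epsilon> = {z}) \<and>
        (\<exists>f\<in>op_eigenspace H z. f \<noteq> (\<lambda>_. 0)) \<and>
        fin_dim_fun_space (op_eigenspace H z)}"

definition h_op :: "(int^'d \<Rightarrow> complex) \<Rightarrow> (int^'d \<Rightarrow> real) \<Rightarrow> real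
                    \<Rightarrow> (int^'d \<Rightarrow> complex) \<Rightarrow> (int^'d \<Rightarrow> complex)" where
  "h_op eh v \<mu> f = (\<lambda>x. (\<Sum>\<^sub>\<infinity>y. eh y * f (x + y)) + complex_of_real (\<mu> * v x) * f x)"

text \<open>Dispersion relation \<open>e(p) = \<Sum>_x eh(x) e^{i x.p}\<close> (real part; it is real by symmetry).\<close>
definition disp :: "(int^'d \<Rightarrow> complex) \<Rightarrow> real^'d \<Rightarrow> real" where
  "disp eh p = Re (\<Sum>\<^sub>\<infinity>x. eh x * cis (\<Sum>i\<in>UNIV. real_of_int (x$i) * p$i))"

definition torus :: "(real^'d) set" where
  "torus = {p. \<forall>i. - pi < p$i \<and> p$i \<le> pi}"

definition disp_min :: "(int^'d \<Rightarrow> complex) \<Rightarrow> real" where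
  "disp_min eh = Inf (disp eh ` torus)"

definition disp_max :: "(int^'d \<Rightarrow> complex) \<Rightarrow> real" where
  "disp_max eh = Sup (disp eh ` torus)"

definition C2_nondeg_at :: "(real^'d \<Rightarrow> real) \<Rightarrow> real^'d \<Rightarrow> bool" where
  "C2_nondeg_at f p \<longleftrightarrow>
    (\<exists>U D D2. open U \<and> p \<in> U \<and>
       (\<forall>q\<in>U. (f has_derivative blinfun_apply (D q)) (at q) \<and>
               (D has_derivative blinfun_apply (D2 q)) (at q)) \<and>
       continuous_on U D2 \<and>
       (\<forall>u. (\<forall>w. blinfun_apply (blinfun_apply (D2 p) u) w = 0) \<longrightarrow> u = 0))"

definition lat_norm :: "int^'d \<Rightarrow> real" where
  "lat_norm x = norm (\<chi> i. real_of_int (x$i))"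

end

theory Submission
  imports Defs "HOL-Probability.Infinite_Product_Measure"
begin

text \<open>
  It suffices to study the spectrum above the band, because replacing the data by their negatives
  exchanges both ends. Let \<open>Q f = e_max \<parallel>f\<parallel>\<^sup>2 - \<langle>f, h\<^sub>0 f\<rangle>\<close>, and let \<open>p\<close> be the maximum point. Since \<open>e_max - e\<close> is
  comparable to \<open>\<bar>q\<bar>\<^sup>2\<close> near \<open>p\<close>, Cauchy-Schwarz with the weight \<open>e_max - e\<close> on the Fourier side gives
  \<open>\<bar>f(x) - e^{ipx} f(0)\<bar>\<^sup>2 \<le> C \<bar>x\<bar>^(2-d+\<gamma>) Q f\<close>. Hence the quadratic form of \<open>v\<close> is
  \<open>(\<Sum> v) \<bar>f(0)\<bar>\<^sup>2\<close> up to an error controlled by \<open>Q\<close>. For small \<open>\<mu>\<close> this makes \<open>h\<^sub>\<mu> - e_max\<close> nonpositive on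
  the functions vanishing at \<open>0\<close> (a subspace of codimension one, so there is at most one bound state),
  and on all functions if \<open>\<Sum> v < 0\<close>. In dimension at most two there are functions with \<open>f(0) = 1\<close> and
  \<open>Q f \<rightarrow> 0\<close> (logarithmic cutoffs of the plane wave); on them the form of \<open>h\<^sub>\<mu> - e_max\<close> tends to \<open>\<mu> \<Sum> v\<close>, and if
  \<open>\<Sum> v = 0\<close> it becomes positive after adding a small multiple of a delta function. A form value
  above \<open>e_max\<close> yields an eigenvalue, because \<open>v\<close> is compact.
\<close>

section \<open>The Hilbert space of square-summable functions\<close>

text \<open>In dimension at most two a point has zero capacity for \<open>Q\<close>: no multiple of
  \<open>Q f\<close> bounds the value of \<open>f\<close> at \<open>0\<close>, so an arbitrarily
  weak potential can bind at the band edge. What \<open>Q\<close> does bound is the deviation of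
  \<open>f\<close> from the plane wave through \<open>f(0)\<close>. The perturbation thus reduces to
  the single number \<open>f(0)\<close>, and the sign of the sum of \<open>v\<close> decides. The
  moment condition on \<open>v\<close> pays for this: the weighted estimate leaves
  \<open>|x|^(2-d+\<gamma>) |q|^(\<gamma>-d)\<close>, and \<open>\<gamma> > 0\<close> makes the
  second factor integrable over the torus. Forms replace an expansion of the resolvent, which is
  singular at the edge. Existence therefore holds for every positive \<open>\<mu>\<close>; smallness
  of \<open>\<mu>\<close> lets \<open>Q\<close> absorb the errors in the uniqueness and absence
  statements. When the sum vanishes, the leading term disappears and the gain is of second order:
  the cross term with a delta at a point where \<open>v\<close> is nonzero is linear in the
  coefficient of the delta and survives the limit \<open>Q -> 0\<close>, while the cost of the delta
  is quadratic.\<close>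

lemma norm_add_squared_le:
  fixes a b :: "'a::real_normed_vector"
  shows "(norm (a + b))\<^sup>2 \<le> 2 * (norm a)\<^sup>2 + 2 * (norm b)\<^sup>2"
proof -
  have "(norm (a + b))\<^sup>2 \<le> (norm a + norm b)\<^sup>2"
    by (intro power_mono norm_triangle_ineq) auto
  also have "\<dots> \<le> 2 * (norm a)\<^sup>2 + 2 * (norm b)\<^sup>2"
    using sum_squares_bound[of "norm a" "norm b"] by (simp add: power2_sum)
  finally show ?thesis .
qed

lemma l2_0: "(\<lambda>_. 0) \<in> l2"
  by (simp add: l2_def)

lemma l2_dominated:
  assumes "f \<in> l2" and "\<And>x. cmod (g x) \<le> c * cmod (f x)"
  shows "g \<in> l2"
proof -
  have "(\<lambda>x. c\<^sup>2 * (cmod (f x))\<^sup>2) summable_on UNIV"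
    using assms(1) by (intro summable_on_cmult_right) (simp add: l2_def)
  moreover have "(cmod (g x))\<^sup>2 \<le> c\<^sup>2 * (cmod (f x))\<^sup>2" for x
    unfolding power_mult_distrib[symmetric] by (intro power_mono assms) auto
  ultimately show ?thesis
    unfolding l2_def mem_Collect_eq by (rule summable_on_comparison_test) auto
qed

lemma l2_add:
  assumes "f \<in> l2" "g \<in> l2"
  shows "(\<lambda>x. f x + g x) \<in> l2"
proof -
  have "(\<lambda>x. 2 * (cmod (f x))\<^sup>2 + 2 * (cmod (g x))\<^sup>2) summable_on UNIV"
    using assms by (intro summable_on_add summable_on_cmult_right) (simp_all add: l2_def)
  then show ?thesis
    unfolding l2_def mem_Collect_eq
    by (rule summable_on_comparison_test) (auto intro: norm_add_squared_le)
qed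

lemma l2_inner_summable:
  assumes "f \<in> l2" "g \<in> l2"
  shows "(\<lambda>x. f x \<bullet> g x) summable_on UNIV"
proof -
  have 1: "(\<lambda>x. (cmod (f x))\<^sup>2 + (cmod (g x))\<^sup>2) summable_on UNIV"
    using assms by (intro summable_on_add) (simp_all add: l2_def)
  have 2: "norm (f x \<bullet> g x) \<le> (cmod (f x))\<^sup>2 + (cmod (g x))\<^sup>2" for x
  proof -
    have "2 * \<bar>f x \<bullet> g x\<bar> \<le> 2 * (norm (f x) * norm (g x))"
      using Cauchy_Schwarz_ineq2[of "f x" "g x"] by simp
    also have "\<dots> \<le> (cmod (f x))\<^sup>2 + (cmod (g x))\<^sup>2"
      using sum_squares_bound[of "norm (f x)" "norm (g x)"] by simp
    finally show ?thesis
      using zero_le_power2[of "cmod (f x)"] zero_le_power2[of "cmod (g x)"]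
      unfolding real_norm_def by linarith
  qed
  show ?thesis
    by (rule abs_summable_summable, rule Infinite_Sum.abs_summable_on_comparison_test'[OF 1 2])
qed

text \<open>As a type the space can carry a topology and completeness, so that bounded operators and
  the Banach fixed point theorem apply. The spectral definitions, which speak of plain functions,
  are reached through \<open>coord\<close> and \<open>ell2_of\<close>.\<close>

typedef 'a ell2 = "l2 :: ('a \<Rightarrow> complex) set"
  morphisms coord ell2_of
  using l2_0 by blast

setup_lifting type_definition_ell2

lemma coord_l2: "coord f \<in> l2"
  using coord by blast

lemma coord_ell2_of: "f \<in> l2 \<Longrightarrow> coord (ell2_of f) = f"
  by (rule ell2_of_inverse)

lemma ell2_eqI: "(\<And>x. coord f x = coord g x) \<Longrightarrow> f = g"
  by (auto simp: coord_inject[symmetric])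

instantiation ell2 :: (type) real_vector
begin
lift_definition zero_ell2 :: "'a ell2" is "\<lambda>_. 0" by (rule l2_0)
lift_definition plus_ell2 :: "'a ell2 \<Rightarrow> 'a ell2 \<Rightarrow> 'a ell2" is "\<lambda>f g x. f x + g x"
  by (rule l2_add)
lift_definition uminus_ell2 :: "'a ell2 \<Rightarrow> 'a ell2" is "\<lambda>f x. - f x"
  by (erule l2_dominated[where c = 1]) simp
lift_definition minus_ell2 :: "'a ell2 \<Rightarrow> 'a ell2 \<Rightarrow> 'a ell2" is "\<lambda>f g x. f x - g x"
  unfolding diff_conv_add_uminus by (intro l2_add, assumption, erule l2_dominated[where c = 1]) simp
lift_definition scaleR_ell2 :: "real \<Rightarrow> 'a ell2 \<Rightarrow> 'a ell2" is "\<lambda>r f x. r *\<^sub>R f x"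
  subgoal for r f by (erule l2_dominated[where c = "\<bar>r\<bar>"]) simp
  done
instance
  by standard (transfer; auto simp: algebra_simps)+
end

lemma coord_simps [simp]:
  "coord 0 x = 0" "coord (f + g) x = coord f x + coord g x" "coord (- f) x = - coord f x"
  "coord (f - g) x = coord f x - coord g x" "coord (r *\<^sub>R f) x = r *\<^sub>R coord f x"
  by (transfer; simp)+

text \<open>The inner product is the real part of the Hermitian one. For quadratic forms of
  symmetric operators this suffices; complex scalars are added separately by
  \<open>cmul\<close>.\<close>

instantiation ell2 :: (type) real_inner
begin
definition inner_ell2 :: "'a ell2 \<Rightarrow> 'a ell2 \<Rightarrow> real" where
  "inner_ell2 f g = (\<Sum>\<^sub>\<infinity>x. coord f x \<bullet> coord g x)"
definition norm_ell2 :: "'a ell2 \<Rightarrow> real" where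
  "norm_ell2 f = sqrt (f \<bullet> f)"
definition sgn_ell2 :: "'a ell2 \<Rightarrow> 'a ell2" where
  "sgn_ell2 f = f /\<^sub>R norm f"
definition dist_ell2 :: "'a ell2 \<Rightarrow> 'a ell2 \<Rightarrow> real" where
  "dist_ell2 f g = norm (f - g)"
definition uniformity_ell2 :: "('a ell2 \<times> 'a ell2) filter" where
  "uniformity_ell2 = (INF e\<in>{0 <..}. principal {(x, y). dist x y < e})"
definition open_ell2 :: "'a ell2 set \<Rightarrow> bool" where
  "open_ell2 U \<longleftrightarrow> (\<forall>x\<in>U. eventually (\<lambda>(x', y). x' = x \<longrightarrow> y \<in> U) uniformity)"
instance
proof
  fix f g h :: "'a ell2" and r :: real and U :: "'a ell2 set"
  show "dist f g = norm (f - g)" by (rule dist_ell2_def)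
  show "sgn f = f /\<^sub>R norm f" by (rule sgn_ell2_def)
  show "(uniformity :: ('a ell2 \<times> 'a ell2) filter) = (INF e\<in>{0 <..}. principal {(x, y). dist x y < e})"
    by (rule uniformity_ell2_def)
  show "open U \<longleftrightarrow> (\<forall>x\<in>U. eventually (\<lambda>(x', y). x' = x \<longrightarrow> y \<in> U) uniformity)"
    by (rule open_ell2_def)
  show "f \<bullet> g = g \<bullet> f"
    unfolding inner_ell2_def by (simp add: inner_commute)
  show "(f + g) \<bullet> h = f \<bullet> h + g \<bullet> h"
    unfolding inner_ell2_def coord_simps inner_add_left
    by (intro infsum_add l2_inner_summable coord_l2)
  show "(r *\<^sub>R f) \<bullet> g = r * (f \<bullet> g)"
    unfolding inner_ell2_def coord_simps inner_scaleR_left by (rule infsum_cmult_right')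
  show "0 \<le> f \<bullet> f"
    unfolding inner_ell2_def by (intro infsum_nonneg) simp
  show "norm f = sqrt (f \<bullet> f)" by (rule norm_ell2_def)
  show "f \<bullet> f = 0 \<longleftrightarrow> f = 0"
  proof
    assume "f \<bullet> f = 0"
    have "coord f x = 0" for x
    proof -
      have "coord f x \<bullet> coord f x = 0"
        by (rule nonneg_infsum_le_0D[where A = UNIV and f = "\<lambda>x. coord f x \<bullet> coord f x"])
           (use \<open>f \<bullet> f = 0\<close> in \<open>auto simp: inner_ell2_def intro!: l2_inner_summable coord_l2\<close>)
      then show ?thesis by simp
    qed
    then show "f = 0" by (intro ell2_eqI) simp
  qed (simp add: inner_ell2_def)
qed
end

lemma inner_ell2_has_sum: "((\<lambda>x. coord f x \<bullet> coord g x) has_sum (f \<bullet> g)) UNIV"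
  unfolding inner_ell2_def by (intro has_sum_infsum l2_inner_summable coord_l2)

lemma norm_ell2_has_sum: "((\<lambda>x. (cmod (coord f x))\<^sup>2) has_sum (norm f)\<^sup>2) UNIV"
  using inner_ell2_has_sum[of f f] by (simp add: dot_square_norm)

lemma sum_coord_le_norm:
  assumes "finite F"
  shows "(\<Sum>x\<in>F. (cmod (coord f x))\<^sup>2) \<le> (norm f)\<^sup>2"
proof -
  have "(\<Sum>x\<in>F. (cmod (coord f x))\<^sup>2) \<le> infsum (\<lambda>x. (cmod (coord f x))\<^sup>2) UNIV"
    using coord_l2[of f] assms by (intro finite_sum_le_infsum) (auto simp: l2_def)
  then show ?thesis using infsumI[OF norm_ell2_has_sum[of f]] by simp
qed

lemma norm_coord_le: "cmod (coord f x) \<le> norm f"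
  by (rule power2_le_imp_le) (use sum_coord_le_norm[of "{x}" f] in simp_all)

lemma bounded_linear_coord: "bounded_linear (\<lambda>f. coord f x)"
  by (rule bounded_linear_intro[where K = 1]) (simp_all add: norm_coord_le)

text \<open>Control of finite partial sums survives pointwise limits, so this plays the role of
  Fatou's lemma in the proof of completeness.\<close>

lemma l2_norm_bound:
  assumes "\<And>F. finite F \<Longrightarrow> (\<Sum>x\<in>F. (cmod (f x))\<^sup>2) \<le> K\<^sup>2"
  shows "f \<in> l2" and "0 \<le> K \<Longrightarrow> norm (ell2_of f) \<le> K"
proof -
  show *: "f \<in> l2"
    unfolding l2_def mem_Collect_eq
    by (rule nonneg_bdd_above_summable_on) (auto intro!: bdd_aboveI assms)
  have "(norm (ell2_of f))\<^sup>2 \<le> K\<^sup>2"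
    using norm_ell2_has_sum[of "ell2_of f"] * assms
    by (auto simp: coord_ell2_of intro: has_sum_le_finite_sums)
  then show "0 \<le> K \<Longrightarrow> norm (ell2_of f) \<le> K"
    by (rule power2_le_imp_le)
qed

text \<open>Coordinates are bounded functionals, so a Cauchy sequence converges pointwise. The
  Cauchy estimate passes to the limit on each finite set and hence to the norm.\<close>

instance ell2 :: (type) banach
proof
  fix X :: "nat \<Rightarrow> 'a ell2"
  assume X: "Cauchy X"
  have "convergent (\<lambda>n. coord (X n) x)" for x
    using bounded_linear.Cauchy[OF bounded_linear_coord X] by (simp add: Cauchy_convergent)
  then obtain f where f: "\<And>x. (\<lambda>n. coord (X n) x) \<longlonglongrightarrow> f x"
    unfolding convergent_def by metis
  have key: "(\<lambda>x. coord (X n) x - f x) \<in> l2 \<and> norm (ell2_of (\<lambda>x. coord (X n) x - f x)) \<le> e"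
    if e: "0 < e" and M: "\<And>m. m \<ge> M \<Longrightarrow> norm (X n - X m) \<le> e" for n e M
  proof -
    have "(\<Sum>x\<in>F. (cmod (coord (X n) x - f x))\<^sup>2) \<le> e\<^sup>2" if "finite F" for F
    proof (rule LIMSEQ_le_const2)
      show "(\<lambda>m. \<Sum>x\<in>F. (cmod (coord (X n) x - coord (X m) x))\<^sup>2)
              \<longlonglongrightarrow> (\<Sum>x\<in>F. (cmod (coord (X n) x - f x))\<^sup>2)"
        by (intro tendsto_intros f)
      show "\<exists>N. \<forall>m\<ge>N. (\<Sum>x\<in>F. (cmod (coord (X n) x - coord (X m) x))\<^sup>2) \<le> e\<^sup>2"
      proof (intro exI allI impI)
        fix m assume "M \<le> m"
        have "(\<Sum>x\<in>F. (cmod (coord (X n) x - coord (X m) x))\<^sup>2) \<le> (norm (X n - X m))\<^sup>2"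
          using sum_coord_le_norm[OF that, of "X n - X m"] by simp
        also have "\<dots> \<le> e\<^sup>2" using M[OF \<open>M \<le> m\<close>] by (intro power_mono) auto
        finally show "(\<Sum>x\<in>F. (cmod (coord (X n) x - coord (X m) x))\<^sup>2) \<le> e\<^sup>2" .
      qed
    qed
    from l2_norm_bound[OF this] e show ?thesis by auto
  qed
  have ex: "\<exists>M. \<forall>n\<ge>M. \<forall>m\<ge>M. norm (X n - X m) \<le> e" if "0 < e" for e
    using CauchyD[OF X that] by (meson less_imp_le)
  obtain M where "\<forall>n\<ge>M. \<forall>m\<ge>M. norm (X n - X m) \<le> 1"
    using ex[of 1] by auto
  then have "(\<lambda>x. coord (X M) x - f x) \<in> l2"
    using key[of 1 M M] by auto
  then have "(\<lambda>x. f x - coord (X M) x) \<in> l2"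
    by (rule l2_dominated[where c = 1]) (simp add: norm_minus_commute)
  from l2_add[OF coord_l2[of "X M"] this] have fl2: "f \<in> l2" by simp
  have "X \<longlonglongrightarrow> ell2_of f"
  proof (rule LIMSEQ_I)
    fix r :: real assume "0 < r"
    then obtain M where M: "\<forall>n\<ge>M. \<forall>m\<ge>M. norm (X n - X m) \<le> r / 2"
      using ex[of "r / 2"] by auto
    have "norm (X n - ell2_of f) < r" if "n \<ge> M" for n
    proof -
      have k: "(\<lambda>x. coord (X n) x - f x) \<in> l2 \<and> norm (ell2_of (\<lambda>x. coord (X n) x - f x)) \<le> r / 2"
        using M that \<open>0 < r\<close> by (intro key[of _ M]) auto
      have eq: "X n - ell2_of f = ell2_of (\<lambda>x. coord (X n) x - f x)"
        by (rule ell2_eqI) (simp only: coord_simps coord_ell2_of[OF fl2] coord_ell2_of[OF conjunct1[OF k]])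
      show ?thesis unfolding eq using k \<open>0 < r\<close> by linarith
    qed
    then show "\<exists>no. \<forall>n\<ge>no. norm (X n - ell2_of f) < r" by blast
  qed
  then show "convergent X" by (auto simp: convergent_def)
qed

section \<open>Self-adjoint operators perturbed by vanishing potentials\<close>

text \<open>For a small step \<open>t\<close> the iteration \<open>f - t (T f - g)\<close> is a
  contraction: coercivity makes the term linear in \<open>t\<close> negative, and boundedness
  controls the quadratic one. No symmetry of \<open>T\<close> is involved, which matters for nonreal
  spectral parameters.\<close>

lemma lax_milgram:
  fixes T :: "'a::{real_inner,banach} \<Rightarrow> 'a"
  assumes T: "bounded_linear T" and c: "0 < c"
    and coercive: "\<And>f. c * (norm f)\<^sup>2 \<le> T f \<bullet> f"
  shows "\<exists>!f. T f = g"
proof -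
  interpret T: bounded_linear T by fact
  obtain K where K: "0 < K" "\<And>f. norm (T f) \<le> norm f * K"
    using T.pos_bounded by blast
  \<comment> \<open>With this step \<open>q = 1 - t c - (t c)^2\<close>, which is visibly below
    \<open>1\<close>.\<close>
  define t where "t = c / (K\<^sup>2 + c\<^sup>2)"
  define q where "q = 1 - 2 * t * c + t\<^sup>2 * K\<^sup>2"
  have pos: "0 < K\<^sup>2 + c\<^sup>2" using c by (simp add: add_nonneg_pos)
  then have t: "0 < t" using c by (simp add: t_def)
  have "t * (K\<^sup>2 + c\<^sup>2) = c" using pos by (simp add: t_def)
  then have "t\<^sup>2 * K\<^sup>2 + t\<^sup>2 * c\<^sup>2 = t * c" by (metis power2_eq_square distrib_left mult.assoc)
  then have q1: "q = (1 - t * c) - (t * c)\<^sup>2"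
    by (simp add: q_def power_mult_distrib algebra_simps)
  have "0 < t * c" using t c by simp
  then have "q < 1" using zero_le_power2[of "t * c"] unfolding q1 by linarith
  have est: "(norm (f - t *\<^sub>R T f))\<^sup>2 \<le> q * (norm f)\<^sup>2" for f
  proof -
    have "(norm (f - t *\<^sub>R T f))\<^sup>2 = (norm f)\<^sup>2 - 2 * t * (T f \<bullet> f) + t\<^sup>2 * (norm (T f))\<^sup>2"
      unfolding power2_norm_eq_inner
      by (simp add: inner_diff_left inner_diff_right inner_commute power2_eq_square algebra_simps)
    also have "\<dots> \<le> (norm f)\<^sup>2 - 2 * t * (c * (norm f)\<^sup>2) + t\<^sup>2 * (norm f * K)\<^sup>2"
      using t coercive[of f] K(2)[of f]
      by (intro add_mono diff_mono mult_left_mono power_mono) auto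
    also have "\<dots> = q * (norm f)\<^sup>2"
      by (simp add: q_def power_mult_distrib algebra_simps)
    finally show ?thesis .
  qed
  \<comment> \<open>By \<open>est\<close>, \<open>q\<close> can be negative only on the zero space;
    the maximum covers that case.\<close>
  define k where "k = sqrt (max q 0)"
  have k: "0 \<le> k" "k < 1" using \<open>q < 1\<close> by (auto simp: k_def)
  have est': "norm (f - t *\<^sub>R T f) \<le> k * norm f" for f
  proof (rule power2_le_imp_le)
    have "q * (norm f)\<^sup>2 \<le> max q 0 * (norm f)\<^sup>2" by (intro mult_right_mono) auto
    then show "(norm (f - t *\<^sub>R T f))\<^sup>2 \<le> (k * norm f)\<^sup>2"
      using est[of f] by (simp add: k_def power_mult_distrib)
  qed (use k in auto)
  have "\<exists>!f. f - t *\<^sub>R (T f - g) = f"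
  proof (rule banach_fix_type[OF k])
    show "\<forall>x y. dist (x - t *\<^sub>R (T x - g)) (y - t *\<^sub>R (T y - g)) \<le> k * dist x y"
    proof (intro allI)
      fix x y
      have eq: "(x - t *\<^sub>R (T x - g)) - (y - t *\<^sub>R (T y - g)) = (x - y) - t *\<^sub>R T (x - y)"
        by (simp add: T.diff algebra_simps)
      show "dist (x - t *\<^sub>R (T x - g)) (y - t *\<^sub>R (T y - g)) \<le> k * dist x y"
        unfolding dist_norm eq by (rule est')
    qed
  qed
  then show ?thesis using t by simp
qed

text \<open>Positivity at \<open>f - t P f\<close> with \<open>t = 1 / M\<close> gives
  \<open>P^2 \<le> M P\<close>. It turns a small form value into a small vector, so that extremising
  sequences become approximate eigenvectors.\<close>

lemma positive_operator_norm_le: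
  fixes P :: "'a::real_inner \<Rightarrow> 'a"
  assumes "bounded_linear P" and sym: "\<And>f g. P f \<bullet> g = f \<bullet> P g" and pos: "\<And>f. 0 \<le> P f \<bullet> f"
  obtains M where "0 < M" "\<And>f. (norm (P f))\<^sup>2 \<le> M * (P f \<bullet> f)"
proof -
  interpret P: bounded_linear P by fact
  obtain M where M: "0 < M" "\<And>f. norm (P f) \<le> norm f * M" using P.pos_bounded by blast
  have "(norm (P f))\<^sup>2 \<le> M * (P f \<bullet> f)" for f
  proof -
    define g where "g = P f"
    define t where "t = 1 / M"
    have "0 \<le> P (f - t *\<^sub>R g) \<bullet> (f - t *\<^sub>R g)" by (rule pos)
    also have "\<dots> = g \<bullet> f - 2 * t * (norm g)\<^sup>2 + t\<^sup>2 * (P g \<bullet> g)"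
    proof -
      have "P g \<bullet> f = (norm g)\<^sup>2" by (simp add: sym g_def dot_square_norm)
      then show ?thesis
        by (simp add: P.diff P.scaleR inner_diff_left inner_diff_right g_def[symmetric]
            dot_square_norm power2_eq_square[of t] algebra_simps)
    qed
    also have "P g \<bullet> g \<le> M * (norm g)\<^sup>2"
      using norm_cauchy_schwarz[of "P g" g] mult_right_mono[OF M(2)[of g] norm_ge_zero[of g]]
      by (simp add: power2_eq_square algebra_simps)
    then have "t\<^sup>2 * (P g \<bullet> g) \<le> t\<^sup>2 * (M * (norm g)\<^sup>2)" by (intro mult_left_mono) auto
    also have "\<dots> = t * (norm g)\<^sup>2" using M(1) by (simp add: t_def power2_eq_square)
    finally have "t * (norm g)\<^sup>2 \<le> g \<bullet> f" by simp
    then show ?thesis using M(1) by (simp add: t_def g_def divide_le_eq mult.commute)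
  qed
  with M(1) show thesis using that by blast
qed

lemma convergent_subsequence_on_finite:
  fixes f :: "nat \<Rightarrow> 'a \<Rightarrow> 'b::heine_borel"
  assumes "finite S" and "\<And>x. x \<in> S \<Longrightarrow> bounded (range (\<lambda>n. f n x))"
  shows "\<exists>r::nat \<Rightarrow> nat. strict_mono r \<and> (\<forall>x\<in>S. convergent (\<lambda>n. f (r n) x))"
  using assms
proof (induction S rule: finite_induct)
  case empty
  then show ?case by (intro exI[of _ id]) (auto simp: strict_mono_def)
next
  case (insert x S)
  then obtain r :: "nat \<Rightarrow> nat" where r: "strict_mono r" "\<forall>x\<in>S. convergent (\<lambda>n. f (r n) x)"
    by auto
  have "bounded (range (\<lambda>n. f (r n) x))"
    by (rule bounded_subset[OF insert.prems[of x]]) auto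
  then obtain l s where s: "strict_mono (s::nat \<Rightarrow> nat)" "((\<lambda>n. f (r n) x) \<circ> s) \<longlonglongrightarrow> l"
    using bounded_imp_convergent_subsequence by blast
  have "convergent (\<lambda>n. f ((r \<circ> s) n) y)" if "y \<in> insert x S" for y
  proof (cases "y = x")
    case True
    then show ?thesis using s(2) by (auto simp: convergent_def comp_def)
  next
    case False
    then have "convergent ((\<lambda>n. f (r n) y) \<circ> s)"
      using that r(2) s(1) by (intro convergent_subseq_convergent) auto
    then show ?thesis by (simp add: comp_def)
  qed
  then show ?case using strict_mono_o[OF r(1) s(1)] by blast
qed

text \<open>The type is a real vector space only; multiplication by a complex number is kept as an
  operator. It serves nonreal spectral parameters and combinations of eigenvectors in which a
  complex value at \<open>0\<close> cancels.\<close>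

lift_definition cmul :: "complex \<Rightarrow> 'a ell2 \<Rightarrow> 'a ell2" is "\<lambda>c f x. c * f x"
  subgoal for c f by (erule l2_dominated[where c = "cmod c"]) (simp add: norm_mult)
  done

lemma coord_cmul [simp]: "coord (cmul c f) x = c * coord f x"
  by transfer simp

lemma norm_cmul: "norm (cmul c f) = cmod c * norm f"
proof -
  have "((\<lambda>x. (cmod c)\<^sup>2 * (cmod (coord f x))\<^sup>2) has_sum (cmod c)\<^sup>2 * (norm f)\<^sup>2) UNIV"
    by (intro has_sum_cmult_right norm_ell2_has_sum)
  moreover have "((\<lambda>x. (cmod c)\<^sup>2 * (cmod (coord f x))\<^sup>2) has_sum (norm (cmul c f))\<^sup>2) UNIV"
    using norm_ell2_has_sum[of "cmul c f"] by (simp add: norm_mult power_mult_distrib)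
  ultimately have "(norm (cmul c f))\<^sup>2 = (cmod c * norm f)\<^sup>2"
    using has_sum_unique by (auto simp: power_mult_distrib)
  then show ?thesis by (rule power2_eq_imp_eq) auto
qed

lemma bounded_linear_cmul: "bounded_linear (cmul c)"
  by (rule bounded_linear_intro[where K = "cmod c"])
     (auto intro!: ell2_eqI simp: algebra_simps norm_cmul)

lemma inner_cmul_left: "cmul c f \<bullet> g = f \<bullet> cmul (cnj c) g"
  unfolding inner_ell2_def by (auto intro!: infsum_cong simp: inner_complex_def algebra_simps)

lemma cmul_of_real: "cmul (complex_of_real r) f = r *\<^sub>R f"
  by (rule ell2_eqI) (simp add: scaleR_conv_of_real)

lemma inner_cmul_self: "cmul c f \<bullet> f = Re c * (norm f)\<^sup>2"
proof (rule has_sum_unique[OF inner_ell2_has_sum])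
  have "(c * w) \<bullet> w = Re c * (cmod w)\<^sup>2" for w
    by (simp only: cmod_power2) (simp add: inner_complex_def power2_eq_square algebra_simps)
  then show "((\<lambda>x. coord (cmul c f) x \<bullet> coord f x) has_sum Re c * (norm f)\<^sup>2) UNIV"
    using has_sum_cmult_right[OF norm_ell2_has_sum[of f], of "Re c"] by simp
qed

text \<open>Evaluation on \<open>S\<close> is injective on \<open>V\<close>. The induction is
  Gaussian elimination: one \<open>g\<close> with \<open>g s \<noteq> 0\<close> reduces every
  element of \<open>V\<close> to the subspace of functions vanishing at \<open>s\<close>.\<close>

lemma fin_dim_fun_spaceI:
  assumes "finite S"
    and "\<And>f g c. f \<in> V \<Longrightarrow> g \<in> V \<Longrightarrow> (\<lambda>x. f x - c * g x) \<in> V"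
    and "\<And>f. f \<in> V \<Longrightarrow> \<forall>x\<in>S. f x = 0 \<Longrightarrow> f = (\<lambda>_. 0)"
  shows "fin_dim_fun_space V"
  using assms
proof (induction S arbitrary: V rule: finite_induct)
  case empty
  then show ?case unfolding fin_dim_fun_space_def by (intro exI[of _ "{}"]) auto
next
  case (insert s S)
  define W where "W = {f \<in> V. f s = 0}"
  have "fin_dim_fun_space W"
    using insert.prems by (intro insert.IH) (auto simp: W_def)
  then obtain B where B: "finite B" "W \<subseteq> {(\<lambda>x. \<Sum>b\<in>B. c b * b x) | c. True}"
    unfolding fin_dim_fun_space_def by blast
  show ?case
  proof (cases "V \<subseteq> W")
    case True
    then show ?thesis using B unfolding fin_dim_fun_space_def by blast
  next
    case False
    then obtain g where g: "g \<in> V" "g s \<noteq> 0" by (auto simp: W_def)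
    have "\<exists>c. f = (\<lambda>x. \<Sum>b\<in>insert g B. c b * b x)" if f: "f \<in> V" for f
    proof -
      define k where "k = f s / g s"
      have "f s = k * g s" using g(2) by (simp add: k_def)
      then have "(\<lambda>x. f x - k * g x) \<in> W"
        using insert.prems(1)[OF f g(1), of k] by (simp add: W_def)
      then obtain c where c: "\<And>x. f x - k * g x = (\<Sum>b\<in>B. c b * b x)"
        using B(2) by (auto dest!: subsetD simp: fun_eq_iff)
      \<comment> \<open>\<open>g\<close> may already belong to \<open>B\<close>, so the two
        coefficients are added instead of chosen by cases.\<close>
      have "f x = (\<Sum>b\<in>insert g B. ((if b \<in> B then c b else 0) + (if b = g then k else 0)) * b x)" for x
      proof -
        have "(\<Sum>b\<in>insert g B. (if b \<in> B then c b else 0) * b x) = (\<Sum>b\<in>B. c b * b x)"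
          using B(1) by (intro sum.mono_neutral_cong_right) auto
        moreover have "(\<Sum>b\<in>insert g B. (if b = g then k else 0) * b x) = k * g x"
          using B(1) by (simp add: if_distrib[where f = "\<lambda>t. t * _"] sum.delta cong: if_cong)
        ultimately show ?thesis
          using c[of x] by (simp add: distrib_right sum.distrib algebra_simps)
      qed
      then show ?thesis by (intro exI[of _ "\<lambda>b. (if b \<in> B then c b else 0) + (if b = g then k else 0)"] ext)
    qed
    then show ?thesis using B(1) unfolding fin_dim_fun_space_def
      by (intro exI[of _ "insert g B"]) blast
  qed
qed

text \<open>\<open>v_vanish\<close> carries the compactness: outside a finite set the potential is
  as small as desired. \<open>Hf\<close> is the same operator on plain functions, to which
  \<open>op_spectrum\<close> and \<open>disc_spectrum\<close> apply.\<close>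

locale compact_perturbation =
  fixes H0 :: "'a ell2 \<Rightarrow> 'a ell2" and H :: "'a ell2 \<Rightarrow> 'a ell2" and v :: "'a \<Rightarrow> real"
    and a :: real and Hf :: "('a \<Rightarrow> complex) \<Rightarrow> ('a \<Rightarrow> complex)"
  assumes bl_H0: "bounded_linear H0"
    and sym_H0: "\<And>f g. H0 f \<bullet> g = f \<bullet> H0 g"
    and cmul_H0: "\<And>c f. H0 (cmul c f) = cmul c (H0 f)"
    and H0_le: "\<And>f. H0 f \<bullet> f \<le> a * (norm f)\<^sup>2"
    and v_vanish: "\<And>e. 0 < e \<Longrightarrow> finite {x. e \<le> \<bar>v x\<bar>}"
    and coord_H: "\<And>f x. coord (H f) x = coord (H0 f) x + v x * coord f x"
    and Hf: "\<And>f. Hf (coord f) = coord (H f)"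
begin

lemma v_bounded: obtains B where "0 < B" "\<And>x. \<bar>v x\<bar> \<le> B"
proof
  define B where "B = 1 + (\<Sum>x\<in>{x. 1 \<le> \<bar>v x\<bar>}. \<bar>v x\<bar>)"
  have fin: "finite {x. 1 \<le> \<bar>v x\<bar>}" using v_vanish[of 1] by simp
  show "0 < B" by (auto simp: B_def intro!: add_pos_nonneg sum_nonneg)
  show "\<bar>v x\<bar> \<le> B" for x
  proof (cases "1 \<le> \<bar>v x\<bar>")
    case True
    then have "\<bar>v x\<bar> \<le> (\<Sum>x\<in>{x. 1 \<le> \<bar>v x\<bar>}. \<bar>v x\<bar>)"
      using fin by (intro member_le_sum) auto
    then show ?thesis by (simp add: B_def)
  next
    case False
    have "0 \<le> (\<Sum>x\<in>{x. 1 \<le> \<bar>v x\<bar>}. \<bar>v x\<bar>)" by (intro sum_nonneg) auto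
    with False show ?thesis unfolding B_def by linarith
  qed
qed

lemma coord_H_diff: "coord (H f - H0 f) x = v x * coord f x"
  by (simp add: coord_H)

lemma bl_H: "bounded_linear H"
proof -
  interpret H0: bounded_linear H0 by (rule bl_H0)
  obtain B where B: "0 < B" "\<And>x. \<bar>v x\<bar> \<le> B" using v_bounded by blast
  have *: "norm (H f - H0 f) \<le> norm f * B" for f
  proof (rule power2_le_imp_le)
    show "(norm (H f - H0 f))\<^sup>2 \<le> (norm f * B)\<^sup>2"
    proof (rule has_sum_mono[OF norm_ell2_has_sum[of "H f - H0 f"]])
      show "((\<lambda>x. B\<^sup>2 * (cmod (coord f x))\<^sup>2) has_sum (norm f * B)\<^sup>2) UNIV"
        using has_sum_cmult_right[OF norm_ell2_has_sum[of f], of "B\<^sup>2"]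
        by (simp add: power_mult_distrib mult.commute)
      show "(cmod (coord (H f - H0 f) x))\<^sup>2 \<le> B\<^sup>2 * (cmod (coord f x))\<^sup>2" for x
        unfolding coord_H_diff norm_mult power_mult_distrib
        using power_mono[OF B(2)[of x], of 2] by (intro mult_right_mono) auto
    qed
  qed (use B in auto)
  have "bounded_linear (\<lambda>f. H f - H0 f)"
    by (rule bounded_linear_intro[OF _ _ *]) (auto intro!: ell2_eqI simp: coord_H H0.add H0.scaleR algebra_simps)
  from bounded_linear_add[OF this bl_H0] show ?thesis by simp
qed

sublocale H: bounded_linear H by (rule bl_H)

lemma cmul_H: "H (cmul c f) = cmul c (H f)"
  by (rule ell2_eqI) (simp add: coord_H cmul_H0 algebra_simps)

lemma sym_H: "H f \<bullet> g = f \<bullet> H g"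
proof -
  have "(H f - H0 f) \<bullet> g = f \<bullet> (H g - H0 g)"
    unfolding inner_ell2_def coord_H_diff
    by (auto intro!: infsum_cong simp: inner_complex_def)
  then show ?thesis by (simp add: inner_diff_left inner_diff_right sym_H0)
qed

lemma v_form_has_sum:
  "((\<lambda>x. v x * (cmod (coord f x))\<^sup>2) has_sum (H f \<bullet> f - H0 f \<bullet> f)) UNIV"
  using inner_ell2_has_sum[of "H f - H0 f" f] unfolding coord_H_diff inner_diff_left
  by (simp add: scaleR_conv_of_real[symmetric] dot_square_norm)

text \<open>\<open>l - H0\<close> is bounded below by \<open>l - a = 2 c\<close>. Where
  \<open>v\<close> stays below \<open>c\<close> it consumes at most half of this; the finitely many
  remaining points are charged to the sum over \<open>S\<close>. This inequality is how the
  compactness of \<open>v\<close> is used.\<close>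

lemma coercive_off_finite_set:
  assumes "a < l"
  obtains S c K where "finite S" "0 < c" "0 < K"
    "\<And>f. c * (norm f)\<^sup>2 \<le> (l *\<^sub>R f - H f) \<bullet> f + K * (\<Sum>x\<in>S. (cmod (coord f x))\<^sup>2)"
proof -
  define c where "c = (l - a) / 2"
  have c: "0 < c" using assms by (simp add: c_def)
  define S where "S = {x. c \<le> \<bar>v x\<bar>}"
  have S: "finite S" unfolding S_def using c by (rule v_vanish)
  obtain B where B: "0 < B" "\<And>x. \<bar>v x\<bar> \<le> B" using v_bounded by blast
  have "c * (norm f)\<^sup>2 \<le> (l *\<^sub>R f - H f) \<bullet> f + B * (\<Sum>x\<in>S. (cmod (coord f x))\<^sup>2)" for f
  proof -
    have "((\<lambda>x. if x \<in> S then B * (cmod (coord f x))\<^sup>2 else 0)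
            has_sum B * (\<Sum>x\<in>S. (cmod (coord f x))\<^sup>2)) UNIV"
      unfolding sum_distrib_left
      by (rule has_sum_finite_neutralI[OF S]) (auto intro: sum.cong)
    then have rhs: "((\<lambda>x. c * (cmod (coord f x))\<^sup>2 + (if x \<in> S then B * (cmod (coord f x))\<^sup>2 else 0))
            has_sum c * (norm f)\<^sup>2 + B * (\<Sum>x\<in>S. (cmod (coord f x))\<^sup>2)) UNIV"
      by (intro has_sum_add has_sum_cmult_right norm_ell2_has_sum)
    have "H f \<bullet> f - H0 f \<bullet> f \<le> c * (norm f)\<^sup>2 + B * (\<Sum>x\<in>S. (cmod (coord f x))\<^sup>2)"
    proof (rule has_sum_mono[OF v_form_has_sum rhs])
      fix x
      show "v x * (cmod (coord f x))\<^sup>2 \<le> c * (cmod (coord f x))\<^sup>2 + (if x \<in> S then B * (cmod (coord f x))\<^sup>2 else 0)"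
      proof (cases "x \<in> S")
        case True
        have "v x * (cmod (coord f x))\<^sup>2 \<le> (c + B) * (cmod (coord f x))\<^sup>2"
          using B(2)[of x] c by (intro mult_right_mono) auto
        with True show ?thesis by (simp add: algebra_simps)
      next
        case False
        then have "v x * (cmod (coord f x))\<^sup>2 \<le> c * (cmod (coord f x))\<^sup>2"
          by (intro mult_right_mono) (auto simp: S_def)
        with False show ?thesis by simp
      qed
    qed
    moreover have "l * (norm f)\<^sup>2 - a * (norm f)\<^sup>2 = 2 * (c * (norm f)\<^sup>2)"
      by (simp add: c_def algebra_simps)
    moreover have "(l *\<^sub>R f - H f) \<bullet> f = l * (norm f)\<^sup>2 - H f \<bullet> f"
      by (simp add: inner_diff_left dot_square_norm)
    ultimately show ?thesis using H0_le[of f] by linarith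
  qed
  with S c B(1) show thesis using that by blast
qed

text \<open>On the finite set \<open>S\<close> the coordinates converge along a subsequence.
  Coercivity applied to differences of its members then makes it Cauchy in norm.\<close>

lemma palais_smale:
  fixes f :: "nat \<Rightarrow> 'a ell2"
  assumes "a < l" and bdd: "\<And>n. norm (f n) \<le> 1"
    and lim: "(\<lambda>n. l *\<^sub>R f n - H (f n)) \<longlonglongrightarrow> 0"
  shows "\<exists>r::nat \<Rightarrow> nat. strict_mono r \<and> convergent (f \<circ> r)"
proof -
  obtain S c K where S: "finite S" and c: "0 < c" and K: "0 < K" and
    coer: "\<And>f. c * (norm f)\<^sup>2 \<le> (l *\<^sub>R f - H f) \<bullet> f + K * (\<Sum>x\<in>S. (cmod (coord f x))\<^sup>2)"
    using coercive_off_finite_set[OF \<open>a < l\<close>] by metis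
  have "bounded (range (\<lambda>n. coord (f n) x))" for x
    by (rule boundedI[of _ 1]) (use order_trans[OF norm_coord_le bdd] in auto)
  then obtain r :: "nat \<Rightarrow> nat" where r: "strict_mono r" "\<forall>x\<in>S. convergent (\<lambda>n. coord (f (r n)) x)"
    using convergent_subsequence_on_finite[OF S, of "\<lambda>n. coord (f n)"] by auto
  define g where "g = f \<circ> r"
  have g1: "norm (g n) \<le> 1" for n using bdd by (simp add: g_def)
  define P where "P f = l *\<^sub>R f - H f" for f
  have P_diff: "P (f - g) = P f - P g" for f g by (simp add: P_def H.diff algebra_simps)
  have Pg: "(\<lambda>n. P (g n)) \<longlonglongrightarrow> 0"
    using LIMSEQ_subseq_LIMSEQ[OF lim r(1)] by (simp add: g_def P_def comp_def)
  have Cx: "Cauchy (\<lambda>n. coord (g n) x)" if "x \<in> S" for x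
    using r(2) that by (auto simp: g_def convergent_Cauchy)
  have "Cauchy g"
  proof (rule CauchyI)
    fix e :: real assume e: "0 < e"
    \<comment> \<open>The form contributes at most \<open>4 d = c e^2 / 2\<close> and the
      coordinates less than the other half. The \<open>1\<close> in \<open>b\<close> keeps the
      divisor positive when \<open>S\<close> is empty.\<close>
    define d where "d = c * e\<^sup>2 / 8"
    define b where "b = 1 + real (card S)"
    have b: "0 < b" by (simp add: b_def)
    define D where "D = c * e\<^sup>2 / (4 * K * b)"
    have d: "0 < d" using c e by (simp add: d_def)
    have D: "0 < D" using c e K b by (simp add: D_def)
    obtain N where N: "\<And>n. n \<ge> N \<Longrightarrow> norm (P (g n)) < d"
      using LIMSEQ_D[OF Pg d] by auto
    have "\<forall>x\<in>S. \<exists>M. \<forall>m\<ge>M. \<forall>n\<ge>M. norm (coord (g m) x - coord (g n) x) < sqrt D"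
      using CauchyD[OF Cx] D by simp
    then obtain M where M: "\<And>x m n. x \<in> S \<Longrightarrow> m \<ge> M x \<Longrightarrow> n \<ge> M x \<Longrightarrow> norm (coord (g m) x - coord (g n) x) < sqrt D"
      by metis
    define M' where "M' = max N (Max (insert 0 (M ` S)))"
    have "norm (g m - g n) < e" if mn: "m \<ge> M'" "n \<ge> M'" for m n
    proof -
      have MS: "M x \<le> M'" if "x \<in> S" for x
        unfolding M'_def using S that by (intro max.coboundedI2 Max_ge) auto
      have "norm (P (g m - g n)) \<le> d + d"
        unfolding P_diff using mn N[of m] N[of n] norm_triangle_ineq4[of "P (g m)" "P (g n)"]
        by (simp add: M'_def)
      moreover have "norm (g m - g n) \<le> 2"
        using norm_triangle_ineq4[of "g m" "g n"] g1[of m] g1[of n] by simp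
      ultimately have "norm (P (g m - g n)) * norm (g m - g n) \<le> (d + d) * 2"
        using d by (intro mult_mono) auto
      then have "P (g m - g n) \<bullet> (g m - g n) \<le> (d + d) * 2"
        using norm_cauchy_schwarz[of "P (g m - g n)" "g m - g n"] by linarith
      moreover have "(\<Sum>x\<in>S. (cmod (coord (g m - g n) x))\<^sup>2) \<le> (\<Sum>x\<in>S. D)"
      proof (rule sum_mono)
        fix x assume "x \<in> S"
        then have "cmod (coord (g m - g n) x) \<le> sqrt D"
          using M[of x m n] MS[of x] mn by (simp add: less_imp_le)
        then have "(cmod (coord (g m - g n) x))\<^sup>2 \<le> (sqrt D)\<^sup>2" by (intro power_mono) auto
        then show "(cmod (coord (g m - g n) x))\<^sup>2 \<le> D" using D by simp
      qed
      then have "K * (\<Sum>x\<in>S. (cmod (coord (g m - g n) x))\<^sup>2) \<le> K * (card S * D)"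
        using K by (intro mult_left_mono) auto
      moreover have "K * (card S * D) < c * e\<^sup>2 / 4 + c * e\<^sup>2 / 4"
      proof -
        have "K * (card S * D) \<le> K * (b * D)"
          using K D by (intro mult_left_mono mult_right_mono) (auto simp: b_def)
        also have "\<dots> = c * e\<^sup>2 / 4" using K b by (simp add: D_def field_simps)
        finally show ?thesis using c e by (smt (verit) divide_pos_pos mult_pos_pos zero_less_power)
      qed
      ultimately have "c * (norm (g m - g n))\<^sup>2 < c * e\<^sup>2"
        using coer[of "g m - g n"] unfolding P_def[symmetric] d_def by (simp add: field_simps)
      then have "(norm (g m - g n))\<^sup>2 < e\<^sup>2" using c by simp
      then show ?thesis using e by (simp add: power2_less_imp_less)
    qed
    then show "\<exists>M. \<forall>m\<ge>M. \<forall>n\<ge>M. norm (g m - g n) < e" by blast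
  qed
  then show ?thesis using r(1) Cauchy_convergent unfolding g_def by blast
qed

lemma unit_approximate_eigenvectors:
  fixes f :: "nat \<Rightarrow> 'a ell2"
  assumes "a < l" and unit: "\<And>n. norm (f n) = 1"
    and lim: "(\<lambda>n. l *\<^sub>R f n - H (f n)) \<longlonglongrightarrow> 0"
  obtains r :: "nat \<Rightarrow> nat" and g where "(\<lambda>n. f (r n)) \<longlonglongrightarrow> g" "norm g = 1" "H g = l *\<^sub>R g"
proof -
  obtain r :: "nat \<Rightarrow> nat" where r: "strict_mono r" "convergent (f \<circ> r)"
    using palais_smale[OF \<open>a < l\<close> _ lim] unit by auto
  then obtain g where g: "(\<lambda>n. f (r n)) \<longlonglongrightarrow> g"
    by (auto simp: convergent_def comp_def)
  have "norm g = 1"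
    using LIMSEQ_unique[OF tendsto_norm[OF g]] unit by simp
  moreover have "(\<lambda>n. l *\<^sub>R f (r n) - H (f (r n))) \<longlonglongrightarrow> l *\<^sub>R g - H g"
    by (intro tendsto_intros H.tendsto g)
  from LIMSEQ_unique[OF this] have "l *\<^sub>R g - H g = 0"
    using LIMSEQ_subseq_LIMSEQ[OF lim r(1)] by (auto simp: comp_def)
  ultimately show thesis using that g by simp
qed

section \<open>Spectrum and discrete spectrum above the form bound\<close>

lemma op_spectrum_iff: "z \<in> op_spectrum Hf \<longleftrightarrow> \<not> (\<forall>g. \<exists>!f. H f - cmul z f = g)"
proof -
  have *: "(\<exists>!u. u \<in> l2 \<and> (\<forall>x. Hf u x - z * u x = coord g x)) \<longleftrightarrow> (\<exists>!f. H f - cmul z f = g)" for g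
  proof -
    have eq: "(\<forall>x. Hf (coord f) x - z * coord f x = coord g x) \<longleftrightarrow> H f - cmul z f = g" for f
      by (auto intro: ell2_eqI simp: Hf)
    show ?thesis
    proof
      assume "\<exists>!u. u \<in> l2 \<and> (\<forall>x. Hf u x - z * u x = coord g x)"
      then obtain u where u: "u \<in> l2" "\<forall>x. Hf u x - z * u x = coord g x"
        and un: "\<And>w. w \<in> l2 \<Longrightarrow> (\<forall>x. Hf w x - z * w x = coord g x) \<Longrightarrow> w = u" by metis
      show "\<exists>!f. H f - cmul z f = g"
      proof
        show "H (ell2_of u) - cmul z (ell2_of u) = g"
          using u by (subst eq[symmetric]) (simp add: coord_ell2_of)
        show "f = ell2_of u" if "H f - cmul z f = g" for f
          using un[OF coord_l2, of f] that by (metis eq coord_inverse)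
      qed
    next
      assume "\<exists>!f. H f - cmul z f = g"
      then obtain f where f: "H f - cmul z f = g" and un: "\<And>h. H h - cmul z h = g \<Longrightarrow> h = f" by metis
      show "\<exists>!u. u \<in> l2 \<and> (\<forall>x. Hf u x - z * u x = coord g x)"
      proof
        show "coord f \<in> l2 \<and> (\<forall>x. Hf (coord f) x - z * coord f x = coord g x)"
          using f by (simp add: eq coord_l2)
        fix w assume w: "w \<in> l2 \<and> (\<forall>x. Hf w x - z * w x = coord g x)"
        then have "H (ell2_of w) - cmul z (ell2_of w) = g"
          by (subst eq[symmetric]) (simp add: coord_ell2_of)
        then show "w = coord f" using un w by (metis coord_ell2_of)
      qed
    qed
  qed
  have "(\<forall>g\<in>l2. Q g) \<longleftrightarrow> (\<forall>g::'a ell2. Q (coord g))" for Q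
    by (metis coord_ell2_of coord_l2)
  then show ?thesis unfolding op_spectrum_def mem_Collect_eq by (simp only: *)
qed

text \<open>Multiplying \<open>H - z\<close> by \<open>i Im z\<close> removes the contribution of
  the symmetric \<open>H\<close> from the real form and leaves exactly \<open>(Im z)^2\<close> times
  the squared norm, so the product is coercive.\<close>

lemma nonreal_notin_spectrum:
  assumes "Im z \<noteq> 0"
  shows "z \<notin> op_spectrum Hf"
proof -
  define w where "w = \<i> * complex_of_real (Im z)"
  have w: "w \<noteq> 0" using assms by (simp add: w_def)
  have inj: "cmul w f = cmul w g \<longleftrightarrow> f = g" for f g
    using w by (metis coord_cmul ell2_eqI mult_left_cancel)
  have "\<exists>!f. cmul w (H f - cmul z f) = cmul w g" for g
  proof (rule lax_milgram)
    show "bounded_linear (\<lambda>f. cmul w (H f - cmul z f))"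
      by (intro bounded_linear_compose[OF bounded_linear_cmul] bounded_linear_sub bl_H bounded_linear_cmul)
    show "0 < (Im z)\<^sup>2" using assms by simp
    show "(Im z)\<^sup>2 * (norm f)\<^sup>2 \<le> cmul w (H f - cmul z f) \<bullet> f" for f
    proof -
      have "cmul w (H f) \<bullet> f = H (cmul w f) \<bullet> f" by (simp add: cmul_H)
      also have "\<dots> = f \<bullet> cmul (cnj w) (H f)" by (simp add: sym_H inner_cmul_left)
      also have "\<dots> = cmul (cnj w) (H f) \<bullet> f" by (rule inner_commute)
      also have "cmul (cnj w) (H f) = - cmul w (H f)" by (rule ell2_eqI) (simp add: w_def)
      finally have "cmul w (H f) \<bullet> f = 0" by simp
      moreover have "cmul w (cmul z f) = cmul (w * z) f" by (rule ell2_eqI) simp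
      ultimately show ?thesis
        by (simp add: linear_diff[OF bounded_linear.linear[OF bounded_linear_cmul]]
            inner_diff_left inner_cmul_self w_def power2_eq_square)
    qed
  qed
  then show ?thesis unfolding op_spectrum_iff inj by blast
qed

text \<open>A Fredholm alternative: if \<open>H - l\<close> were not bounded below, normalised
  violators would be approximate eigenvectors, and by \<open>palais_smale\<close> a subsequence
  would converge to an eigenvector.\<close>

lemma spectrum_above_iff:
  assumes "a < l"
  shows "complex_of_real l \<in> op_spectrum Hf \<longleftrightarrow> (\<exists>f. f \<noteq> 0 \<and> H f = l *\<^sub>R f)"
proof
  assume "\<exists>f. f \<noteq> 0 \<and> H f = l *\<^sub>R f"
  then obtain f where f: "f \<noteq> 0" "H f = l *\<^sub>R f" by blast
  have "\<not> (\<exists>!f. H f - cmul (complex_of_real l) f = 0)"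
    using f by (metis H.zero cmul_of_real diff_self scaleR_zero_right)
  then show "complex_of_real l \<in> op_spectrum Hf" unfolding op_spectrum_iff by blast
next
  assume spec: "complex_of_real l \<in> op_spectrum Hf"
  show "\<exists>f. f \<noteq> 0 \<and> H f = l *\<^sub>R f"
  proof (rule ccontr)
    assume none: "\<not> ?thesis"
    define P where "P f = H f - l *\<^sub>R f" for f
    have blP: "bounded_linear P"
      unfolding P_def by (intro bounded_linear_sub bl_H bounded_linear_scaleR_right)
    interpret P: bounded_linear P by (rule blP)
    have "\<exists>c>0. \<forall>f. c * norm f \<le> norm (P f)"
    proof (rule ccontr)
      assume "\<not> ?thesis"
      then have "\<forall>n. \<exists>f. norm (P f) < inverse (real (Suc n)) * norm f"
        by (meson inverse_positive_iff_positive not_le of_nat_0_less_iff zero_less_Suc)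
      then obtain f where f: "\<And>n. norm (P (f n)) < inverse (real (Suc n)) * norm (f n)" by metis
      have f0: "0 < norm (f n)" for n
        using le_less_trans[OF norm_ge_zero f[of n]] by (auto simp: zero_less_mult_iff)
      define g where "g n = f n /\<^sub>R norm (f n)" for n
      have "norm (g n) = 1" for n using f0[of n] by (simp add: g_def)
      moreover have "(\<lambda>n. l *\<^sub>R g n - H (g n)) \<longlonglongrightarrow> 0"
      proof (rule tendsto_norm_zero_cancel, rule tendsto_sandwich[OF _ _ tendsto_const LIMSEQ_inverse_real_of_nat])
        have "norm (l *\<^sub>R g n - H (g n)) \<le> inverse (real (Suc n))" for n
        proof -
          have "norm (l *\<^sub>R g n - H (g n)) = norm (P (g n))" by (simp add: P_def norm_minus_commute)
          also have "\<dots> = norm (P (f n)) / norm (f n)"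
            by (simp add: g_def P.scaleR divide_inverse mult.commute)
          also have "\<dots> \<le> inverse (real (Suc n))"
            using f[of n] f0[of n] by (simp add: divide_le_eq)
          finally show ?thesis .
        qed
        then show "\<forall>\<^sub>F n in sequentially. norm (l *\<^sub>R g n - H (g n)) \<le> inverse (real (Suc n))" by simp
      qed simp
      ultimately obtain h where "norm h = 1" "H h = l *\<^sub>R h"
        using unit_approximate_eigenvectors[OF \<open>a < l\<close>, of g] by blast
      then show False using none by (metis norm_zero zero_neq_one)
    qed
    then obtain c where c: "0 < c" "\<And>f. c * norm f \<le> norm (P f)" by blast
    have symP: "P f \<bullet> g = f \<bullet> P g" for f g
      by (simp add: P_def inner_diff_left inner_diff_right sym_H)
    (* P is symmetric and bounded below, so its square is coercive; this gives surjectivity. *)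
    have "\<exists>!f. P (P f) = g" for g
    proof (rule lax_milgram)
      show "bounded_linear (\<lambda>f. P (P f))" by (intro bounded_linear_compose[OF blP blP])
      show "0 < c\<^sup>2" using c by simp
      show "c\<^sup>2 * (norm f)\<^sup>2 \<le> P (P f) \<bullet> f" for f
        using power_mono[OF c(2)[of f], of 2] c(1)
        by (simp add: symP power_mult_distrib dot_square_norm)
    qed
    moreover have "f = g" if "P f = P g" for f g
    proof -
      have "P (f - g) = 0" using that by (simp add: P.diff)
      then have "norm (f - g) \<le> 0" using c(2)[of "f - g"] c(1) by (simp add: mult_le_0_iff)
      then show ?thesis by simp
    qed
    ultimately have "\<forall>g. \<exists>!f. P f = g" by metis
    then show False using spec unfolding op_spectrum_iff cmul_of_real P_def by blast
  qed
qed

lemma eigenvectors_orthogonal: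
  assumes "H f = l *\<^sub>R f" "H g = m *\<^sub>R g" "l \<noteq> m"
  shows "f \<bullet> g = 0"
proof -
  have "l * (f \<bullet> g) = m * (f \<bullet> g)"
    using sym_H[of f g] assms by simp
  with \<open>l \<noteq> m\<close> show ?thesis by simp
qed

lemma spectrum_isolated_above:
  assumes "a < l"
  shows "\<exists>\<epsilon>>0. op_spectrum Hf \<inter> ball (complex_of_real l) \<epsilon> \<subseteq> {complex_of_real l}"
proof (rule ccontr)
  assume no: "\<not> ?thesis"
  \<comment> \<open>The bound \<open>l - a\<close> keeps the nearby spectral points above
    \<open>a\<close>, where they are eigenvalues; the other bound makes them converge to
    \<open>l\<close>.\<close>
  define e where "e n = min (l - a) (inverse (real (Suc n)))" for n :: nat
  have "\<exists>m f. norm f = 1 \<and> H f = m *\<^sub>R f \<and> m \<noteq> l \<and> \<bar>m - l\<bar> < e n" for n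
  proof -
    have "0 < e n" using assms by (simp add: e_def)
    then obtain z where z: "z \<in> op_spectrum Hf" "z \<in> ball (complex_of_real l) (e n)" "z \<noteq> complex_of_real l"
      using no by blast
    define m where "m = Re z"
    have zm: "z = complex_of_real m"
      using nonreal_notin_spectrum z(1) by (auto simp: m_def complex_eq_iff)
    have d: "\<bar>m - l\<bar> < e n"
      using z(2) by (simp add: zm dist_of_real) (simp add: dist_real_def abs_minus_commute)
    then have "a < m" by (simp add: e_def) linarith
    then obtain f where f: "f \<noteq> 0" "H f = m *\<^sub>R f"
      using spectrum_above_iff z(1) zm by blast
    have "norm (f /\<^sub>R norm f) = 1" "H (f /\<^sub>R norm f) = m *\<^sub>R (f /\<^sub>R norm f)"
      using f by (simp_all add: H.scaleR)
    with d z(3) zm show ?thesis by blast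
  qed
  then obtain m f where mf: "\<And>n. norm (f n) = 1" "\<And>n. H (f n) = m n *\<^sub>R f n" "\<And>n. m n \<noteq> l"
    "\<And>n. \<bar>m n - l\<bar> < e n" by metis
  have "(\<lambda>n. l *\<^sub>R f n - H (f n)) \<longlonglongrightarrow> 0"
  proof (rule tendsto_norm_zero_cancel, rule tendsto_sandwich[OF _ _ tendsto_const LIMSEQ_inverse_real_of_nat])
    have "norm (l *\<^sub>R f n - H (f n)) \<le> inverse (real (Suc n))" for n
      using mf(4)[of n] mf(1)[of n] by (simp add: mf(2) scaleR_diff_left[symmetric] e_def abs_minus_commute)
    then show "\<forall>\<^sub>F n in sequentially. norm (l *\<^sub>R f n - H (f n)) \<le> inverse (real (Suc n))" by simp
  qed simp
  then obtain r :: "nat \<Rightarrow> nat" and g where g: "(\<lambda>n. f (r n)) \<longlonglongrightarrow> g" "norm g = 1" "H g = l *\<^sub>R g"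
    by (rule unit_approximate_eigenvectors[OF assms mf(1)])
  (* g is a limit of eigenvectors that are all orthogonal to it. *)
  have "(\<lambda>n. f (r n) \<bullet> g) \<longlonglongrightarrow> g \<bullet> g" by (intro tendsto_intros g)
  moreover have "f (r n) \<bullet> g = 0" for n
    using mf g by (intro eigenvectors_orthogonal)
  ultimately have "g \<bullet> g = 0" using LIMSEQ_unique by fastforce
  with g(2) show False by simp
qed

text \<open>Beyond isolation, finite multiplicity is needed: an eigenfunction vanishing on the
  finite set of \<open>coercive_off_finite_set\<close> has norm zero, so restriction to that set is
  injective on the eigenspace.\<close>

lemma disc_spectrum_above_iff:
  assumes "a < l"
  shows "complex_of_real l \<in> disc_spectrum Hf \<longleftrightarrow> (\<exists>f. f \<noteq> 0 \<and> H f = l *\<^sub>R f)"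
proof
  assume "complex_of_real l \<in> disc_spectrum Hf"
  then show "\<exists>f. f \<noteq> 0 \<and> H f = l *\<^sub>R f"
    using spectrum_above_iff[OF assms] by (simp add: disc_spectrum_def)
next
  let ?z = "complex_of_real l"
  assume ex: "\<exists>f. f \<noteq> 0 \<and> H f = l *\<^sub>R f"
  then obtain f where f: "f \<noteq> 0" "H f = l *\<^sub>R f" by blast
  have spec: "?z \<in> op_spectrum Hf" using ex spectrum_above_iff[OF assms] by blast
  moreover have "\<exists>\<epsilon>>0. op_spectrum Hf \<inter> ball ?z \<epsilon> = {?z}"
    using spectrum_isolated_above[OF assms] spec by (meson centre_in_ball IntI insert_subset empty_subsetI subset_antisym)
  moreover have "coord f \<in> op_eigenspace Hf ?z"
    by (simp add: op_eigenspace_def coord_l2 Hf f scaleR_conv_of_real)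
  moreover have "coord f \<noteq> (\<lambda>_. 0)"
    using f(1) by (metis coord_simps(1) ell2_eqI)
  moreover have "fin_dim_fun_space (op_eigenspace Hf ?z)"
  proof -
    obtain S c K where S: "finite S" and c: "0 < c" and
      coer: "\<And>f. c * (norm f)\<^sup>2 \<le> (l *\<^sub>R f - H f) \<bullet> f + K * (\<Sum>x\<in>S. (cmod (coord f x))\<^sup>2)"
      using coercive_off_finite_set[OF assms] by metis
    have eig: "u \<in> op_eigenspace Hf ?z \<longleftrightarrow> (\<exists>f. u = coord f \<and> H f = l *\<^sub>R f)" for u
    proof
      assume u: "u \<in> op_eigenspace Hf ?z"
      then have c: "u = coord (ell2_of u)" by (simp add: op_eigenspace_def coord_ell2_of)
      have "H (ell2_of u) = l *\<^sub>R ell2_of u"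
        by (rule ell2_eqI) (use u c Hf[of "ell2_of u"] in \<open>auto simp: op_eigenspace_def scaleR_conv_of_real\<close>)
      with c show "\<exists>f. u = coord f \<and> H f = l *\<^sub>R f" by blast
    qed (auto simp: op_eigenspace_def coord_l2 Hf scaleR_conv_of_real)
    show ?thesis
    proof (rule fin_dim_fun_spaceI[OF S])
      fix u w :: "'a \<Rightarrow> complex" and k
      assume "u \<in> op_eigenspace Hf ?z" "w \<in> op_eigenspace Hf ?z"
      then obtain f g where fg: "u = coord f" "w = coord g" "H f = l *\<^sub>R f" "H g = l *\<^sub>R g"
        unfolding eig by blast
      have "(\<lambda>x. u x - k * w x) = coord (f - cmul k g)" by (simp add: fg fun_eq_iff)
      moreover have "H (f - cmul k g) = l *\<^sub>R (f - cmul k g)"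
        by (rule ell2_eqI) (simp add: H.diff cmul_H fg algebra_simps)
      ultimately show "(\<lambda>x. u x - k * w x) \<in> op_eigenspace Hf ?z" unfolding eig by blast
    next
      fix u assume "u \<in> op_eigenspace Hf ?z" and 0: "\<forall>x\<in>S. u x = 0"
      then obtain f where f: "u = coord f" "H f = l *\<^sub>R f" unfolding eig by blast
      have "c * (norm f)\<^sup>2 \<le> 0" using coer[of f] f 0 by simp
      then have "f = 0" using c by (simp add: mult_le_0_iff)
      then show "u = (\<lambda>_. 0)" using f by (simp add: fun_eq_iff)
    qed
  qed
  ultimately show "?z \<in> disc_spectrum Hf" unfolding disc_spectrum_def by blast
qed

text \<open>The supremum \<open>l\<close> of the Rayleigh quotient exceeds \<open>a\<close> and is
  attained. Since \<open>l - H\<close> is positive, a maximising sequence satisfies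
  \<open>(l - H) f \<rightarrow> 0\<close> in norm, not only in the form sense, and the compactness
  above \<open>a\<close> applies.\<close>

lemma eigenvalue_above:
  assumes "a * (norm f0)\<^sup>2 < H f0 \<bullet> f0"
  obtains l f where "a < l" "f \<noteq> 0" "H f = l *\<^sub>R f"
proof -
  obtain K where K: "0 < K" "\<And>f. norm (H f) \<le> norm f * K" using H.pos_bounded by blast
  define R where "R = (\<lambda>f. H f \<bullet> f) ` {f. norm f = 1}"
  have f0: "f0 \<noteq> 0" using assms by auto
  have hom: "H (f /\<^sub>R norm f) \<bullet> (f /\<^sub>R norm f) = (H f \<bullet> f) / (norm f)\<^sup>2" for f
    by (simp add: H.scaleR power2_eq_square divide_inverse)
  have in_R: "(H f \<bullet> f) / (norm f)\<^sup>2 \<in> R" if "f \<noteq> 0" for f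
    unfolding R_def hom[symmetric] using that by (intro imageI) simp
  have bdd: "bdd_above R"
  proof (rule bdd_aboveI[of _ K])
    fix y assume "y \<in> R"
    then obtain f where f: "y = H f \<bullet> f" "norm f = 1" by (auto simp: R_def)
    then show "y \<le> K" using norm_cauchy_schwarz[of "H f" f] K(2)[of f] by simp
  qed
  define l where "l = Sup R"
  have "a < (H f0 \<bullet> f0) / (norm f0)\<^sup>2" using assms f0 by (simp add: less_divide_eq)
  also have "\<dots> \<le> l" unfolding l_def by (intro cSup_upper in_R bdd f0)
  finally have al: "a < l" .
  define P where "P f = l *\<^sub>R f - H f" for f
  have blP: "bounded_linear P"
    unfolding P_def by (intro bounded_linear_sub bl_H bounded_linear_scaleR_right)
  interpret P: bounded_linear P by (rule blP)
  have symP: "P f \<bullet> g = f \<bullet> P g" for f g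
    by (simp add: P_def inner_diff_left inner_diff_right sym_H)
  have posP: "0 \<le> P f \<bullet> f" for f
  proof (cases "f = 0")
    case False
    then have "(H f \<bullet> f) / (norm f)\<^sup>2 \<le> l" unfolding l_def by (intro cSup_upper in_R bdd)
    then show ?thesis using False
      by (simp add: P_def inner_diff_left dot_square_norm divide_le_eq)
  qed simp
  obtain M where M: "0 < M" "\<And>f. (norm (P f))\<^sup>2 \<le> M * (P f \<bullet> f)"
    using positive_operator_norm_le[OF blP symP posP] by blast
  have "\<exists>f. norm f = 1 \<and> l - inverse (real (Suc n)) < H f \<bullet> f" for n
  proof -
    have "l - inverse (real (Suc n)) < Sup R" by (simp add: l_def)
    then obtain y where "y \<in> R" "l - inverse (real (Suc n)) < y"
      using in_R[OF f0] less_cSup_iff[OF _ bdd] by blast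
    then show ?thesis by (auto simp: R_def)
  qed
  then obtain f where f: "\<And>n. norm (f n) = 1" "\<And>n. l - inverse (real (Suc n)) < H (f n) \<bullet> f n" by metis
  have "(\<lambda>n. (norm (P (f n)))\<^sup>2) \<longlonglongrightarrow> 0"
  proof (rule tendsto_sandwich[OF _ _ tendsto_const])
    show "(\<lambda>n. M * inverse (real (Suc n))) \<longlonglongrightarrow> 0"
      using tendsto_mult_right_zero[OF LIMSEQ_inverse_real_of_nat] by blast
    have "(norm (P (f n)))\<^sup>2 \<le> M * inverse (real (Suc n))" for n
    proof -
      have "P (f n) \<bullet> f n \<le> inverse (real (Suc n))"
        using f[of n] by (simp add: P_def inner_diff_left dot_square_norm)
      then show ?thesis using M(2)[of "f n"] M(1) by (smt (verit) mult_left_mono)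
    qed
    then show "\<forall>\<^sub>F n in sequentially. (norm (P (f n)))\<^sup>2 \<le> M * inverse (real (Suc n))" by simp
  qed auto
  from tendsto_real_sqrt[OF this] have "(\<lambda>n. P (f n)) \<longlonglongrightarrow> 0"
    by (simp add: tendsto_norm_zero_iff)
  then obtain r :: "nat \<Rightarrow> nat" and g where "(\<lambda>n. f (r n)) \<longlonglongrightarrow> g" "norm g = 1" "H g = l *\<^sub>R g"
    unfolding P_def by (rule unit_approximate_eigenvectors[OF al f(1)])
  then show thesis using that[OF al, of g] by force
qed

end

section \<open>The dispersion relation near its maximum\<close>

text \<open>The second difference \<open>\<Delta>\<close> is symmetric in \<open>u\<close> and
  \<open>w\<close> by construction, and the mean value theorem together with differentiability of
  \<open>D\<close> at \<open>p\<close> identifies its leading term with the second derivative.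
  \<open>C2_nondeg_at\<close> does not include symmetry, yet it is needed to show that a null
  direction of the Hessian form lies in its kernel.\<close>

lemma second_derivative_symmetric:
  fixes f :: "'a::real_normed_vector \<Rightarrow> real" and D :: "'a \<Rightarrow> 'a \<Rightarrow>\<^sub>L real"
  assumes U: "open U" "p \<in> U" and D: "\<And>q. q \<in> U \<Longrightarrow> (f has_derivative blinfun_apply (D q)) (at q)"
    and B: "(D has_derivative B) (at p)"
  shows "blinfun_apply (B u) w = blinfun_apply (B w) u"
proof -
  define \<Delta> where "\<Delta> u w h = f (p + h *\<^sub>R u + h *\<^sub>R w) - f (p + h *\<^sub>R u) - f (p + h *\<^sub>R w) + f p"
    for u w and h :: real
  interpret B: bounded_linear B using B by (rule has_derivative_bounded_linear)
  obtain \<rho> where \<rho>: "0 < \<rho>" "ball p \<rho> \<subseteq> U" using U openE by blast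
  have key: "\<exists>d>0. \<forall>h. 0 < h \<and> h < d \<longrightarrow> \<bar>\<Delta> u w h - h\<^sup>2 * blinfun_apply (B u) w\<bar> \<le> e * h\<^sup>2"
    if e: "0 < e" for u w and e :: real
  proof -
    define s where "s = 1 + norm u + norm w"
    have s: "1 \<le> s" "norm u \<le> s" "norm w \<le> s" by (auto simp: s_def)
    \<comment> \<open>Two remainders of size at most \<open>\<eta> h s^2\<close> occur, and
      \<open>2 \<eta> h s^2 = e h\<close>.\<close>
    define \<eta> where "\<eta> = e / (2 * s * s)"
    have \<eta>: "0 < \<eta>" using e s by (simp add: \<eta>_def)
    obtain d0 where d0: "0 < d0"
      "\<And>y. norm (y - p) < d0 \<Longrightarrow> norm (D y - D p - B (y - p)) \<le> \<eta> * norm (y - p)"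
      using B \<eta> unfolding has_derivative_at_alt by metis
    define d where "d = min d0 \<rho> / s"
    have "0 < d" using d0 \<rho> s by (simp add: d_def)
    moreover have "\<bar>\<Delta> u w h - h\<^sup>2 * blinfun_apply (B u) w\<bar> \<le> e * h\<^sup>2" if h: "0 < h" "h < d" for h
    proof -
      have hs: "h * s < min d0 \<rho>" using h s by (simp add: d_def less_divide_eq)
      have small: "norm (k *\<^sub>R u + t *\<^sub>R w) \<le> h * s" if "0 \<le> k" "k \<le> h" "0 \<le> t" "t \<le> h" for k t
      proof -
        have "norm (k *\<^sub>R u + t *\<^sub>R w) \<le> k * norm u + t * norm w"
          using that by (intro order_trans[OF norm_triangle_ineq]) simp
        also have "\<dots> \<le> h * norm u + h * norm w"
          using that by (intro add_mono mult_right_mono) auto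
        also have "\<dots> \<le> h * s" using h by (simp add: s_def algebra_simps)
        finally show ?thesis .
      qed
      have dist_p: "dist p (p + x) = norm x" for x by (simp add: dist_norm)
      have inU: "p + k *\<^sub>R u + t *\<^sub>R w \<in> U" if "0 \<le> k" "k \<le> h" "0 \<le> t" "t \<le> h" for k t
      proof -
        have "dist p (p + k *\<^sub>R u + t *\<^sub>R w) < \<rho>"
          using small[OF that] hs dist_p[of "k *\<^sub>R u + t *\<^sub>R w"] by (simp add: add.assoc)
        then show ?thesis using \<rho> by auto
      qed
      \<comment> \<open>The vanishing term \<open>0 *\<^sub>R u\<close> is kept so that both
        summands are instances of \<open>line\<close> and of the remainder bound \<open>R\<close>,
        with \<open>k = h\<close> and \<open>k = 0\<close>.\<close>
      define \<phi> where "\<phi> t = f (p + h *\<^sub>R u + t *\<^sub>R w) - f (p + 0 *\<^sub>R u + t *\<^sub>R w)" for t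
      define \<phi>' where "\<phi>' t = D (p + h *\<^sub>R u + t *\<^sub>R w) w - D (p + 0 *\<^sub>R u + t *\<^sub>R w) w" for t
      have line: "((\<lambda>t. f (p + k *\<^sub>R u + t *\<^sub>R w)) has_real_derivative D (p + k *\<^sub>R u + t *\<^sub>R w) w) (at t)"
        if "0 \<le> k" "k \<le> h" "0 \<le> t" "t \<le> h" for k t
      proof -
        have "((\<lambda>t. p + k *\<^sub>R u + t *\<^sub>R w) has_derivative (\<lambda>t. t *\<^sub>R w)) (at t)"
          by (auto intro!: derivative_eq_intros)
        from has_derivative_compose[OF this D[OF inU[OF that]]]
        show ?thesis
          by (simp add: has_field_derivative_def blinfun.scaleR_right mult_commute_abs)
      qed
      have "\<exists>z>0. z < h \<and> \<phi> h - \<phi> 0 = (h - 0) * \<phi>' z"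
      proof (rule MVT2)
        show "0 < h" by fact
        fix t assume "0 \<le> t" "t \<le> h"
        then show "(\<phi> has_real_derivative \<phi>' t) (at t)"
          unfolding \<phi>_def \<phi>'_def using h by (intro DERIV_diff line) auto
      qed
      then obtain z where z: "0 < z" "z < h" "\<phi> h - \<phi> 0 = h * \<phi>' z" by auto
      define R where "R y = D (p + y) - D p - B y" for y
      have R: "norm (R (k *\<^sub>R u + z *\<^sub>R w)) \<le> \<eta> * (h * s)" if "0 \<le> k" "k \<le> h" for k
      proof -
        have "norm (R (k *\<^sub>R u + z *\<^sub>R w)) \<le> \<eta> * norm (k *\<^sub>R u + z *\<^sub>R w)"
          using d0(2)[of "p + (k *\<^sub>R u + z *\<^sub>R w)"] small[of k z] that z hs by (simp add: R_def)
        also have "\<dots> \<le> \<eta> * (h * s)" using small[of k z] that z \<eta> by (intro mult_left_mono) auto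
        finally show ?thesis .
      qed
      have "\<phi>' z = h * B u w + (R (h *\<^sub>R u + z *\<^sub>R w) w - R (0 *\<^sub>R u + z *\<^sub>R w) w)"
        by (simp add: \<phi>'_def R_def B.add B.scaleR blinfun.add_left blinfun.diff_left blinfun.scaleR_left add.assoc)
      moreover have "\<bar>R (k *\<^sub>R u + z *\<^sub>R w) w\<bar> \<le> \<eta> * (h * s) * s" if "0 \<le> k" "k \<le> h" for k
      proof -
        have "\<bar>R (k *\<^sub>R u + z *\<^sub>R w) w\<bar> \<le> norm (R (k *\<^sub>R u + z *\<^sub>R w)) * norm w"
          using norm_blinfun[of "R (k *\<^sub>R u + z *\<^sub>R w)" w] by simp
        also have "\<dots> \<le> \<eta> * (h * s) * s"
          using R[OF that] s \<eta> h by (intro mult_mono) auto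
        finally show ?thesis .
      qed
      from this[of h] this[of 0] have "\<bar>R (h *\<^sub>R u + z *\<^sub>R w) w - R (0 *\<^sub>R u + z *\<^sub>R w) w\<bar> \<le> 2 * (\<eta> * (h * s) * s)"
        using h by linarith
      moreover have "2 * (\<eta> * (h * s) * s) = e * h" using s by (simp add: \<eta>_def)
      ultimately have "\<bar>\<phi>' z - h * B u w\<bar> \<le> e * h" by simp
      moreover have "\<Delta> u w h = h * \<phi>' z"
        using z(3) by (simp add: \<Delta>_def \<phi>_def)
      then have "\<Delta> u w h - h\<^sup>2 * B u w = h * (\<phi>' z - h * B u w)"
        by (simp add: power2_eq_square algebra_simps)
      ultimately show ?thesis
        using h by (simp add: abs_mult power2_eq_square mult.left_commute)
    qed
    ultimately show ?thesis by blast
  qed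
  have sym\<Delta>: "\<Delta> u w h = \<Delta> w u h" for h by (simp add: \<Delta>_def algebra_simps)
  have "\<bar>blinfun_apply (B u) w - blinfun_apply (B w) u\<bar> \<le> 0 + e" if e: "0 < e" for e
  proof -
    obtain d1 where d1: "0 < d1" "\<And>h. 0 < h \<Longrightarrow> h < d1 \<Longrightarrow> \<bar>\<Delta> u w h - h\<^sup>2 * blinfun_apply (B u) w\<bar> \<le> e / 2 * h\<^sup>2"
      using key[of "e / 2" u w] e by auto
    obtain d2 where d2: "0 < d2" "\<And>h. 0 < h \<Longrightarrow> h < d2 \<Longrightarrow> \<bar>\<Delta> w u h - h\<^sup>2 * blinfun_apply (B w) u\<bar> \<le> e / 2 * h\<^sup>2"
      using key[of "e / 2" w u] e by auto
    define h where "h = min d1 d2 / 2"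
    have h: "0 < h" "h < d1" "h < d2" using d1(1) d2(1) by (auto simp: h_def)
    have "\<bar>h\<^sup>2 * blinfun_apply (B u) w - h\<^sup>2 * blinfun_apply (B w) u\<bar> \<le> e * h\<^sup>2"
      using d1(2)[OF h(1,2)] d2(2)[OF h(1,3)] unfolding sym\<Delta> by linarith
    then have "h\<^sup>2 * \<bar>blinfun_apply (B u) w - blinfun_apply (B w) u\<bar> \<le> h\<^sup>2 * e"
      by (simp only: right_diff_distrib[symmetric] abs_mult mult.commute[of e]) simp
    then show ?thesis using h(1) by simp
  qed
  then show ?thesis using field_le_epsilon[of "\<bar>blinfun_apply (B u) w - blinfun_apply (B w) u\<bar>" 0] by simp
qed

text \<open>Second-order Taylor expansion with the Hessian at an intermediate point, compared with
  the Hessian at \<open>p\<close>. Maximality gives only a semidefinite form; symmetry and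
  non-degeneracy make it definite, and compactness of the unit sphere makes this uniform.\<close>

lemma nondegenerate_max_quadratic:
  fixes f :: "real^'d \<Rightarrow> real"
  assumes C2: "C2_nondeg_at f p" and max: "\<And>q. f q \<le> f p"
  obtains r c C where "0 < r" "0 < c" "0 < C"
    "\<And>q. norm q \<le> r \<Longrightarrow> c * (norm q)\<^sup>2 \<le> f p - f (p + q)"
    "\<And>q. norm q \<le> r \<Longrightarrow> f p - f (p + q) \<le> C * (norm q)\<^sup>2"
proof -
  obtain U D D2 where U: "open U" "p \<in> U"
    and D: "\<And>q. q \<in> U \<Longrightarrow> (f has_derivative blinfun_apply (D q)) (at q)"
    and D2: "\<And>q. q \<in> U \<Longrightarrow> (D has_derivative blinfun_apply (D2 q)) (at q)"
    and cont: "continuous_on U D2"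
    and nd: "\<And>u. (\<forall>w. blinfun_apply (blinfun_apply (D2 p) u) w = 0) \<Longrightarrow> u = 0"
    using C2 unfolding C2_nondeg_at_def by blast
  obtain \<rho> where \<rho>: "0 < \<rho>" "ball p \<rho> \<subseteq> U" using U openE by blast
  have Dp: "blinfun_apply (D p) = (\<lambda>_. 0)"
    by (rule differential_zero_maxmin[OF U(2,1) D[OF U(2)]]) (use max in blast)
  have taylor: "\<exists>t. 0 < t \<and> t < 1 \<and> f (p + q) = f p + D2 (p + t *\<^sub>R q) q q / 2" if "norm q < \<rho>" for q
  proof -
    have inU: "p + t *\<^sub>R q \<in> U" if "0 \<le> t" "t \<le> 1" for t
    proof -
      have "norm (t *\<^sub>R q) \<le> norm q" using that by (simp add: mult_left_le_one_le)
      then have "dist p (p + t *\<^sub>R q) < \<rho>" using \<open>norm q < \<rho>\<close> by (simp add: dist_norm)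
      then show ?thesis using \<rho> by auto
    qed
    define G where "G m t = (if m = 0 then f (p + t *\<^sub>R q) else if m = 1 then D (p + t *\<^sub>R q) q
        else D2 (p + t *\<^sub>R q) q q)" for m :: nat and t
    have line: "((\<lambda>t. p + t *\<^sub>R q) has_derivative (\<lambda>t. t *\<^sub>R q)) (at t)" for t
      by (auto intro!: derivative_eq_intros)
    have "\<exists>t>0. t < 1 \<and> f (p + 1 *\<^sub>R q) = (\<Sum>m<2. G m 0 / fact m * (1 - 0) ^ m) + G 2 t / fact 2 * (1 - 0)\<^sup>2"
    proof (rule Taylor_up[where a = 0])
      show "G 0 = (\<lambda>t. f (p + t *\<^sub>R q))" by (simp add: G_def fun_eq_iff)
      show "\<forall>m t. m < 2 \<and> 0 \<le> t \<and> t \<le> 1 \<longrightarrow> (G m has_real_derivative G (Suc m) t) (at t)"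
      proof (intro allI impI)
        fix m :: nat and t :: real assume mt: "m < 2 \<and> 0 \<le> t \<and> t \<le> 1"
        then have pU: "p + t *\<^sub>R q \<in> U" by (simp add: inU)
        have d0: "((\<lambda>t. f (p + t *\<^sub>R q)) has_real_derivative D (p + t *\<^sub>R q) q) (at t)"
          using has_derivative_compose[OF line D[OF pU]]
          by (simp add: has_field_derivative_def blinfun.scaleR_right mult_commute_abs)
        have "((\<lambda>t. D (p + t *\<^sub>R q)) has_derivative (\<lambda>s. D2 (p + t *\<^sub>R q) (s *\<^sub>R q))) (at t)"
          by (rule has_derivative_compose[OF line D2[OF pU]])
        then have "((\<lambda>t. D (p + t *\<^sub>R q) q) has_derivative (\<lambda>s. D2 (p + t *\<^sub>R q) (s *\<^sub>R q) q)) (at t)"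
          by (auto intro!: derivative_eq_intros)
        then have d1: "((\<lambda>t. D (p + t *\<^sub>R q) q) has_real_derivative D2 (p + t *\<^sub>R q) q q) (at t)"
          by (simp add: has_field_derivative_def blinfun.scaleR_right blinfun.scaleR_left mult_commute_abs)
        have "m = 0 \<or> m = 1" using mt by auto
        then show "(G m has_real_derivative G (Suc m) t) (at t)"
          using d0 d1 unfolding G_def by (elim disjE) simp_all
      qed
    qed auto
    then show ?thesis by (auto simp: G_def numeral_2_eq_2 Dp)
  qed
  define Q where "Q u = D2 p u u" for u
  have sym: "D2 p u w = D2 p w u" for u w
    by (rule second_derivative_symmetric[OF U D D2[OF U(2)]])
  have contD2: "\<exists>\<delta>>0. \<delta> \<le> \<rho> \<and> (\<forall>q. norm q < \<delta> \<longrightarrow> norm (D2 (p + q) - D2 p) \<le> e)" if "0 < e" for e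
  proof -
    have "isCont D2 p" using cont U by (simp add: continuous_on_eq_continuous_at)
    then obtain \<delta> where \<delta>: "0 < \<delta>" "\<And>y. norm (y - p) < \<delta> \<Longrightarrow> norm (D2 y - D2 p) < e"
      unfolding isCont_def LIM_eq using \<open>0 < e\<close> by (metis diff_self norm_zero)
    have "norm (D2 (p + q) - D2 p) \<le> e" if "norm q < min \<delta> \<rho>" for q
      using \<delta>(2)[of "p + q"] that by simp
    then show ?thesis using \<delta>(1) \<rho>(1) by (intro exI[of _ "min \<delta> \<rho>"]) auto
  qed
  have quad_diff: "\<bar>D2 (p + x) q q - Q q\<bar> \<le> norm (D2 (p + x) - D2 p) * (norm q)\<^sup>2" for x q
  proof -
    have "\<bar>D2 (p + x) q q - Q q\<bar> = norm (blinfun_apply (blinfun_apply (D2 (p + x) - D2 p) q) q)"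
      by (simp add: Q_def blinfun.diff_left)
    also have "\<dots> \<le> norm (blinfun_apply (D2 (p + x) - D2 p) q) * norm q" by (rule norm_blinfun)
    also have "\<dots> \<le> norm (D2 (p + x) - D2 p) * norm q * norm q"
      by (intro mult_right_mono norm_blinfun) auto
    finally show ?thesis by (simp add: power2_eq_square mult.assoc)
  qed
  have Qscale: "Q (s *\<^sub>R u) = s\<^sup>2 * Q u" for s u
    by (simp add: Q_def blinfun.scaleR_left blinfun.scaleR_right power2_eq_square)
  have Qneg: "Q u \<le> 0" for u
  proof (rule ccontr)
    assume "\<not> Q u \<le> 0"
    then have Qu: "0 < Q u" by simp
    then have u0: "u \<noteq> 0" by (auto simp: Q_def)
    \<comment> \<open>With this tolerance the error at \<open>q\<close>, a multiple of
      \<open>u\<close>, is exactly half of \<open>Q q\<close>; a positive \<open>Q u\<close> would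
      then give \<open>f p < f (p + q)\<close>.\<close>
    define e where "e = Q u / (2 * (norm u)\<^sup>2)"
    have "0 < e" using Qu u0 by (simp add: e_def)
    then obtain \<delta> where \<delta>: "0 < \<delta>" "\<delta> \<le> \<rho>" "\<And>q. norm q < \<delta> \<Longrightarrow> norm (D2 (p + q) - D2 p) \<le> e"
      using contD2 by blast
    define s where "s = \<delta> / (2 * norm u)"
    define q where "q = s *\<^sub>R u"
    have s: "0 < s" using \<delta> u0 by (simp add: s_def)
    have nq: "norm q = \<delta> / 2" using u0 \<delta> by (simp add: q_def s_def)
    then obtain t where t: "0 < t" "t < 1" "f (p + q) = f p + D2 (p + t *\<^sub>R q) q q / 2"
      using taylor[of q] \<delta> by auto
    have "norm (t *\<^sub>R q) < \<delta>" using t nq \<delta> mult_left_le_one_le[of "norm q" t] by simp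
    then have "\<bar>D2 (p + t *\<^sub>R q) q q - Q q\<bar> \<le> e * (norm q)\<^sup>2"
      using \<delta>(3) by (intro order_trans[OF quad_diff] mult_right_mono) auto
    also have "e * (norm q)\<^sup>2 = Q q / 2"
      using u0 s by (simp add: e_def q_def Qscale power_mult_distrib)
    finally have "D2 (p + t *\<^sub>R q) q q \<ge> Q q / 2" by linarith
    moreover have "0 < Q q" using Qu s by (simp add: q_def Qscale)
    ultimately have "f p < f (p + q)" using t(3) by linarith
    then show False using max[of "p + q"] by simp
  qed
  have Qneg': "Q u < 0" if "u \<noteq> 0" for u
  proof (rule ccontr)
    assume "\<not> Q u < 0"
    then have Q0: "Q u = 0" using Qneg[of u] by simp
    have "D2 p u w = 0" for w
    proof (rule ccontr)
      assume b: "D2 p u w \<noteq> 0"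
      define b where "b = D2 p u w"
      have exp: "Q (u + t *\<^sub>R w) = 2 * t * b + t\<^sup>2 * Q w" for t
        using Q0 by (simp add: Q_def b_def sym[of w u] blinfun.add_left blinfun.add_right
            blinfun.scaleR_left blinfun.scaleR_right power2_eq_square algebra_simps)
      \<comment> \<open>This \<open>t\<close> solves \<open>b + t Q w = t\<close>, so that
        \<open>Q (u + t w) = t^2 + t b\<close> is positive. The denominator is at least
        \<open>1\<close> because \<open>Q w \<le> 0\<close>.\<close>
      define t where "t = b / (1 - Q w)"
      have k: "0 < 1 - Q w" using Qneg[of w] by simp
      have "t * (1 - Q w) = b" using k by (simp add: t_def)
      then have tb: "b + t * Q w = t" by (simp add: algebra_simps)
      have "2 * t * b + t\<^sup>2 * Q w = t * b + t * (b + t * Q w)"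
        by (simp add: power2_eq_square algebra_simps)
      then have "2 * t * b + t\<^sup>2 * Q w = t\<^sup>2 + t * b"
        unfolding tb by (simp add: power2_eq_square)
      moreover have "t * b = b\<^sup>2 / (1 - Q w)" by (simp add: t_def power2_eq_square)
      moreover have "0 < b\<^sup>2 / (1 - Q w)" using k b by (simp add: b_def)
      ultimately have "0 < Q (u + t *\<^sub>R w)" unfolding exp using zero_le_power2[of t] by linarith
      then show False using Qneg[of "u + t *\<^sub>R w"] by simp
    qed
    then show False using nd that by blast
  qed
  obtain k where k: "0 < k" "\<And>u. Q u \<le> - k * (norm u)\<^sup>2"
  proof -
    have "continuous_on (sphere 0 1) Q"
      unfolding Q_def by (intro continuous_intros)
    moreover have "sphere (0::real^'d) 1 \<noteq> {}" by simp
    ultimately obtain u0 where u0: "u0 \<in> sphere 0 1" "\<And>u. u \<in> sphere 0 1 \<Longrightarrow> Q u \<le> Q u0"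
      using continuous_attains_sup[OF compact_sphere, of "0::real^'d" 1 Q] by blast
    have "Q u \<le> - (- Q u0) * (norm u)\<^sup>2" for u
    proof (cases "u = 0")
      case False
      then have "Q (u /\<^sub>R norm u) \<le> Q u0" by (intro u0(2)) simp
      then show ?thesis using False by (simp add: Qscale field_simps)
    qed (simp add: Q_def)
    moreover have "0 < - Q u0" using Qneg'[of u0] u0(1) by (cases "u0 = 0") auto
    ultimately show thesis using that by blast
  qed
  \<comment> \<open>Half of \<open>k\<close> is given up to the error and another factor
    \<open>2\<close> comes from the Taylor coefficient, hence the final constant
    \<open>k / 4\<close>.\<close>
  obtain \<delta> where \<delta>: "0 < \<delta>" "\<delta> \<le> \<rho>" "\<And>q. norm q < \<delta> \<Longrightarrow> norm (D2 (p + q) - D2 p) \<le> k / 2"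
    using contD2[of "k / 2"] k by auto
  define M where "M = norm (D2 p)"
  have QM: "\<bar>Q u\<bar> \<le> M * (norm u)\<^sup>2" for u
  proof -
    have "\<bar>Q u\<bar> \<le> norm (blinfun_apply (D2 p) u) * norm u" using norm_blinfun[of "blinfun_apply (D2 p) u" u] by (simp add: Q_def)
    also have "\<dots> \<le> M * norm u * norm u" unfolding M_def by (intro mult_right_mono norm_blinfun) auto
    finally show ?thesis by (simp add: power2_eq_square mult.assoc)
  qed
  have both: "k / 4 * (norm q)\<^sup>2 \<le> f p - f (p + q) \<and> f p - f (p + q) \<le> (M + k) * (norm q)\<^sup>2"
    if nq: "norm q \<le> \<delta> / 2" for q
  proof -
    obtain t where t: "0 < t" "t < 1" "f (p + q) = f p + D2 (p + t *\<^sub>R q) q q / 2"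
      using taylor[of q] nq \<delta>(1,2) by auto
    have "norm (t *\<^sub>R q) < \<delta>" using t nq \<delta>(1) mult_left_le_one_le[of "norm q" t] by simp
    then have "\<bar>D2 (p + t *\<^sub>R q) q q - Q q\<bar> \<le> k / 2 * (norm q)\<^sup>2"
      using \<delta>(3) by (intro order_trans[OF quad_diff] mult_right_mono) auto
    moreover have "f p - f (p + q) = - D2 (p + t *\<^sub>R q) q q / 2" by (simp add: t(3))
    moreover define y kn mn where "y = D2 (p + t *\<^sub>R q) q q" and "kn = k * (norm q)\<^sup>2" and "mn = M * (norm q)\<^sup>2"
    moreover have "0 \<le> kn" "Q q \<le> - kn" "\<bar>Q q\<bar> \<le> mn" using k(1) k(2)[of q] QM[of q] by (simp_all add: kn_def mn_def)
    ultimately have "f p - f (p + q) = - y / 2" "\<bar>y - Q q\<bar> \<le> kn / 2" "0 \<le> kn" "Q q \<le> - kn" "\<bar>Q q\<bar> \<le> mn"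
      by simp_all
    then have "kn / 4 \<le> f p - f (p + q) \<and> f p - f (p + q) \<le> mn + kn" by linarith
    then show ?thesis by (simp add: kn_def mn_def distrib_right)
  qed
  show thesis
  proof (rule that[of "\<delta> / 2" "k / 4" "M + k"])
    show "0 < M + k" using k by (simp add: M_def add_nonneg_pos)
  qed (use \<delta> k both in auto)
qed

section \<open>Lattice phases, periodicity and global bounds at the maximum\<close>

definition phase :: "int^'d \<Rightarrow> real^'d \<Rightarrow> real" where
  "phase x p = (\<Sum>i\<in>UNIV. real_of_int (x$i) * p$i)"

lemma phase_simps:
  "phase (x + y) p = phase x p + phase y p" "phase (- x) p = - phase x p" "phase (x - y) p = phase x p - phase y p"
  "phase x (p + q) = phase x p + phase x q" "phase 0 p = 0"
  by (simp_all add: phase_def algebra_simps sum.distrib sum_negf sum_subtractf)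

lemma abs_phase_le: "\<bar>phase x q\<bar> \<le> lat_norm x * norm q"
proof -
  have "phase x q = (\<chi> i. real_of_int (x$i)) \<bullet> q"
    by (simp add: phase_def inner_vec_def)
  then show ?thesis using Cauchy_Schwarz_ineq2 by (simp add: lat_norm_def)
qed

lemma cis_phase_periodic: "cis (phase x (\<chi> i. p$i + 2 * pi * real_of_int (k$i))) = cis (phase x p)"
proof -
  have "phase x (\<chi> i. p$i + 2 * pi * real_of_int (k$i)) = phase x p + 2 * pi * real_of_int (\<Sum>i\<in>UNIV. x$i * k$i)"
    by (simp add: phase_def algebra_simps sum.distrib sum_distrib_left)
  then show ?thesis
    by (simp only: cis_mult[symmetric]) (simp add: cis_multiple_2pi del: of_int_sum of_int_mult)
qed

lemma torus_representative:
  fixes p :: "real^'d"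
  obtains k :: "int^'d" where "(\<chi> i. p$i + 2 * pi * real_of_int (k$i)) \<in> torus"
proof
  \<comment> \<open>The ceiling fits a cell that is open at \<open>- pi\<close> and closed at
    \<open>pi\<close>.\<close>
  let ?k = "\<chi> i. - \<lceil>(p$i - pi) / (2 * pi)\<rceil>"
  have "- pi < t + 2 * pi * real_of_int (- \<lceil>(t - pi) / (2 * pi)\<rceil>) \<and>
        t + 2 * pi * real_of_int (- \<lceil>(t - pi) / (2 * pi)\<rceil>) \<le> pi" for t :: real
  proof -
    define n where "n = \<lceil>(t - pi) / (2 * pi)\<rceil>"
    have "(t - pi) / (2 * pi) \<le> of_int n" "of_int n < (t - pi) / (2 * pi) + 1"
      using ceiling_correct[of "(t - pi) / (2 * pi)"] by (auto simp: n_def)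
    then have "t - pi \<le> of_int n * (2 * pi)" "of_int n * (2 * pi) < t - pi + 2 * pi"
      by (simp_all add: divide_le_eq less_divide_eq field_simps)
    then show ?thesis unfolding n_def[symmetric] by (simp add: algebra_simps)
  qed
  then show "(\<chi> i. p$i + 2 * pi * real_of_int (?k$i)) \<in> torus"
    by (simp add: torus_def)
qed

lemma cmod_cis_diff_le: "cmod (cis t - 1) \<le> \<bar>t\<bar>"
  using dist_exp_i_1[of t] abs_sin_x_le_abs_x[of "t / 2"] by (simp add: cis_conv_exp)

text \<open>At a quarter \<open>x\<close> of the angle, \<open>sin x \<ge> x cos x\<close> and
  \<open>(cos x)^2 \<ge> 1/2\<close>, so the double-angle formula gives
  \<open>sin (2 x) \<ge> x\<close>. It lets finite differences on the lattice dominate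
  \<open>|q|^2\<close>.\<close>

lemma abs_le_cmod_cis_diff:
  assumes "\<bar>t\<bar> \<le> pi"
  shows "\<bar>t\<bar> \<le> 2 * cmod (cis t - 1)"
proof -
  define x where "x = \<bar>t\<bar> / 4"
  have x: "0 \<le> x" "x \<le> pi / 4" using assms by (auto simp: x_def)
  have "x * cos x \<le> sin x"
  proof (cases "x = 0")
    case False
    then have "\<exists>z>0. z < x \<and> sin x - sin 0 = (x - 0) * cos z"
      using x by (intro MVT2) auto
    then obtain z where z: "0 < z" "z < x" "sin x = x * cos z" by auto
    have "cos x \<le> cos z" using z x by (intro cos_monotone_0_pi_le) auto
    then show ?thesis using x z by (simp add: mult_left_mono)
  qed simp
  moreover have cosx: "cos (pi / 4) \<le> cos x" using x by (intro cos_monotone_0_pi_le) auto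
  then have "0 \<le> cos x" by (rule order_trans[rotated]) (simp add: cos_45)
  ultimately have "2 * (x * cos x) * cos x \<le> 2 * sin x * cos x"
    by (intro mult_right_mono) auto
  moreover have "(cos (pi / 4))\<^sup>2 \<le> (cos x)\<^sup>2" using cosx by (intro power_mono) (auto simp: cos_45)
  then have "1 / 2 \<le> (cos x)\<^sup>2" by (simp add: cos_45 power_divide)
  then have "x * (1 / 2) \<le> x * (cos x)\<^sup>2" using x by (intro mult_left_mono)
  ultimately have "x \<le> sin (2 * x)" unfolding sin_double by (simp add: power2_eq_square algebra_simps)
  moreover have "\<bar>sin (t / 2)\<bar> = \<bar>sin (2 * x)\<bar>" by (cases "0 \<le> t") (auto simp: x_def)
  ultimately have "x \<le> \<bar>sin (t / 2)\<bar>" by linarith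
  then show ?thesis using dist_exp_i_1[of t] by (simp add: cis_conv_exp x_def)
qed

locale dispersion =
  fixes eh :: "int^'d \<Rightarrow> complex"
  assumes eh_l1: "(\<lambda>x. cmod (eh x)) summable_on UNIV"
    and eh_sym: "\<And>x. cnj (eh (- x)) = eh x"
begin

lemma disp_abs_summable: "(\<lambda>x. norm (eh x * cis (phase x p))) summable_on UNIV"
  using eh_l1 by (simp add: norm_mult)

text \<open>\<open>disp\<close> is defined as a real part. The substitution of \<open>- x\<close>
  for \<open>x\<close> together with \<open>eh_sym\<close> shows that the complex sum equals its
  conjugate, so nothing is lost.\<close>

lemma disp_has_sum: "((\<lambda>x. eh x * cis (phase x p)) has_sum complex_of_real (disp eh p)) UNIV"
proof -
  define s where "s = (\<Sum>\<^sub>\<infinity>x. eh x * cis (phase x p))"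
  have s: "((\<lambda>x. eh x * cis (phase x p)) has_sum s) UNIV"
    unfolding s_def by (rule has_sum_infsum[OF abs_summable_summable[OF disp_abs_summable]])
  then have "((\<lambda>x. cnj (eh x * cis (phase x p))) has_sum cnj s) UNIV" by (simp only: has_sum_cnj_iff)
  moreover have "bij (uminus :: int^'d \<Rightarrow> _)" by (rule bij_uminus)
  ultimately have "((\<lambda>x. cnj (eh (- x) * cis (phase (- x) p))) has_sum cnj s) UNIV"
    by (simp only: has_sum_reindex_bij_betw[of uminus UNIV UNIV "\<lambda>x. cnj (eh x * cis (phase x p))"])
  moreover have "cnj (eh (- x) * cis (phase (- x) p)) = eh x * cis (phase x p)" for x
    by (simp add: eh_sym phase_simps cis_cnj)
  ultimately have "((\<lambda>x. eh x * cis (phase x p)) has_sum cnj s) UNIV" by simp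
  then have "cnj s = s" using s by (rule has_sum_unique)
  then have "s = complex_of_real (Re s)" by (simp add: complex_eq_iff)
  then show ?thesis using s by (simp add: disp_def phase_def s_def)
qed

text \<open>Uniformity in \<open>p\<close> yields both the continuity of \<open>disp\<close> and the
  exchange of the hopping series with integration over the torus.\<close>

lemma disp_uniform_limit:
  "uniform_limit UNIV (\<lambda>F p. \<Sum>x\<in>F. eh x * cis (phase x p)) (\<lambda>p. complex_of_real (disp eh p)) (finite_subsets_at_top UNIV)"
  by (rule Weierstrass_m_test_general'[OF _ disp_has_sum eh_l1]) (simp add: norm_mult)

lemma continuous_disp: "continuous_on UNIV (disp eh)"
proof -
  have "continuous_on UNIV (\<lambda>p. complex_of_real (disp eh p))"
    by (rule uniform_limit_theorem[OF _ disp_uniform_limit])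
       (auto simp: phase_def cis_conv_exp intro!: always_eventually continuous_intros)
  from continuous_on_Re[OF this] show ?thesis by simp
qed

lemma abs_disp_le: "\<bar>disp eh p\<bar> \<le> (\<Sum>\<^sub>\<infinity>x. cmod (eh x))"
  using norm_infsum_bound[OF disp_abs_summable[of p]] infsumI[OF disp_has_sum[of p]]
  by (simp add: norm_mult)

lemma disp_periodic: "disp eh (\<chi> i. p$i + 2 * pi * real_of_int (k$i)) = disp eh p"
  using has_sum_unique[OF disp_has_sum[of p]] disp_has_sum[of "\<chi> i. p$i + 2 * pi * real_of_int (k$i)"]
  unfolding cis_phase_periodic by fastforce

lemma disp_le_max: "disp eh p \<le> disp_max eh"
proof -
  obtain k where k: "(\<chi> i. p$i + 2 * pi * real_of_int (k$i)) \<in> torus" by (rule torus_representative)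
  have "disp eh (\<chi> i. p$i + 2 * pi * real_of_int (k$i)) \<le> disp_max eh"
    unfolding disp_max_def using abs_disp_le
    by (intro cSup_upper imageI k bdd_aboveI[of _ "\<Sum>\<^sub>\<infinity>x. cmod (eh x)"]) (auto simp: abs_le_iff)
  then show ?thesis by (simp only: disp_periodic)
qed

text \<open>\<open>p + q\<close> may leave the cell. If it were a maximum point, its representative
  in the cell would be \<open>p\<close>, so \<open>q\<close> would have components in
  \<open>2 pi\<close> times the integers; components of modulus at most \<open>pi\<close> must then
  vanish.\<close>

lemma disp_less_max:
  assumes p: "p \<in> torus" "\<And>p'. p' \<in> torus \<Longrightarrow> disp eh p' = disp_max eh \<Longrightarrow> p' = p"
    and q: "\<And>i. \<bar>q$i\<bar> \<le> pi" "q \<noteq> 0"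
  shows "disp eh (p + q) < disp_max eh"
proof (rule ccontr)
  assume "\<not> ?thesis"
  then have eq: "disp eh (p + q) = disp_max eh" using disp_le_max[of "p + q"] by simp
  obtain k where k: "(\<chi> i. (p + q)$i + 2 * pi * real_of_int (k$i)) \<in> torus" by (rule torus_representative)
  have pk: "(\<chi> i. (p + q)$i + 2 * pi * real_of_int (k$i)) = p"
    by (rule p(2)[OF k]) (simp only: disp_periodic eq)
  have qk: "q$i = - (2 * pi * real_of_int (k$i))" for i
    using arg_cong[OF pk, of "\<lambda>w. w$i"] by simp
  have "q$i = 0" for i
  proof -
    have "2 * pi * \<bar>real_of_int (k$i)\<bar> \<le> pi" using q(1)[of i] qk[of i] by (simp add: abs_mult)
    then have "\<bar>real_of_int (k$i)\<bar> * 2 \<le> 1" using pi_gt_zero by (simp add: mult.commute)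
    then have "k$i = 0" by linarith
    then show ?thesis by (simp add: qk)
  qed
  then show False using q(2) by (simp add: vec_eq_iff)
qed

text \<open>Away from \<open>p\<close> the lower bound comes from a positive minimum over a compact
  set, and the upper bound from boundedness of \<open>disp\<close>. The latter is therefore
  available for all \<open>q\<close>, the former on one period cell.\<close>

lemma disp_quadratic_at_max:
  assumes p: "p \<in> torus" "disp eh p = disp_max eh"
    "\<And>p'. p' \<in> torus \<Longrightarrow> disp eh p' = disp_max eh \<Longrightarrow> p' = p"
    and nd: "C2_nondeg_at (disp eh) p"
  obtains c C where "0 < c" "0 < C"
    "\<And>q. (\<And>i. \<bar>q$i\<bar> \<le> pi) \<Longrightarrow> c * (norm q)\<^sup>2 \<le> disp_max eh - disp eh (p + q)"
    "\<And>q. disp_max eh - disp eh (p + q) \<le> C * (norm q)\<^sup>2"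
proof -
  obtain r c C where r: "0 < r" and c: "0 < c" and C: "0 < C"
    and lo: "\<And>q. norm q \<le> r \<Longrightarrow> c * (norm q)\<^sup>2 \<le> disp_max eh - disp eh (p + q)"
    and up: "\<And>q. norm q \<le> r \<Longrightarrow> disp_max eh - disp eh (p + q) \<le> C * (norm q)\<^sup>2"
    using nondegenerate_max_quadratic[OF nd] disp_le_max unfolding p(2) by metis
  define K where "K = {q :: real^'d. (\<forall>i. \<bar>q$i\<bar> \<le> pi) \<and> r \<le> norm q}"
  have Kbox: "{q :: real^'d. \<forall>i. \<bar>q$i\<bar> \<le> pi} = cbox (\<chi> i. - pi) (\<chi> i. pi)"
    by (auto simp: mem_box_cart abs_le_iff minus_le_iff)
  have "K = cbox (\<chi> i. - pi) (\<chi> i. pi) \<inter> {q. r \<le> norm q}"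
    unfolding K_def Kbox[symmetric] by auto
  then have K: "compact K"
    by (simp only:) (intro compact_Int_closed compact_cbox closed_Collect_le continuous_intros)
  obtain R where R: "0 < R" "\<And>q :: real^'d. (\<And>i. \<bar>q$i\<bar> \<le> pi) \<Longrightarrow> norm q \<le> R"
    using bounded_cbox[of "(\<chi> i. - pi) :: real^'d" "\<chi> i. pi"] unfolding bounded_pos Kbox[symmetric] by auto
  obtain m where m: "0 < m" "\<And>q. q \<in> K \<Longrightarrow> m \<le> disp_max eh - disp eh (p + q)"
  proof (cases "K = {}")
    case True
    then show thesis using that[of 1] by simp
  next
    case False
    have "continuous_on K (\<lambda>q. disp_max eh - disp eh (p + q))"
      by (intro continuous_intros continuous_on_compose2[OF continuous_disp]) auto
    then obtain q0 where q0: "q0 \<in> K" "\<And>q. q \<in> K \<Longrightarrow> disp_max eh - disp eh (p + q0) \<le> disp_max eh - disp eh (p + q)"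
      using continuous_attains_inf[OF K False] by blast
    have "q0 \<noteq> 0" using q0(1) r by (auto simp: K_def)
    then have "disp eh (p + q0) < disp_max eh"
      using q0(1) by (intro disp_less_max p) (auto simp: K_def)
    then show thesis using that[of "disp_max eh - disp eh (p + q0)"] q0(2) by simp
  qed
  define A where "A = disp_max eh + (\<Sum>\<^sub>\<infinity>x. cmod (eh x))"
  have A: "disp_max eh - disp eh q \<le> A" for q using abs_disp_le[of q] by (simp add: A_def)
  have "0 \<le> A" using A[of p] p(2) by simp
  show thesis
  proof (rule that[of "min c (m / R\<^sup>2)" "max C (A / r\<^sup>2)"])
    show "0 < min c (m / R\<^sup>2)" using c m R by simp
    show "0 < max C (A / r\<^sup>2)" using C by simp
  next
    fix q :: "real^'d" assume q: "\<And>i. \<bar>q$i\<bar> \<le> pi"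
    show "min c (m / R\<^sup>2) * (norm q)\<^sup>2 \<le> disp_max eh - disp eh (p + q)"
    proof (cases "norm q \<le> r")
      case True
      have "min c (m / R\<^sup>2) * (norm q)\<^sup>2 \<le> c * (norm q)\<^sup>2" by (intro mult_right_mono) auto
      with lo[OF True] show ?thesis by linarith
    next
      case False
      have "min c (m / R\<^sup>2) * (norm q)\<^sup>2 \<le> (m / R\<^sup>2) * R\<^sup>2"
        using R(2)[OF q] m R(1) c by (intro mult_mono power_mono) auto
      also have "\<dots> = m" using R(1) by simp
      also have "\<dots> \<le> disp_max eh - disp eh (p + q)" using False q by (intro m) (auto simp: K_def)
      finally show ?thesis .
    qed
  next
    fix q :: "real^'d"
    show "disp_max eh - disp eh (p + q) \<le> max C (A / r\<^sup>2) * (norm q)\<^sup>2"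
    proof (cases "norm q \<le> r")
      case True
      have "C * (norm q)\<^sup>2 \<le> max C (A / r\<^sup>2) * (norm q)\<^sup>2" by (intro mult_right_mono) auto
      with up[OF True] show ?thesis by linarith
    next
      case False
      have "A = (A / r\<^sup>2) * r\<^sup>2" using r by simp
      also have "\<dots> \<le> max C (A / r\<^sup>2) * (norm q)\<^sup>2"
        using False r C \<open>0 \<le> A\<close> by (intro mult_mono power_mono) auto
      finally show ?thesis using A[of "p + q"] by linarith
    qed
  qed
qed

end

section \<open>The hopping operator and the torus\<close>

lemma bij_add_right: "bij (\<lambda>x::'a::ab_group_add. x + y)"
  by (rule bij_betw_byWitness[where f' = "\<lambda>x. x - y"]) auto

lift_definition shift :: "'a::ab_group_add \<Rightarrow> 'a ell2 \<Rightarrow> 'a ell2" is "\<lambda>y f x. f (x + y)"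
  subgoal for y f
    using summable_on_reindex_bij_betw[OF bij_add_right, of "\<lambda>x. (cmod (f x))\<^sup>2" y] by (simp add: l2_def)
  done

lemma coord_shift [simp]: "coord (shift y f) x = coord f (x + y)"
  by transfer simp

lemma inner_shift_left: "shift y f \<bullet> g = f \<bullet> shift (- y) g"
  unfolding inner_ell2_def
  using infsum_reindex_bij_betw[OF bij_add_right, of "\<lambda>x. coord f x \<bullet> coord (shift (- y) g) x" y] by simp

lemma norm_shift [simp]: "norm (shift y f) = norm f"
proof -
  have "shift (- y) (shift y f) = f" by (rule ell2_eqI) simp
  then show ?thesis by (simp add: norm_eq_sqrt_inner inner_shift_left)
qed

lift_definition trunc :: "'a set \<Rightarrow> 'a ell2 \<Rightarrow> 'a ell2" is "\<lambda>F f x. if x \<in> F then f x else 0"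
  by (erule l2_dominated[where c = 1]) auto

lemma coord_trunc [simp]: "coord (trunc F f) x = (if x \<in> F then coord f x else 0)"
  by transfer simp

text \<open>By this density the Fourier identities are needed for trigonometric polynomials only;
  continuity of \<open>Q\<close> and of the coordinates carries the resulting inequalities to the
  whole space.\<close>

lemma trunc_tendsto: "((\<lambda>F. trunc F f) \<longlongrightarrow> f) (finite_subsets_at_top UNIV)"
proof -
  have eq: "(norm (trunc F f - f))\<^sup>2 = (norm f)\<^sup>2 - (\<Sum>x\<in>F. (cmod (coord f x))\<^sup>2)" if "finite F" for F
  proof (rule has_sum_unique[OF norm_ell2_has_sum])
    have "((\<lambda>x. if x \<in> F then (cmod (coord f x))\<^sup>2 else 0) has_sum (\<Sum>x\<in>F. (cmod (coord f x))\<^sup>2)) UNIV"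
      by (rule has_sum_finite_neutralI[OF that]) (auto intro: sum.cong)
    from has_sum_add[OF norm_ell2_has_sum has_sum_uminusI[OF this]]
    have "((\<lambda>x. (cmod (coord f x))\<^sup>2 - (if x \<in> F then (cmod (coord f x))\<^sup>2 else 0)) has_sum
        (norm f)\<^sup>2 - (\<Sum>x\<in>F. (cmod (coord f x))\<^sup>2)) UNIV"
      by simp
    moreover have "(cmod (coord (trunc F f - f) x))\<^sup>2 = (cmod (coord f x))\<^sup>2 - (if x \<in> F then (cmod (coord f x))\<^sup>2 else 0)" for x
      by simp
    ultimately show "((\<lambda>x. (cmod (coord (trunc F f - f) x))\<^sup>2) has_sum
        (norm f)\<^sup>2 - (\<Sum>x\<in>F. (cmod (coord f x))\<^sup>2)) UNIV" by (simp only:)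
  qed
  have "((\<lambda>F. (norm f)\<^sup>2 - (\<Sum>x\<in>F. (cmod (coord f x))\<^sup>2)) \<longlongrightarrow> (norm f)\<^sup>2 - (norm f)\<^sup>2) (finite_subsets_at_top UNIV)"
    using norm_ell2_has_sum[of f] unfolding has_sum_def by (intro tendsto_intros)
  then have "((\<lambda>F. (norm (trunc F f - f))\<^sup>2) \<longlongrightarrow> 0) (finite_subsets_at_top UNIV)"
    by (subst tendsto_cong[where g = "\<lambda>F. (norm f)\<^sup>2 - (\<Sum>x\<in>F. (cmod (coord f x))\<^sup>2)"])
       (auto simp: eq intro!: eventually_finite_subsets_at_top_weakI)
  from tendsto_real_sqrt[OF this] have "((\<lambda>F. trunc F f - f) \<longlongrightarrow> 0) (finite_subsets_at_top UNIV)"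
    by (simp add: tendsto_norm_zero_iff)
  then show ?thesis by (simp add: LIM_zero_iff)
qed

context dispersion
begin

text \<open>The sum is taken in norm, whereas \<open>h_op\<close> sums pointwise: bounded linear
  maps then pass through it term by term. \<open>coord_hop\<close> shows that both agree.\<close>

definition hop :: "(int^'d) ell2 \<Rightarrow> (int^'d) ell2" where
  "hop f = (\<Sum>\<^sub>\<infinity>y. cmul (eh y) (shift y f))"

lemma hop_abs_summable: "(\<lambda>y. norm (cmul (eh y) (shift y f))) summable_on UNIV"
  using summable_on_cmult_left[OF eh_l1, of "norm f"] by (simp add: norm_cmul)

lemma hop_has_sum: "((\<lambda>y. cmul (eh y) (shift y f)) has_sum hop f) UNIV"
  unfolding hop_def by (rule has_sum_infsum[OF abs_summable_summable[OF hop_abs_summable]])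

lemma coord_hop: "coord (hop f) x = (\<Sum>\<^sub>\<infinity>y. eh y * coord f (x + y))"
  using has_sum_bounded_linear[OF bounded_linear_coord[of x] hop_has_sum[of f]] by (simp add: infsumI)

lemma hop_inner_has_sum: "((\<lambda>y. cmul (eh y) (shift y f) \<bullet> g) has_sum hop f \<bullet> g) UNIV"
  by (rule has_sum_bounded_linear[OF bounded_linear_inner_left hop_has_sum])

lemma bl_hop: "bounded_linear hop"
proof (rule bounded_linear_intro)
  show "hop (f + g) = hop f + hop g" for f g
  proof (rule has_sum_unique[OF hop_has_sum])
    have "cmul (eh y) (shift y (f + g)) = cmul (eh y) (shift y f) + cmul (eh y) (shift y g)" for y
      by (rule ell2_eqI) (simp add: algebra_simps)
    then show "((\<lambda>y. cmul (eh y) (shift y (f + g))) has_sum hop f + hop g) UNIV"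
      using has_sum_add[OF hop_has_sum hop_has_sum, of f g] by simp
  qed
  show "hop (r *\<^sub>R f) = r *\<^sub>R hop f" for r f
  proof (rule has_sum_unique[OF hop_has_sum])
    have "cmul (eh y) (shift y (r *\<^sub>R f)) = r *\<^sub>R cmul (eh y) (shift y f)" for y
      by (rule ell2_eqI) simp
    then show "((\<lambda>y. cmul (eh y) (shift y (r *\<^sub>R f))) has_sum r *\<^sub>R hop f) UNIV"
      using has_sum_bounded_linear[OF bounded_linear_scaleR_right[of r] hop_has_sum, of f] by simp
  qed
  show "norm (hop f) \<le> norm f * (\<Sum>\<^sub>\<infinity>x. cmod (eh x))" for f
    using norm_infsum_bound[OF hop_abs_summable[of f]] unfolding hop_def[symmetric]
    by (simp add: norm_cmul infsum_cmult_right' mult.commute)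
qed

lemma cmul_hop: "hop (cmul c f) = cmul c (hop f)"
proof (rule has_sum_unique[OF hop_has_sum])
  have "cmul (eh y) (shift y (cmul c f)) = cmul c (cmul (eh y) (shift y f))" for y
    by (rule ell2_eqI) simp
  then show "((\<lambda>y. cmul (eh y) (shift y (cmul c f))) has_sum cmul c (hop f)) UNIV"
    using has_sum_bounded_linear[OF bounded_linear_cmul[of c] hop_has_sum, of f] by simp
qed

lemma sym_hop: "hop f \<bullet> g = f \<bullet> hop g"
proof (rule has_sum_unique[OF hop_inner_has_sum])
  have "cmul (eh y) (shift y f) \<bullet> g = cmul (eh (- y)) (shift (- y) g) \<bullet> f" for y
  proof -
    have "cmul (eh y) (shift y f) \<bullet> g = f \<bullet> shift (- y) (cmul (cnj (eh y)) g)"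
      by (simp add: inner_cmul_left inner_shift_left)
    also have "shift (- y) (cmul (cnj (eh y)) g) = cmul (eh (- y)) (shift (- y) g)"
      using eh_sym[of "- y"] by (intro ell2_eqI) simp
    finally show ?thesis by (simp add: inner_commute)
  qed
  moreover have "((\<lambda>y. cmul (eh (- y)) (shift (- y) g) \<bullet> f) has_sum hop g \<bullet> f) UNIV"
    using has_sum_reindex_bij_betw[OF bij_uminus, of "\<lambda>y. cmul (eh y) (shift y g) \<bullet> f" "hop g \<bullet> f"]
      hop_inner_has_sum[of g f] by simp
  ultimately show "((\<lambda>y. cmul (eh y) (shift y f) \<bullet> g) has_sum f \<bullet> hop g) UNIV"
    by (simp add: inner_commute)
qed

end

section \<open>Uniform measure on the Brillouin zone and orthogonality of characters\<close>

definition interval_prob :: "real measure" where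
  "interval_prob = density lborel (\<lambda>t. ennreal (indicator {-pi..pi} t / (2 * pi)))"

lemma sets_interval_prob [measurable_cong]: "sets interval_prob = sets borel"
  by (simp add: interval_prob_def)

lemma space_interval_prob [simp]: "space interval_prob = UNIV"
  by (simp add: interval_prob_def)

lemma prob_space_interval_prob: "prob_space interval_prob"
proof
  have "emeasure interval_prob (space interval_prob)
      = (\<integral>\<^sup>+t. ennreal (1 / (2 * pi)) * indicator {-pi..pi} t \<partial>lborel)"
    unfolding interval_prob_def
    by (subst emeasure_density) (auto intro!: nn_integral_cong simp: indicator_def)
  also have "\<dots> = 1"
    by (subst nn_integral_cmult_indicator) (auto simp: ennreal_mult[symmetric])
  finally show "emeasure interval_prob (space interval_prob) = 1" .
qed

lemma integral_interval_prob:
  fixes f :: "real \<Rightarrow> 'b::{banach, second_countable_topology}"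
  assumes "f \<in> borel_measurable borel"
  shows "integral\<^sup>L interval_prob f = (\<integral>t. indicator {-pi..pi} t *\<^sub>R f t \<partial>lborel) /\<^sub>R (2 * pi)"
proof -
  have "integral\<^sup>L interval_prob f = (\<integral>t. (indicator {-pi..pi} t / (2 * pi)) *\<^sub>R f t \<partial>lborel)"
    unfolding interval_prob_def using assms by (intro integral_density) auto
  also have "\<dots> = (\<integral>t. (indicator {-pi..pi} t *\<^sub>R f t) /\<^sub>R (2 * pi) \<partial>lborel)"
    by (simp only: divide_inverse_commute scaleR_scaleR)
  finally show ?thesis by (simp only: integral_scaleR_right)
qed

text \<open>The point \<open>0\<close> is excluded because \<open>0 powr b = 0\<close> would make
  the product in \<open>norm_powr_le_prod\<close> vanish exactly where the weight is
  singular.\<close>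

lemma AE_interval_prob: "AE t in interval_prob. \<bar>t\<bar> \<le> pi \<and> t \<noteq> 0"
proof -
  have "AE t in lborel. t \<noteq> (0::real)" by (rule AE_lborel_singleton)
  then show ?thesis unfolding interval_prob_def
    by (subst AE_density) (auto simp: indicator_def elim!: eventually_mono)
qed

lemma integral_interval_prob_cis:
  "integral\<^sup>L interval_prob (\<lambda>t. cis (real_of_int n * t)) = (if n = 0 then 1 else 0)"
proof (cases "n = 0")
  case True
  then show ?thesis using prob_space.prob_space[OF prob_space_interval_prob] by simp
next
  case False
  have "(\<integral>t. indicator {-pi..pi} t *\<^sub>R cis (real_of_int n * t) \<partial>lborel) =
      cis (real_of_int n * pi) / (\<i> * real_of_int n) - cis (real_of_int n * (- pi)) / (\<i> * real_of_int n)"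
  proof (rule integral_FTC_Icc)
    fix t :: real
    show "((\<lambda>t. cis (real_of_int n * t) / (\<i> * real_of_int n)) has_vector_derivative cis (real_of_int n * t)) (at t within {-pi..pi})"
      unfolding cis_conv_exp using False
      by (auto intro!: derivative_eq_intros has_vector_derivative_real_field simp: field_simps)
  qed (auto intro!: continuous_intros)
  also have "cis (real_of_int n * pi) = cis (real_of_int n * (- pi) + 2 * pi * real_of_int n)"
    by (simp add: algebra_simps)
  also have "\<dots> = cis (real_of_int n * (- pi))"
    by (simp only: cis_mult[symmetric]) simp
  finally show ?thesis using False
    by (subst integral_interval_prob) (auto intro!: borel_measurable_continuous_onI continuous_intros)
qed

lemma integrable_powr_interval_prob:
  assumes "- 1 < a"
  shows "integrable interval_prob (\<lambda>t. \<bar>t\<bar> powr a)"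
proof -
  have 1: "(\<lambda>t. \<bar>t\<bar> powr a) integrable_on {0..pi}"
    using integrable_on_powr_from_0[OF assms, of pi] by (rule integrable_cong[THEN iffD1, rotated]) auto
  then have 2: "(\<lambda>t. \<bar>t\<bar> powr a) integrable_on {-pi..0}"
    using Henstock_Kurzweil_Integration.integrable_reflect_real[of "\<lambda>t. \<bar>t\<bar> powr a" pi 0] by simp
  have "(\<lambda>t. \<bar>t\<bar> powr a) integrable_on {-pi..pi}"
    using 1 2 by (intro Henstock_Kurzweil_Integration.integrable_combine[of "-pi" 0 pi]) auto
  then have "(\<lambda>t. \<bar>t\<bar> powr a) absolutely_integrable_on {-pi..pi}"
    by (intro nonnegative_absolutely_integrable_1) auto
  then have "integrable lborel (\<lambda>t. indicator {-pi..pi} t *\<^sub>R (\<bar>t\<bar> powr a))"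
    unfolding set_integrable_def by (subst (asm) integrable_completion) auto
  then have "integrable lborel (\<lambda>t. (indicator {-pi..pi} t *\<^sub>R (\<bar>t\<bar> powr a)) /\<^sub>R (2 * pi))"
    by (rule integrable_scaleR_right)
  then have "integrable lborel (\<lambda>t. (indicator {-pi..pi} t / (2 * pi)) *\<^sub>R (\<bar>t\<bar> powr a))"
    by (simp only: divide_inverse_commute scaleR_scaleR)
  then show ?thesis unfolding interval_prob_def by (subst integrable_density) auto
qed

text \<open>The Brillouin zone is modelled as the probability space of the functions \<open>'d \<Rightarrow> real\<close> with
  independent uniform components, so that integrals of products factorise.\<close>

definition torus_prob :: "('d::finite \<Rightarrow> real) measure" where
  "torus_prob = PiM UNIV (\<lambda>_. interval_prob)"

definition tvec :: "('d::finite \<Rightarrow> real) \<Rightarrow> real^'d" where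
  "tvec q = (\<chi> i. q i)"

lemma tvec_nth [simp]: "tvec q $ i = q i"
  by (simp add: tvec_def)

lemma prob_space_torus_prob: "prob_space torus_prob"
  unfolding torus_prob_def by (intro prob_space_PiM prob_space_interval_prob)

interpretation torus: prob_space torus_prob by (rule prob_space_torus_prob)

interpretation interval: product_sigma_finite "\<lambda>_. interval_prob"
  by (simp add: product_sigma_finite_def prob_space_imp_sigma_finite prob_space_interval_prob)

lemma measurable_tvec [measurable]: "(tvec :: ('d::finite \<Rightarrow> real) \<Rightarrow> _) \<in> torus_prob \<rightarrow>\<^sub>M borel"
proof -
  have "(\<lambda>q. q i) \<in> borel_measurable torus_prob" for i :: 'd
    unfolding torus_prob_def by measurable
  then show ?thesis
    by (subst borel_measurable_euclidean_space) (auto simp: Basis_vec_def inner_axis)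
qed

lemma AE_torus_prob: "AE q in (torus_prob :: ('d::finite \<Rightarrow> real) measure). \<forall>i. \<bar>q i\<bar> \<le> pi \<and> q i \<noteq> 0"
  unfolding torus_prob_def
  by (intro AE_all_countable[THEN iffD2] allI AE_PiM_component prob_space_interval_prob AE_interval_prob) auto

lemma integral_cis_phase:
  "integral\<^sup>L torus_prob (\<lambda>q. cis (phase x (tvec q))) = (if x = 0 then 1 else 0)"
proof -
  have "cis (phase x (tvec q)) = (\<Prod>i\<in>UNIV. cis (real_of_int (x$i) * q i))" for q
    by (simp add: phase_def cis_conv_exp exp_sum sum_distrib_left)
  then have "integral\<^sup>L torus_prob (\<lambda>q. cis (phase x (tvec q)))
      = (\<Prod>i\<in>UNIV. integral\<^sup>L interval_prob (\<lambda>t. cis (real_of_int (x$i) * t)))"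
    unfolding torus_prob_def
    by (simp only:) (intro interval.product_integral_prod finite finite_measure.integrable_const_bound[of _ _ 1]
        prob_space.finite_measure prob_space_interval_prob;
        auto simp: measurable_cong_sets[OF sets_interval_prob refl] intro!: borel_measurable_continuous_onI continuous_intros)
  also have "\<dots> = (if x = 0 then 1 else 0)"
    unfolding integral_interval_prob_cis by (auto simp: vec_eq_iff prod_zero_iff)
  finally show ?thesis .
qed

section \<open>Fourier representation of the quadratic form\<close>

text \<open>Cauchy-Schwarz recovered from its scaled arithmetic-geometric form. The optimal scale is
  \<open>sqrt (B / A)\<close>; when \<open>A\<close> or \<open>B\<close> vanishes, an explicit large
  or small scale forces \<open>r = 0\<close>.\<close>

lemma le_mult_of_all_scaled:
  fixes r A B :: real
  assumes "0 \<le> r" "0 \<le> A" "0 \<le> B" and le: "\<And>s. 0 < s \<Longrightarrow> 2 * r \<le> s * A + B / s"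
  shows "r\<^sup>2 \<le> A * B"
proof (cases "A = 0 \<or> B = 0")
  case False
  then have AB: "0 < A" "0 < B" using assms by auto
  define s where "s = sqrt B / sqrt A"
  have "s * A = sqrt A * sqrt B" using AB by (simp add: s_def real_div_sqrt) (simp add: field_simps)
  moreover have "B / s = sqrt A * sqrt B" using AB by (simp add: s_def real_div_sqrt) (simp add: field_simps)
  moreover have "0 < s" using AB by (simp add: s_def)
  ultimately have "r \<le> sqrt A * sqrt B" using le[of s] by simp
  then have "r\<^sup>2 \<le> (sqrt A * sqrt B)\<^sup>2" using \<open>0 \<le> r\<close> by (rule power_mono)
  then show ?thesis using AB by (simp add: power_mult_distrib)
next
  case True
  have "r = 0"
  proof (rule ccontr)
    assume "r \<noteq> 0"
    with \<open>0 \<le> r\<close> have r: "0 < r" by simp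
    from True show False
    proof
      assume "A = 0"
      have "2 * r \<le> B / (B / r + 1)"
        using le[of "B / r + 1"] \<open>A = 0\<close> r \<open>0 \<le> B\<close> by (simp add: add_nonneg_pos)
      moreover have "0 < B / r + 1" using r \<open>0 \<le> B\<close> by (simp add: add_nonneg_pos)
      ultimately have "2 * r * (B / r + 1) \<le> B" by (simp add: le_divide_eq)
      then show False using r \<open>0 \<le> B\<close> by (simp add: algebra_simps)
    next
      assume "B = 0"
      have "2 * r \<le> r / (A + 1) * A"
        using le[of "r / (A + 1)"] \<open>B = 0\<close> r \<open>0 \<le> A\<close> by simp
      also have "\<dots> = r * (A / (A + 1))" by simp
      also have "\<dots> \<le> r * 1" using r \<open>0 \<le> A\<close> by (intro mult_left_mono) auto
      finally show False using r by simp
    qed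
  qed
  then show ?thesis using assms by simp
qed

lemma continuous_cis_phase: "continuous_on UNIV (\<lambda>P. cis (phase x P))"
  unfolding phase_def by (intro continuous_intros)

lemma torus_integrable:
  fixes g :: "real^'d \<Rightarrow> 'b::{banach,second_countable_topology}"
  assumes "continuous_on UNIV g" "\<And>P. norm (g P) \<le> B"
  shows "integrable torus_prob (\<lambda>q. g (p + tvec q))"
proof (rule torus.integrable_const_bound[where B = B])
  show "(\<lambda>q. g (p + tvec q)) \<in> borel_measurable torus_prob"
    by (rule measurable_compose[OF _ borel_measurable_continuous_onI[OF assms(1)]]) measurable
qed (use assms(2) in auto)

lemma integral_cis_phase_shifted:
  "integral\<^sup>L torus_prob (\<lambda>q. cis (phase x (p + tvec q))) = (if x = 0 then 1 else 0)"
proof -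
  have "integral\<^sup>L torus_prob (\<lambda>q. cis (phase x (p + tvec q))) = cis (phase x p) * integral\<^sup>L torus_prob (\<lambda>q. cis (phase x (tvec q)))"
    by (subst integral_mult_right_zero[symmetric]) (simp only: phase_simps cis_mult)
  then show ?thesis by (simp add: integral_cis_phase phase_simps)
qed

text \<open>The Fourier transform of \<open>u\<close> on \<open>F\<close>. With the minus sign,
  \<open>shift y\<close> becomes multiplication by \<open>cis (phase y P)\<close>, so hopping
  becomes multiplication by \<open>disp\<close>.\<close>

definition trig_poly :: "(int^'d) set \<Rightarrow> (int^'d \<Rightarrow> complex) \<Rightarrow> real^'d \<Rightarrow> complex" where
  "trig_poly F u P = (\<Sum>x\<in>F. u x * cis (- phase x P))"

lemma continuous_trig_poly: "continuous_on UNIV (trig_poly F u)"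
proof -
  have "trig_poly F u = (\<lambda>P. \<Sum>x\<in>F. u x * cis (phase (- x) P))"
    by (simp add: trig_poly_def phase_simps fun_eq_iff)
  then show ?thesis
    by (simp only:) (intro continuous_intros continuous_cis_phase)
qed

lemma norm_trig_poly_le: "cmod (trig_poly F u P) \<le> (\<Sum>x\<in>F. cmod (u x))"
  unfolding trig_poly_def by (rule order_trans[OF norm_sum]) (simp add: norm_mult)

lemma integral_trig_poly:
  assumes "finite F"
  shows "integral\<^sup>L torus_prob (\<lambda>q. trig_poly F u (p + tvec q) * cis (phase x (p + tvec q))) = (if x \<in> F then u x else 0)"
proof -
  have "trig_poly F u P * cis (phase x P) = (\<Sum>y\<in>F. u y * cis (phase (x - y) P))" for P
    by (simp add: trig_poly_def sum_distrib_right mult.assoc cis_mult phase_simps)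
  then have "integral\<^sup>L torus_prob (\<lambda>q. trig_poly F u (p + tvec q) * cis (phase x (p + tvec q)))
      = (\<Sum>y\<in>F. integral\<^sup>L torus_prob (\<lambda>q. u y * cis (phase (x - y) (p + tvec q))))"
    by (simp only:) (intro Bochner_Integration.integral_sum integrable_mult_right torus_integrable[where B = 1] continuous_cis_phase; simp)
  also have "\<dots> = (\<Sum>y\<in>F. if y = x then u y else 0)"
    by (intro sum.cong) (auto simp: integral_cis_phase_shifted)
  finally show ?thesis using assms by simp
qed

text \<open>Parseval with the symbol of a translation: after expanding the square, orthogonality
  keeps only the pairs with \<open>a = b + y\<close>. The free base point \<open>p\<close> later
  becomes the maximum point, so that \<open>q\<close> measures the distance from it.\<close>

lemma shift_form_eq_integral:
  fixes f :: "(int^'d) ell2"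
  assumes F: "finite F" "\<And>x. x \<notin> F \<Longrightarrow> coord f x = 0"
  shows "cmul c (shift y f) \<bullet> f =
    integral\<^sup>L torus_prob (\<lambda>q. Re (c * cis (phase y (p + tvec q))) * (cmod (trig_poly F (coord f) (p + tvec q)))\<^sup>2)"
proof -
  let ?t = "\<lambda>q. trig_poly F (coord f) (p + tvec q)"
  have int: "integrable torus_prob (\<lambda>q. c * cis (phase y (p + tvec q)) * complex_of_real ((cmod (?t q))\<^sup>2))"
  proof (rule torus_integrable[where g = "\<lambda>P. c * cis (phase y P) * complex_of_real ((cmod (trig_poly F (coord f) P))\<^sup>2)"
        and B = "cmod c * (\<Sum>x\<in>F. cmod (coord f x))\<^sup>2"])
    show "continuous_on UNIV (\<lambda>P. c * cis (phase y P) * complex_of_real ((cmod (trig_poly F (coord f) P))\<^sup>2))"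
      by (intro continuous_intros continuous_cis_phase continuous_trig_poly)
    show "norm (c * cis (phase y P) * complex_of_real ((cmod (trig_poly F (coord f) P))\<^sup>2)) \<le> cmod c * (\<Sum>x\<in>F. cmod (coord f x))\<^sup>2" for P
      using power_mono[OF norm_trig_poly_le[of F "coord f" P], of 2]
      by (simp add: norm_mult norm_power mult_left_mono)
  qed
  have exp: "c * cis (phase y P) * complex_of_real ((cmod (trig_poly F (coord f) P))\<^sup>2)
      = (\<Sum>b\<in>F. \<Sum>a\<in>F. c * coord f a * cnj (coord f b) * cis (phase (y + b - a) P))" for P
  proof -
    have "complex_of_real ((cmod (trig_poly F (coord f) P))\<^sup>2) = cnj (trig_poly F (coord f) P) * trig_poly F (coord f) P"
      by (simp add: complex_norm_square mult.commute del: of_real_power)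
    also have "\<dots> = (\<Sum>b\<in>F. \<Sum>a\<in>F. cnj (coord f b) * cis (phase b P) * (coord f a * cis (- phase a P)))"
      by (simp add: trig_poly_def cnj_sum sum_product cis_cnj)
    finally show ?thesis
      by (simp add: sum_distrib_left) (intro sum.cong refl, simp add: phase_simps cis_mult[symmetric] cis_divide[symmetric] mult_ac diff_conv_add_uminus del: add_uminus_conv_diff)
  qed
  have "integral\<^sup>L torus_prob (\<lambda>q. c * cis (phase y (p + tvec q)) * complex_of_real ((cmod (?t q))\<^sup>2))
     = (\<Sum>b\<in>F. \<Sum>a\<in>F. integral\<^sup>L torus_prob (\<lambda>q. c * coord f a * cnj (coord f b) * cis (phase (y + b - a) (p + tvec q))))"
  proof -
    have i: "integrable torus_prob (\<lambda>q. c * coord f a * cnj (coord f b) * cis (phase (y + b - a) (p + tvec q)))" for a b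
      by (intro integrable_mult_right torus_integrable[where B = 1] continuous_cis_phase) simp
    show ?thesis unfolding exp
      by (simp only: Bochner_Integration.integral_sum Bochner_Integration.integrable_sum i)
  qed
  also have "\<dots> = (\<Sum>b\<in>F. c * coord f (b + y) * cnj (coord f b))"
  proof (intro sum.cong refl)
    fix b assume "b \<in> F"
    have "integral\<^sup>L torus_prob (\<lambda>q. c * coord f a * cnj (coord f b) * cis (phase (y + b - a) (p + tvec q)))
        = (if a = b + y then c * coord f a * cnj (coord f b) else 0)" for a
      by (auto simp: integral_cis_phase_shifted add.commute)
    then show "(\<Sum>a\<in>F. integral\<^sup>L torus_prob (\<lambda>q. c * coord f a * cnj (coord f b) * cis (phase (y + b - a) (p + tvec q))))
        = c * coord f (b + y) * cnj (coord f b)"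
      using F by simp
  qed
  finally have "Re (integral\<^sup>L torus_prob (\<lambda>q. c * cis (phase y (p + tvec q)) * complex_of_real ((cmod (?t q))\<^sup>2)))
      = (\<Sum>b\<in>F. (c * coord f (b + y)) \<bullet> coord f b)"
    by (simp add: inner_complex_def)
  also have "\<dots> = cmul c (shift y f) \<bullet> f"
    by (rule has_sum_unique[OF has_sum_finite_neutralI inner_ell2_has_sum]) (use F in auto)
  finally show ?thesis
    using integral_Re[OF int] by simp
qed

context dispersion
begin

definition Q :: "(int^'d) ell2 \<Rightarrow> real" where
  "Q f = disp_max eh * (norm f)\<^sup>2 - hop f \<bullet> f"

lemma norm_eq_integral:
  assumes F: "finite F" "\<And>x. x \<notin> F \<Longrightarrow> coord f x = 0"
  shows "(norm f)\<^sup>2 = integral\<^sup>L torus_prob (\<lambda>q. (cmod (trig_poly F (coord f) (p + tvec q)))\<^sup>2)"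
proof -
  have "cmul 1 (shift 0 f) = f" by (rule ell2_eqI) simp
  then show ?thesis
    using shift_form_eq_integral[OF F, of 1 0 p] by (simp add: dot_square_norm phase_simps)
qed

lemma integrable_disp_trig_poly:
  "integrable torus_prob (\<lambda>q. disp eh (p + tvec q) * (cmod (trig_poly F u (p + tvec q)))\<^sup>2)"
proof (rule torus_integrable[where g = "\<lambda>P. disp eh P * (cmod (trig_poly F u P))\<^sup>2"])
  show "continuous_on UNIV (\<lambda>P. disp eh P * (cmod (trig_poly F u P))\<^sup>2)"
    by (intro continuous_intros continuous_disp continuous_trig_poly)
  show "norm (disp eh P * (cmod (trig_poly F u P))\<^sup>2) \<le> (\<Sum>\<^sub>\<infinity>x. cmod (eh x)) * (\<Sum>x\<in>F. cmod (u x))\<^sup>2" for P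
    unfolding norm_mult using abs_disp_le[of P]
    by (intro mult_mono) (auto intro!: power_mono norm_trig_poly_le infsum_nonneg)
qed

lemma integrable_trig_poly_squared:
  "integrable torus_prob (\<lambda>q. (cmod (trig_poly F u (p + tvec q)))\<^sup>2)"
proof (rule torus_integrable[where g = "\<lambda>P. (cmod (trig_poly F u P))\<^sup>2"])
  show "continuous_on UNIV (\<lambda>P. (cmod (trig_poly F u P))\<^sup>2)"
    by (intro continuous_intros continuous_trig_poly)
  show "norm ((cmod (trig_poly F u P))\<^sup>2) \<le> (\<Sum>x\<in>F. cmod (u x))\<^sup>2" for P
    by (auto intro!: power_mono norm_trig_poly_le)
qed

text \<open>Each translation is already represented by an integral; the uniform convergence of the
  dispersion series justifies the limit under the integral.\<close>

lemma hop_form_eq_integral: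
  assumes F: "finite F" "\<And>x. x \<notin> F \<Longrightarrow> coord f x = 0"
  shows "hop f \<bullet> f = integral\<^sup>L torus_prob (\<lambda>q. disp eh (p + tvec q) * (cmod (trig_poly F (coord f) (p + tvec q)))\<^sup>2)"
proof (rule has_sum_unique[OF hop_inner_has_sum])
  let ?T = "\<lambda>P. (cmod (trig_poly F (coord f) P))\<^sup>2"
  let ?I = "integral\<^sup>L torus_prob (\<lambda>q. disp eh (p + tvec q) * ?T (p + tvec q))"
  have summand_int: "integrable torus_prob (\<lambda>q. Re (eh y * cis (phase y (p + tvec q))) * ?T (p + tvec q))" for y
  proof (rule torus_integrable[where g = "\<lambda>P. Re (eh y * cis (phase y P)) * ?T P"])
    show "continuous_on UNIV (\<lambda>P. Re (eh y * cis (phase y P)) * ?T P)"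
      by (intro continuous_intros continuous_cis_phase continuous_trig_poly)
    show "norm (Re (eh y * cis (phase y P)) * ?T P) \<le> cmod (eh y) * (\<Sum>x\<in>F. cmod (coord f x))\<^sup>2" for P
      unfolding norm_mult using abs_Re_le_cmod[of "eh y * cis (phase y P)"]
      by (intro mult_mono) (auto simp: norm_mult intro!: power_mono norm_trig_poly_le)
  qed
  show "((\<lambda>y. cmul (eh y) (shift y f) \<bullet> f) has_sum ?I) UNIV"
    unfolding has_sum_def
  proof (rule tendstoI)
    fix e :: real assume "0 < e"
    \<comment> \<open>The squared polynomial integrates to the squared norm of \<open>f\<close>, so
      a uniform error \<open>d\<close> costs \<open>d\<close> times that norm; the \<open>1\<close>
      covers \<open>f = 0\<close>.\<close>
    define d where "d = e / (1 + (norm f)\<^sup>2)"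
    have pos: "0 < 1 + (norm f)\<^sup>2" by (simp add: add_pos_nonneg)
    then have d: "0 < d" using \<open>0 < e\<close> by (simp add: d_def)
    have "\<forall>\<^sub>F G in finite_subsets_at_top UNIV. \<forall>P\<in>UNIV. dist (\<Sum>x\<in>G. eh x * cis (phase x P)) (complex_of_real (disp eh P)) < d"
      by (rule uniform_limitD[OF disp_uniform_limit d])
    then show "\<forall>\<^sub>F G in finite_subsets_at_top UNIV. dist (\<Sum>y\<in>G. cmul (eh y) (shift y f) \<bullet> f) ?I < e"
    proof eventually_elim
      case (elim G)
      have bnd: "\<bar>(\<Sum>y\<in>G. Re (eh y * cis (phase y P))) - disp eh P\<bar> \<le> d" for P
      proof -
        have "\<bar>Re ((\<Sum>x\<in>G. eh x * cis (phase x P)) - complex_of_real (disp eh P))\<bar> \<le> d"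
          using elim by (intro order_trans[OF abs_Re_le_cmod]) (auto simp: dist_norm less_imp_le)
        then show ?thesis by simp
      qed
      have "(\<Sum>y\<in>G. cmul (eh y) (shift y f) \<bullet> f)
          = (\<Sum>y\<in>G. integral\<^sup>L torus_prob (\<lambda>q. Re (eh y * cis (phase y (p + tvec q))) * ?T (p + tvec q)))"
        by (intro sum.cong refl shift_form_eq_integral F)
      also have "\<dots> = integral\<^sup>L torus_prob (\<lambda>q. \<Sum>y\<in>G. Re (eh y * cis (phase y (p + tvec q))) * ?T (p + tvec q))"
        by (rule Bochner_Integration.integral_sum[symmetric], rule summand_int)
      finally have "(\<Sum>y\<in>G. cmul (eh y) (shift y f) \<bullet> f) - ?I
          = integral\<^sup>L torus_prob (\<lambda>q. (\<Sum>y\<in>G. Re (eh y * cis (phase y (p + tvec q))) * ?T (p + tvec q)) - disp eh (p + tvec q) * ?T (p + tvec q))"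
        by (simp only: Bochner_Integration.integral_diff integrable_disp_trig_poly Bochner_Integration.integrable_sum summand_int)
      also have "\<bar>\<dots>\<bar> \<le> integral\<^sup>L torus_prob (\<lambda>q. d * ?T (p + tvec q))"
      proof (rule order_trans[OF integral_abs_bound], rule integral_mono)
        fix q
        show "\<bar>(\<Sum>y\<in>G. Re (eh y * cis (phase y (p + tvec q))) * ?T (p + tvec q)) - disp eh (p + tvec q) * ?T (p + tvec q)\<bar> \<le> d * ?T (p + tvec q)"
          unfolding sum_distrib_right[symmetric] left_diff_distrib[symmetric] abs_mult
          using bnd[of "p + tvec q"] by (intro mult_mono) auto
      qed (intro integrable_abs integrable_mult_right Bochner_Integration.integrable_diff integrable_trig_poly_squared
          integrable_disp_trig_poly Bochner_Integration.integrable_sum summand_int)+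
      also have "\<dots> = d * (norm f)\<^sup>2" using norm_eq_integral[OF F, of p] by simp
      also have "\<dots> < e" using \<open>0 < e\<close> pos by (simp add: d_def field_simps)
      finally show ?case by (simp add: dist_real_def)
    qed
  qed
qed

lemma integrable_gap_trig_poly:
  "integrable torus_prob (\<lambda>q. (disp_max eh - disp eh (p + tvec q)) * (cmod (trig_poly F u (p + tvec q)))\<^sup>2)"
  unfolding left_diff_distrib
  by (intro Bochner_Integration.integrable_diff integrable_mult_right integrable_trig_poly_squared integrable_disp_trig_poly)

lemma Q_eq_integral:
  assumes F: "finite F" "\<And>x. x \<notin> F \<Longrightarrow> coord f x = 0"
  shows "Q f = integral\<^sup>L torus_prob (\<lambda>q. (disp_max eh - disp eh (p + tvec q)) * (cmod (trig_poly F (coord f) (p + tvec q)))\<^sup>2)"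
proof -
  let ?T = "\<lambda>q. (cmod (trig_poly F (coord f) (p + tvec q)))\<^sup>2"
  have "(norm f)\<^sup>2 = integral\<^sup>L torus_prob ?T" by (rule norm_eq_integral) (use F in auto)
  moreover have "hop f \<bullet> f = integral\<^sup>L torus_prob (\<lambda>q. disp eh (p + tvec q) * ?T q)"
    by (rule hop_form_eq_integral) (use F in auto)
  ultimately show ?thesis unfolding Q_def left_diff_distrib
    by (subst Bochner_Integration.integral_diff)
       (auto intro!: integrable_trig_poly_squared integrable_disp_trig_poly)
qed

lemma tendsto_Q: "(g \<longlongrightarrow> f) G \<Longrightarrow> ((\<lambda>n. Q (g n)) \<longlongrightarrow> Q f) G"
  unfolding Q_def by (intro tendsto_intros bounded_linear.tendsto[OF bl_hop])

lemma Q_nonneg: "0 \<le> Q f"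
proof (rule tendsto_lowerbound[OF tendsto_Q[OF trunc_tendsto]])
  show "\<forall>\<^sub>F F in finite_subsets_at_top UNIV. 0 \<le> Q (trunc F f)"
  proof (rule eventually_finite_subsets_at_top_weakI)
    fix F :: "(int^'d) set" assume F: "finite F"
    show "0 \<le> Q (trunc F f)"
      by (subst Q_eq_integral[OF F, where p = 0]) (auto intro!: integral_nonneg_AE AE_I2 mult_nonneg_nonneg simp: disp_le_max)
  qed
qed simp

end

section \<open>Oscillation estimate and trial functions\<close>

text \<open>Interpolates between the linear bound for small \<open>t\<close> and the trivial bound
  \<open>2\<close>. Lowering the exponent from \<open>2\<close> to \<open>\<alpha>\<close> weakens
  the growth in \<open>x\<close> at the price of a singularity in \<open>q\<close>.\<close>

lemma cis_diff_powr_le: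
  assumes "0 \<le> \<alpha>" "\<alpha> \<le> 2" "\<bar>\<theta>\<bar> \<le> t" "0 < t"
  shows "(cmod (cis \<theta> - 1))\<^sup>2 \<le> 4 * t powr \<alpha>"
proof (cases "t \<le> 1")
  case True
  have "cmod (cis \<theta> - 1) \<le> t" using cmod_cis_diff_le[of \<theta>] assms by linarith
  then have "(cmod (cis \<theta> - 1))\<^sup>2 \<le> t\<^sup>2" by (intro power_mono) auto
  also have "t\<^sup>2 = t powr 2" using assms by simp
  also have "\<dots> \<le> t powr \<alpha>" using assms True by (intro powr_mono') auto
  finally show ?thesis using powr_ge_zero[of t \<alpha>] by linarith
next
  case False
  have "cmod (cis \<theta> - 1) \<le> 2" using norm_triangle_ineq4[of "cis \<theta>" 1] by simp
  then have "(cmod (cis \<theta> - 1))\<^sup>2 \<le> 2\<^sup>2" by (intro power_mono) auto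
  also have "\<dots> \<le> 4 * t powr \<alpha>" using False assms by (simp add: ge_one_powr_ge_zero)
  finally show ?thesis .
qed

text \<open>Replaces a radial singularity by a product of one-dimensional ones, which integrates
  factor by factor.\<close>

lemma norm_powr_le_prod:
  fixes q :: "real^'d"
  assumes "b \<le> 0" "\<And>i. q$i \<noteq> 0"
  shows "norm q powr (b * real CARD('d)) \<le> (\<Prod>i\<in>UNIV. \<bar>q$i\<bar> powr b)"
proof -
  have n: "0 < norm q" using assms(2) by (auto simp: vec_eq_iff)
  have "norm q powr (b * real CARD('d)) = (\<Prod>i\<in>(UNIV::'d set). norm q powr b)"
    using n by (simp add: powr_power mult.commute)
  also have "\<dots> \<le> (\<Prod>i\<in>UNIV. \<bar>q$i\<bar> powr b)"
    using assms component_le_norm_cart[of q] by (intro prod_mono conjI powr_mono2') auto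
  finally show ?thesis .
qed

lemma lat_norm_pos: "x \<noteq> 0 \<Longrightarrow> 0 < lat_norm x"
  by (auto simp: lat_norm_def vec_eq_iff)

context dispersion
begin

(* The exponent is chosen so that |cis(phase x q) - 1|^2 / |q|^2 is bounded by
   |x|^(2-d+gamma) |q|^(gamma-d), whose singularity is dominated by an integrable product. *)
lemma oscillation_le_Q:
  assumes c: "0 < c" "\<And>q. (\<And>i. \<bar>q$i\<bar> \<le> pi) \<Longrightarrow> c * (norm q)\<^sup>2 \<le> disp_max eh - disp eh (p + q)"
    and \<gamma>: "0 < \<gamma>" "\<gamma> < 1" and dim: "CARD('d) \<le> 2"
  obtains C where "0 \<le> C" "\<And>f x. (cmod (coord f x - cis (phase x p) * coord f 0))\<^sup>2
      \<le> C * lat_norm x powr (2 - real CARD('d) + \<gamma>) * Q f"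
proof
  define \<alpha> where "\<alpha> = 2 - real CARD('d) + \<gamma>"
  \<comment> \<open>The exponent for each coordinate: it exceeds \<open>- 1\<close>, hence is
    integrable, and multiplied by the dimension it gives \<open>\<alpha> - 2\<close>.\<close>
  define b where "b = \<gamma> / real CARD('d) - 1"
  have d: "1 \<le> CARD('d)" by (simp add: Suc_leI)
  have dR: "1 \<le> real CARD('d)" "real CARD('d) \<le> 2" using d dim by linarith+
  have \<alpha>: "0 \<le> \<alpha>" "\<alpha> \<le> 2" using \<gamma> dR unfolding \<alpha>_def by linarith+
  have "0 < \<gamma> / real CARD('d)" "\<gamma> / real CARD('d) \<le> 1"
    using \<gamma> dR by (intro divide_pos_pos divide_le_eq_1_pos[THEN iffD2]; linarith)+
  then have b: "- 1 < b" "b \<le> 0" unfolding b_def by linarith+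
  have b\<alpha>: "b * real CARD('d) = \<alpha> - 2" using d by (simp add: b_def \<alpha>_def left_diff_distrib)
  define W where "W q = (\<Prod>i\<in>UNIV. \<bar>q i\<bar> powr b)" for q :: "'d \<Rightarrow> real"
  have W_int: "integrable torus_prob W"
    unfolding W_def torus_prob_def
    by (intro interval.product_integrable_prod finite integrable_powr_interval_prob b)
  define C where "C = (4 / c) * integral\<^sup>L torus_prob W"
  have W_nonneg: "0 \<le> W q" for q by (simp add: W_def prod_nonneg)
  then show C: "0 \<le> C" using c by (simp add: C_def)
  have fin: "(cmod (coord f x - cis (phase x p) * coord f 0))\<^sup>2 \<le> C * lat_norm x powr \<alpha> * Q f"
    if F: "finite F" "\<And>x. x \<notin> F \<Longrightarrow> coord f x = 0" for F f x
  proof (cases "x = 0")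
    case False
    then have L: "0 < lat_norm x" by (rule lat_norm_pos)
    define r where "r = coord f x - cis (phase x p) * coord f 0"
    define t where "t q = trig_poly F (coord f) (p + tvec q)" for q
    \<comment> \<open>\<open>\<psi>\<close> vanishes at \<open>q = 0\<close> and thereby compensates
      the zero of the weight \<open>e\<close> there; this is why the plane wave through
      \<open>f(0)\<close> is subtracted.\<close>
    define \<psi> where "\<psi> q = cis (phase x (p + tvec q)) - cis (phase x p)" for q
    define e where "e q = disp_max eh - disp eh (p + tvec q)" for q
    have t_int: "integrable torus_prob (\<lambda>q. t q * cis (phase y (p + tvec q)))" for y
      unfolding t_def
    proof (rule torus_integrable[where g = "\<lambda>P. trig_poly F (coord f) P * cis (phase y P)"])
      show "continuous_on UNIV (\<lambda>P. trig_poly F (coord f) P * cis (phase y P))"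
        by (intro continuous_intros continuous_trig_poly continuous_cis_phase)
      show "norm (trig_poly F (coord f) P * cis (phase y P)) \<le> (\<Sum>x\<in>F. cmod (coord f x))" for P
        using norm_trig_poly_le[of F "coord f" P] by (simp add: norm_mult)
    qed
    have coef: "coord f y = integral\<^sup>L torus_prob (\<lambda>q. t q * cis (phase y (p + tvec q)))" for y
      using integral_trig_poly[OF F(1), of "coord f" p y] F(2)[of y] by (auto simp: t_def)
    have split: "t q * \<psi> q = t q * cis (phase x (p + tvec q)) - cis (phase x p) * (t q * cis (phase 0 (p + tvec q)))" for q
      by (simp add: \<psi>_def phase_simps algebra_simps)
    have t\<psi>_int: "integrable torus_prob (\<lambda>q. t q * \<psi> q)"
      unfolding split by (intro Bochner_Integration.integrable_diff integrable_mult_right t_int)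
    have r_eq: "r = integral\<^sup>L torus_prob (\<lambda>q. t q * \<psi> q)"
      unfolding split r_def coef
      by (simp only: Bochner_Integration.integral_diff integrable_mult_right t_int integral_mult_right_zero)
    have e_int: "integrable torus_prob (\<lambda>q. e q * (cmod (t q))\<^sup>2)"
      unfolding e_def t_def by (rule integrable_gap_trig_poly)
    have Qf: "Q f = integral\<^sup>L torus_prob (\<lambda>q. e q * (cmod (t q))\<^sup>2)"
      unfolding e_def t_def by (rule Q_eq_integral) (use F in auto)
    \<comment> \<open>Pointwise, \<open>2 |t \<psi>| \<le> X |t|^2 + |\<psi>|^2 / X\<close> with
      \<open>X = s e\<close>, which is positive almost everywhere. The first term integrates to
      \<open>s Q f\<close>; the second is dominated by a multiple of \<open>W\<close>.\<close>
    have "2 * cmod r \<le> s * Q f + C * lat_norm x powr \<alpha> / s" if s: "0 < s" for s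
    proof -
      let ?K = "(4 / c) * lat_norm x powr \<alpha> / s"
      have "2 * cmod r \<le> 2 * integral\<^sup>L torus_prob (\<lambda>q. cmod (t q * \<psi> q))"
        unfolding r_eq using integral_norm_bound[of torus_prob "\<lambda>q. t q * \<psi> q"] by simp
      also have "\<dots> = integral\<^sup>L torus_prob (\<lambda>q. 2 * cmod (t q * \<psi> q))" by simp
      also have "\<dots> \<le> integral\<^sup>L torus_prob (\<lambda>q. s * (e q * (cmod (t q))\<^sup>2) + ?K * W q)"
      proof (rule integral_mono_AE)
        show "integrable torus_prob (\<lambda>q. 2 * cmod (t q * \<psi> q))"
          by (intro integrable_mult_right integrable_norm t\<psi>_int)
        show "integrable torus_prob (\<lambda>q. s * (e q * (cmod (t q))\<^sup>2) + ?K * W q)"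
          by (intro Bochner_Integration.integrable_add integrable_mult_right e_int W_int)
        show "AE q in torus_prob. 2 * cmod (t q * \<psi> q) \<le> s * (e q * (cmod (t q))\<^sup>2) + ?K * W q"
          using AE_torus_prob
        proof eventually_elim
          case (elim q)
          let ?n = "norm (tvec q)"
          have n: "0 < ?n" using elim by (auto simp: vec_eq_iff)
          have en: "c * ?n\<^sup>2 \<le> e q" unfolding e_def using elim by (intro c(2)) simp
          define X where "X = s * e q"
          have cn: "0 < c * ?n\<^sup>2" using c(1) n by simp
          then have X: "0 < X" "s * (c * ?n\<^sup>2) \<le> X" using en s by (auto simp: X_def)
          have "cmod (\<psi> q) = cmod (cis (phase x p)) * cmod (cis (phase x (tvec q)) - 1)"
            unfolding norm_mult[symmetric] \<psi>_def by (simp add: right_diff_distrib phase_simps cis_mult)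
          then have "(cmod (\<psi> q))\<^sup>2 \<le> 4 * (lat_norm x * ?n) powr \<alpha>"
            using cis_diff_powr_le[OF \<alpha> abs_phase_le[of x "tvec q"]] L n by simp
          also have "\<dots> = 4 * lat_norm x powr \<alpha> * ?n powr \<alpha>" using L n by (simp add: powr_mult)
          finally have "(cmod (\<psi> q))\<^sup>2 / X \<le> 4 * lat_norm x powr \<alpha> * ?n powr \<alpha> / (s * (c * ?n\<^sup>2))"
            using X s cn by (intro frac_le) auto
          also have "\<dots> = ?K * (?n powr \<alpha> / ?n\<^sup>2)" by (simp add: field_simps)
          also have "?n powr \<alpha> / ?n\<^sup>2 = ?n powr (\<alpha> - 2)" using n by (simp add: powr_diff)
          also have "?K * \<dots> \<le> ?K * W q"
            using norm_powr_le_prod[OF b(2), of "tvec q"] elim c(1) s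
            by (intro mult_left_mono) (simp_all add: b\<alpha> W_def)
          finally have 1: "(cmod (\<psi> q))\<^sup>2 / X \<le> ?K * W q" .
          have "0 \<le> (X * cmod (t q) - cmod (\<psi> q))\<^sup>2 / X" using X by simp
          also have "\<dots> = X * (cmod (t q))\<^sup>2 - 2 * cmod (t q * \<psi> q) + (cmod (\<psi> q))\<^sup>2 / X"
            using X by (simp add: power2_diff norm_mult field_simps power2_eq_square)
          finally show ?case using 1 by (simp add: X_def mult.assoc)
        qed
      qed
      also have "\<dots> = s * Q f + ?K * integral\<^sup>L torus_prob W"
        unfolding Qf using e_int W_int by (subst Bochner_Integration.integral_add) auto
      finally show ?thesis by (simp add: C_def field_simps)
    qed
    then have "(cmod r)\<^sup>2 \<le> Q f * (C * lat_norm x powr \<alpha>)"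
      using C Q_nonneg[of f] by (intro le_mult_of_all_scaled) auto
    then show ?thesis by (simp add: r_def mult.commute)
  qed (use C Q_nonneg[of f] in \<open>simp add: phase_simps\<close>)
  fix f x
  have "(cmod (coord f x - cis (phase x p) * coord f 0))\<^sup>2 \<le> C * lat_norm x powr \<alpha> * Q f"
  proof (rule tendsto_le[OF finite_subsets_at_top_neq_bot])
    show "((\<lambda>F. C * lat_norm x powr \<alpha> * Q (trunc F f)) \<longlongrightarrow> C * lat_norm x powr \<alpha> * Q f) (finite_subsets_at_top UNIV)"
      by (intro tendsto_intros tendsto_Q trunc_tendsto)
    show "((\<lambda>F. (cmod (coord (trunc F f) x - cis (phase x p) * coord (trunc F f) 0))\<^sup>2) \<longlongrightarrow>
        (cmod (coord f x - cis (phase x p) * coord f 0))\<^sup>2) (finite_subsets_at_top UNIV)"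
      by (intro tendsto_intros bounded_linear.tendsto[OF bounded_linear_coord] trunc_tendsto)
    show "\<forall>\<^sub>F F in finite_subsets_at_top UNIV. (cmod (coord (trunc F f) x - cis (phase x p) * coord (trunc F f) 0))\<^sup>2
        \<le> C * lat_norm x powr \<alpha> * Q (trunc F f)"
      by (rule eventually_finite_subsets_at_top_weakI) (rule fin, auto)
  qed
  then show "(cmod (coord f x - cis (phase x p) * coord f 0))\<^sup>2
      \<le> C * lat_norm x powr (2 - real CARD('d) + \<gamma>) * Q f" by (simp add: \<alpha>_def)
qed

text \<open>On the cell, \<open>|q|^2\<close> is at most four times the sum of
  \<open>|e^{i q_i} - 1|^2\<close>, the symbols of twisted differences. The factor
  \<open>cis (- p$i)\<close> gives the plane wave with momentum \<open>p\<close> zero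
  gradient.\<close>

lemma Q_le_gradient:
  fixes f :: "(int^'d) ell2"
  assumes C: "0 < C" "\<And>q. disp_max eh - disp eh (p + q) \<le> C * (norm q)\<^sup>2"
    and F: "finite F" "\<And>x. x \<notin> F \<Longrightarrow> coord f x = 0"
  shows "Q f \<le> 4 * C * (\<Sum>i\<in>UNIV. (norm (cmul (cis (- p$i)) (shift (axis i 1) f) - f))\<^sup>2)"
proof -
  define t where "t q = trig_poly F (coord f) (p + tvec q)" for q
  have grad: "(norm (cmul (cis (- p$i)) (shift (axis i 1) f) - f))\<^sup>2
      = integral\<^sup>L torus_prob (\<lambda>q. (cmod (cis (q i) - 1))\<^sup>2 * (cmod (t q))\<^sup>2)"
    and grad_int: "integrable torus_prob (\<lambda>q. (cmod (cis (q i) - 1))\<^sup>2 * (cmod (t q))\<^sup>2)" for i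
  proof -
    let ?g = "cmul (cis (- p$i)) (shift (axis i 1) f)"
    have ph: "phase (axis i 1) P = P$i" for P :: "real^'d"
      by (simp add: phase_def axis_def if_distrib[of "\<lambda>t. real_of_int t * _"] cong: if_cong)
    have gf: "?g \<bullet> f = integral\<^sup>L torus_prob (\<lambda>q. cos (q i) * (cmod (t q))\<^sup>2)"
      by (subst shift_form_eq_integral[where p = p and F = F]) (use F in \<open>auto simp: ph t_def cis_mult\<close>)
    have c2: "(cmod (cis \<theta> - 1))\<^sup>2 = 2 - 2 * cos \<theta>" for \<theta>
    proof -
      have "(cmod (cis \<theta> - 1))\<^sup>2 = (cos \<theta> - 1)\<^sup>2 + (sin \<theta>)\<^sup>2" by (simp add: cmod_power2)
      then show ?thesis using sin_cos_squared_add[of \<theta>] by (simp add: power2_diff)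
    qed
    have t2: "integrable torus_prob (\<lambda>q. (cmod (t q))\<^sup>2)"
      unfolding t_def by (rule integrable_trig_poly_squared)
    have cos_int: "integrable torus_prob (\<lambda>q. cos (q i) * (cmod (t q))\<^sup>2)"
    proof (rule Bochner_Integration.integrable_bound[OF t2])
      have "(\<lambda>q. tvec q $ i) \<in> borel_measurable torus_prob"
        by (rule measurable_compose[OF measurable_tvec borel_measurable_continuous_onI]) (intro continuous_intros)
      then show "(\<lambda>q. cos (q i) * (cmod (t q))\<^sup>2) \<in> borel_measurable torus_prob"
        using borel_measurable_integrable[OF t2] by simp
      show "AE q in torus_prob. norm (cos (q i) * (cmod (t q))\<^sup>2) \<le> norm ((cmod (t q))\<^sup>2)"
        by (simp add: abs_mult mult_left_le_one_le)
    qed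
    have eq: "(cmod (cis (q i) - 1))\<^sup>2 * (cmod (t q))\<^sup>2 = 2 * (cmod (t q))\<^sup>2 - 2 * (cos (q i) * (cmod (t q))\<^sup>2)" for q
      unfolding c2 by (simp add: algebra_simps)
    show "integrable torus_prob (\<lambda>q. (cmod (cis (q i) - 1))\<^sup>2 * (cmod (t q))\<^sup>2)"
      unfolding eq by (intro Bochner_Integration.integrable_diff integrable_mult_right t2 cos_int)
    have nf: "(norm f)\<^sup>2 = integral\<^sup>L torus_prob (\<lambda>q. (cmod (t q))\<^sup>2)"
      unfolding t_def by (rule norm_eq_integral) (use F in auto)
    have "(norm (?g - f))\<^sup>2 = (norm ?g)\<^sup>2 + (norm f)\<^sup>2 - 2 * (?g \<bullet> f)"
      unfolding power2_norm_eq_inner by (simp add: inner_diff_left inner_diff_right inner_commute)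
    also have "\<dots> = 2 * (norm f)\<^sup>2 - 2 * (?g \<bullet> f)" by (simp add: norm_cmul)
    also have "\<dots> = integral\<^sup>L torus_prob (\<lambda>q. (cmod (cis (q i) - 1))\<^sup>2 * (cmod (t q))\<^sup>2)"
      unfolding eq nf gf using t2 cos_int by (subst Bochner_Integration.integral_diff) auto
    finally show "(norm (?g - f))\<^sup>2 = integral\<^sup>L torus_prob (\<lambda>q. (cmod (cis (q i) - 1))\<^sup>2 * (cmod (t q))\<^sup>2)" .
  qed
  have "Q f = integral\<^sup>L torus_prob (\<lambda>q. (disp_max eh - disp eh (p + tvec q)) * (cmod (t q))\<^sup>2)"
    unfolding t_def by (rule Q_eq_integral) (use F in auto)
  also have "\<dots> \<le> integral\<^sup>L torus_prob (\<lambda>q. 4 * C * (\<Sum>i\<in>UNIV. (cmod (cis (q i) - 1))\<^sup>2 * (cmod (t q))\<^sup>2))"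
  proof (rule integral_mono_AE)
    show "integrable torus_prob (\<lambda>q. (disp_max eh - disp eh (p + tvec q)) * (cmod (t q))\<^sup>2)"
      unfolding t_def by (rule integrable_gap_trig_poly)
    show "integrable torus_prob (\<lambda>q. 4 * C * (\<Sum>i\<in>UNIV. (cmod (cis (q i) - 1))\<^sup>2 * (cmod (t q))\<^sup>2))"
      by (intro integrable_mult_right Bochner_Integration.integrable_sum grad_int)
    show "AE q in torus_prob. (disp_max eh - disp eh (p + tvec q)) * (cmod (t q))\<^sup>2
        \<le> 4 * C * (\<Sum>i\<in>UNIV. (cmod (cis (q i) - 1))\<^sup>2 * (cmod (t q))\<^sup>2)"
      using AE_torus_prob
    proof eventually_elim
      case (elim q)
      have "(norm (tvec q))\<^sup>2 = (\<Sum>i\<in>UNIV. \<bar>q i\<bar>\<^sup>2)"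
        by (simp add: norm_vec_def L2_set_def sum_nonneg)
      also have "\<dots> \<le> (\<Sum>i\<in>UNIV. (2 * cmod (cis (q i) - 1))\<^sup>2)"
        using elim by (intro sum_mono power_mono abs_le_cmod_cis_diff) auto
      also have "\<dots> = 4 * (\<Sum>i\<in>UNIV. (cmod (cis (q i) - 1))\<^sup>2)"
        by (simp add: power_mult_distrib sum_distrib_left)
      finally have "C * (norm (tvec q))\<^sup>2 \<le> C * (4 * (\<Sum>i\<in>UNIV. (cmod (cis (q i) - 1))\<^sup>2))"
        using C(1) by (intro mult_left_mono) auto
      then have "disp_max eh - disp eh (p + tvec q) \<le> C * (4 * (\<Sum>i\<in>UNIV. (cmod (cis (q i) - 1))\<^sup>2))"
        using C(2)[of "tvec q"] by linarith
      then have "(disp_max eh - disp eh (p + tvec q)) * (cmod (t q))\<^sup>2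
          \<le> C * (4 * (\<Sum>i\<in>UNIV. (cmod (cis (q i) - 1))\<^sup>2)) * (cmod (t q))\<^sup>2"
        by (intro mult_right_mono) auto
      then show ?case unfolding sum_distrib_right[symmetric] by (simp add: mult_ac)
    qed
  qed
  also have "\<dots> = 4 * C * (\<Sum>i\<in>UNIV. (norm (cmul (cis (- p$i)) (shift (axis i 1) f) - f))\<^sup>2)"
    using grad_int by (simp add: grad Bochner_Integration.integral_sum)
  finally show ?thesis .
qed

end

section \<open>Lattice cubes and logarithmic cutoffs\<close>

definition supnorm :: "int^'d \<Rightarrow> nat" where
  "supnorm x = Max (range (\<lambda>i. nat \<bar>x$i\<bar>))"

lemma supnorm_le_iff: "supnorm x \<le> k \<longleftrightarrow> (\<forall>i. \<bar>x$i\<bar> \<le> int k)"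
  unfolding supnorm_def by (subst Max_le_iff) (auto simp: nat_le_iff)

lemma supnorm_0: "supnorm 0 = 0"
  using supnorm_le_iff[of 0 0] by simp

lemma supnorm_add_axis:
  "supnorm (x + axis i 1) \<le> supnorm x + 1" "supnorm x \<le> supnorm (x + axis i 1) + 1"
proof -
  have *: "\<bar>y$j\<bar> \<le> int (supnorm y)" for y :: "int^'d" and j
    using supnorm_le_iff[of y "supnorm y"] by blast
  have "\<bar>(x + axis i 1)$j\<bar> \<le> int (supnorm x + 1)" for j
    using *[of x j] by (auto simp: axis_def)
  then show "supnorm (x + axis i 1) \<le> supnorm x + 1" by (subst supnorm_le_iff) blast
  have "\<bar>x$j\<bar> \<le> int (supnorm (x + axis i 1) + 1)" for j
    using *[of "x + axis i 1" j] by (auto simp: axis_def split: if_splits)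
  then show "supnorm x \<le> supnorm (x + axis i 1) + 1" by (subst supnorm_le_iff) blast
qed

lemma card_supnorm_le:
  "finite {x :: int^'d. supnorm x \<le> k}" "card {x :: int^'d. supnorm x \<le> k} = (2 * k + 1) ^ CARD('d)"
proof -
  have eq: "{x :: int^'d. supnorm x \<le> k} = vec_lambda ` (PiE UNIV (\<lambda>_. {- int k..int k}))"
  proof (intro equalityI subsetI)
    fix x :: "int^'d" assume "x \<in> {x. supnorm x \<le> k}"
    then have "vec_nth x \<in> PiE UNIV (\<lambda>_. {- int k..int k})" by (auto simp: supnorm_le_iff abs_le_iff minus_le_iff)
    then show "x \<in> vec_lambda ` (PiE UNIV (\<lambda>_. {- int k..int k}))" by (metis image_eqI vec_nth_inverse)
  next
    fix x :: "int^'d" assume "x \<in> vec_lambda ` (PiE UNIV (\<lambda>_. {- int k..int k}))"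
    then obtain u where u: "x = vec_lambda u" "\<And>i. u i \<in> {- int k..int k}" by (auto simp: PiE_def Pi_def)
    then show "x \<in> {x. supnorm x \<le> k}" by (force simp: supnorm_le_iff abs_le_iff minus_le_iff)
  qed
  show "finite {x :: int^'d. supnorm x \<le> k}" unfolding eq by (intro finite_imageI finite_PiE) auto
  have "inj_on vec_lambda (PiE (UNIV :: 'd set) (\<lambda>_. {- int k..int k}))"
    by (rule inj_onI) (simp add: vec_lambda_inject)
  then show "card {x :: int^'d. supnorm x \<le> k} = (2 * k + 1) ^ CARD('d)"
    unfolding eq by (simp add: card_image card_PiE nat_add_distrib nat_mult_distrib)
qed

text \<open>Here the dimension enters the construction of trial functions: shells grow at most
  linearly. In dimension two the count is exactly \<open>8 k\<close>, in dimension one it is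
  \<open>2\<close>.\<close>

lemma card_supnorm_eq_le:
  assumes "CARD('d) \<le> 2" "1 \<le> k"
  shows "card {x :: int^'d. supnorm x = k} \<le> 8 * k"
proof -
  have "{x :: int^'d. supnorm x = k} = {x. supnorm x \<le> k} - {x. supnorm x \<le> k - 1}"
    using assms(2) by auto
  then have "card {x :: int^'d. supnorm x = k} = card ({x :: int^'d. supnorm x \<le> k} - {x. supnorm x \<le> k - 1})"
    by (rule arg_cong)
  also have "\<dots> = card {x :: int^'d. supnorm x \<le> k} - card {x :: int^'d. supnorm x \<le> k - 1}"
    by (intro card_Diff_subset card_supnorm_le(1)) auto
  also have "\<dots> = (2 * k + 1) ^ CARD('d) - (2 * (k - 1) + 1) ^ CARD('d)"
    by (simp only: card_supnorm_le(2))
  also have "\<dots> \<le> 8 * k"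
  proof -
    obtain m where k: "k = Suc m" using assms(2) by (cases k) auto
    have "CARD('d) \<noteq> 0" by simp
    then have "CARD('d) = 1 \<or> CARD('d) = 2" using assms(1) by linarith
    then show ?thesis by (elim disjE) (simp_all add: k power2_eq_square algebra_simps)
  qed
  finally show ?thesis .
qed

text \<open>The shell of radius \<open>k\<close> contributes at most
  \<open>8 k / k^2 = 8 / k\<close>, so the total grows only logarithmically; the leading
  \<open>1\<close> is the origin.\<close>

lemma sum_supnorm_inverse_square_le:
  assumes "CARD('d) \<le> 2"
  shows "(\<Sum>x \<in> {x :: int^'d. supnorm x \<le> n}. (1 / max 1 (real (supnorm x)))\<^sup>2) \<le> 1 + 8 * (harm n :: real)"
proof (induction n)
  case 0
  have "card {x :: int^'d. supnorm x \<le> 0} = 1" by (simp only: card_supnorm_le) simp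
  then show ?case by (simp add: harm_def)
next
  case (Suc n)
  have eq: "{x :: int^'d. supnorm x \<le> Suc n} = {x. supnorm x \<le> n} \<union> {x. supnorm x = Suc n}" by auto
  have fin: "finite {x :: int^'d. supnorm x = Suc n}"
    by (rule finite_subset[OF _ card_supnorm_le(1)[of "Suc n"]]) auto
  have c8: "real (card {x :: int^'d. supnorm x = Suc n}) \<le> 8 * real (Suc n)"
    using of_nat_mono[OF card_supnorm_eq_le[OF assms, of "Suc n"], where 'a = real]
    by (simp only: of_nat_mult of_nat_numeral)
  have "(\<Sum>x \<in> {x :: int^'d. supnorm x = Suc n}. (1 / max 1 (real (supnorm x)))\<^sup>2)
      = real (card {x :: int^'d. supnorm x = Suc n}) * (1 / real (Suc n))\<^sup>2"
    by simp
  also have "\<dots> \<le> (8 * real (Suc n)) * (1 / real (Suc n))\<^sup>2"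
    by (intro mult_right_mono c8) simp
  also have "\<dots> = 8 * inverse (real (Suc n))" by (simp add: power2_eq_square inverse_eq_divide del: of_nat_Suc)
  finally show ?case
    unfolding eq using Suc fin
    by (subst sum.union_disjoint) (auto simp: card_supnorm_le harm_Suc simp del: of_nat_Suc)
qed

text \<open>The logarithmic cutoff of potential theory, with harmonic numbers in place of logarithms
  so that its increments are exact reciprocals. It is \<open>1\<close> at radius \<open>0\<close>
  and, for positive \<open>n\<close>, vanishes from radius \<open>n\<close> on.\<close>

definition log_cutoff :: "nat \<Rightarrow> nat \<Rightarrow> real" where
  "log_cutoff n k = max 0 (1 - harm k / harm n)"

lemma log_cutoff_step:
  assumes n: "1 \<le> n" and kl: "l \<le> k + 1" "k \<le> l + 1"
  shows "\<bar>log_cutoff n l - log_cutoff n k\<bar> \<le> (if k \<le> n then 1 / max 1 (real k) / harm n else 0)"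
proof -
  have hn: "0 < (harm n :: real)" using n by (simp add: harm_pos)
  show ?thesis
  proof (cases "k \<le> n")
    case True
    \<comment> \<open>Stepping outward changes the harmonic number by \<open>1 / (k + 1)\<close>,
      inward by \<open>1 / k\<close>; \<open>max 1\<close> covers \<open>k = 0\<close>, where only
      outward steps occur.\<close>
    have "\<bar>harm l - harm k :: real\<bar> \<le> 1 / max 1 (real k)"
    proof -
      consider "l = k" | "l = Suc k" | "k = Suc l" using kl by linarith
      then show ?thesis
      proof cases
        case 2
        then show ?thesis by (simp add: harm_Suc inverse_eq_divide frac_le)
      next
        case 3
        then show ?thesis by (simp add: harm_Suc inverse_eq_divide)
      qed simp
    qed
    have "\<bar>log_cutoff n l - log_cutoff n k\<bar> \<le> \<bar>(1 - harm l / harm n) - (1 - harm k / harm n)\<bar>"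
      unfolding log_cutoff_def by linarith
    also have "\<dots> = \<bar>harm l - harm k\<bar> / harm n"
      using hn by (simp add: diff_divide_distrib[symmetric] abs_minus_commute)
    also have "\<dots> \<le> 1 / max 1 (real k) / harm n"
      using \<open>\<bar>harm l - harm k :: real\<bar> \<le> 1 / max 1 (real k)\<close> hn by (intro divide_right_mono less_imp_le[OF hn])
    finally show ?thesis using True by simp
  next
    case False
    have 0: "log_cutoff n m = 0" if "n \<le> m" for m
      using harm_mono[OF that, where 'a = real] hn by (simp add: log_cutoff_def)
    show ?thesis using False kl 0[of k] 0[of l] by simp
  qed
qed

context dispersion
begin

text \<open>The unnormalised energy is of order \<open>h n\<close>, and dividing the profile by
  \<open>h n\<close> divides it by \<open>(h n)^2\<close>; the divergence of the harmonic series
  then drives \<open>Q\<close> to zero. The same mechanism makes the planar random walk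
  recurrent.\<close>

lemma trial_functions:
  fixes p :: "real^'d"
  assumes C: "0 < C" "\<And>q. disp_max eh - disp eh (p + q) \<le> C * (norm q)\<^sup>2"
    and dim: "CARD('d) \<le> 2"
  obtains f where "\<And>n::nat. coord (f n) 0 = 1" "(\<lambda>n. Q (f n)) \<longlonglongrightarrow> 0"
proof -
  \<comment> \<open>Radius \<open>Suc n\<close> keeps the harmonic number in the denominator
    positive.\<close>
  define u where "u n x = cis (phase x p) * complex_of_real (log_cutoff (Suc n) (supnorm x))" for n x
  define B where "B n = {x :: int^'d. supnorm x \<le> n}" for n
  have B: "finite (B n)" for n by (simp add: B_def card_supnorm_le)
  have u0: "u n x = 0" if "x \<notin> B (Suc n)" for n x
  proof -
    have "(harm (Suc n) :: real) \<le> harm (supnorm x)" using that by (intro harm_mono) (simp add: B_def)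
    then have "log_cutoff (Suc n) (supnorm x) = 0" by (simp add: log_cutoff_def harm_pos)
    then show ?thesis by (simp add: u_def)
  qed
  have ul2: "u n \<in> l2" for n
    unfolding l2_def mem_Collect_eq
    by (rule finite_nonzero_values_imp_summable_on, rule finite_subset[OF _ B[of "Suc n"]]) (use u0 in auto)
  define f where "f n = ell2_of (u n)" for n
  have cf: "coord (f n) = u n" for n by (simp add: f_def coord_ell2_of ul2)
  define h where "h n = (harm (Suc n) :: real)" for n
  have h: "0 < h n" for n by (simp add: h_def harm_pos)
  have grad: "(norm (cmul (cis (- p$i)) (shift (axis i 1) (f n)) - f n))\<^sup>2 \<le> (1 + 8 * h n) / (h n)\<^sup>2" for n i
  proof -
    let ?g = "cmul (cis (- p$i)) (shift (axis i 1) (f n)) - f n"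
    let ?b = "\<lambda>x. if x \<in> B (Suc n) then (1 / max 1 (real (supnorm x)))\<^sup>2 / (h n)\<^sup>2 else 0"
    have ph: "phase (axis i 1) p = p$i"
      by (simp add: phase_def axis_def if_distrib[of "\<lambda>t. real_of_int t * _"] cong: if_cong)
    have gx: "coord ?g x = cis (phase x p) * complex_of_real (log_cutoff (Suc n) (supnorm (x + axis i 1)) - log_cutoff (Suc n) (supnorm x))" for x
    proof -
      have "cis (- p$i) * cis (phase (x + axis i 1) p) = cis (phase x p)" by (simp add: cis_mult phase_simps ph)
      then show ?thesis by (simp add: cf u_def right_diff_distrib mult.assoc[symmetric])
    qed
    have le: "(cmod (coord ?g x))\<^sup>2 \<le> ?b x" for x
    proof -
      have "cmod (coord ?g x) = \<bar>log_cutoff (Suc n) (supnorm (x + axis i 1)) - log_cutoff (Suc n) (supnorm x)\<bar>"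
        unfolding gx norm_mult norm_of_real by simp
      also have "\<dots> \<le> (if supnorm x \<le> Suc n then 1 / max 1 (real (supnorm x)) / harm (Suc n) else 0)"
        by (intro log_cutoff_step supnorm_add_axis) simp
      finally have "(cmod (coord ?g x))\<^sup>2 \<le> (if supnorm x \<le> Suc n then 1 / max 1 (real (supnorm x)) / harm (Suc n) else 0)\<^sup>2"
        by (intro power_mono) auto
      then show ?thesis by (simp add: B_def h_def power_divide power_mult_distrib split: if_splits)
    qed
    have "(norm ?g)\<^sup>2 \<le> (\<Sum>x\<in>B (Suc n). ?b x)"
    proof (rule has_sum_mono[OF norm_ell2_has_sum])
      show "(?b has_sum (\<Sum>x\<in>B (Suc n). ?b x)) UNIV"
        by (rule has_sum_finite_neutralI[OF B]) auto
    qed (rule le)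
    also have "\<dots> = (\<Sum>x\<in>B (Suc n). (1 / max 1 (real (supnorm x)))\<^sup>2) / (h n)\<^sup>2"
      by (simp add: sum_divide_distrib)
    also have "\<dots> \<le> (1 + 8 * h n) / (h n)\<^sup>2"
      using sum_supnorm_inverse_square_le[OF dim, of "Suc n"] by (intro divide_right_mono) (auto simp: B_def h_def)
    finally show ?thesis .
  qed
  have Qle: "Q (f n) \<le> 4 * C * (real CARD('d) * ((1 + 8 * h n) / (h n)\<^sup>2))" for n
  proof -
    have "Q (f n) \<le> 4 * C * (\<Sum>i\<in>UNIV. (norm (cmul (cis (- p$i)) (shift (axis i 1) (f n)) - f n))\<^sup>2)"
      by (rule Q_le_gradient[OF C B[of "Suc n"]]) (simp add: cf u0)
    also have "\<dots> \<le> 4 * C * (\<Sum>i\<in>(UNIV :: 'd set). (1 + 8 * h n) / (h n)\<^sup>2)"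
      using C(1) by (intro mult_left_mono sum_mono grad) auto
    finally show ?thesis by simp
  qed
  have "filterlim h at_top sequentially"
    unfolding h_def using filterlim_compose[OF harm_at_top filterlim_Suc] by simp
  then have "(\<lambda>n. inverse (h n)) \<longlonglongrightarrow> 0" by (rule tendsto_inverse_0_at_top)
  then have "(\<lambda>n. 4 * C * (real CARD('d) * ((inverse (h n))\<^sup>2 + 8 * inverse (h n)))) \<longlonglongrightarrow> 4 * C * (real CARD('d) * (0\<^sup>2 + 8 * 0))"
    by (intro tendsto_intros)
  moreover have "(1 + 8 * h n) / (h n)\<^sup>2 = (inverse (h n))\<^sup>2 + 8 * inverse (h n)" for n
    using h[of n] by (simp add: field_simps power2_eq_square)
  ultimately have lim: "(\<lambda>n. 4 * C * (real CARD('d) * ((1 + 8 * h n) / (h n)\<^sup>2))) \<longlonglongrightarrow> 0" by simp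
  have "(\<lambda>n. Q (f n)) \<longlonglongrightarrow> 0"
    by (rule tendsto_sandwich[OF _ _ tendsto_const lim]) (intro always_eventually allI Q_nonneg Qle)+
  moreover have "coord (f n) 0 = 1" for n
    by (simp add: cf u_def phase_simps supnorm_0 log_cutoff_def harm_def)
  ultimately show thesis using that by blast
qed

end

section \<open>Bound states above the band\<close>

lemma finite_ge_of_summable:
  fixes f :: "'a \<Rightarrow> real"
  assumes "f summable_on UNIV" "\<And>x. 0 \<le> f x" "0 < e"
  shows "finite {x. e \<le> f x}"
proof (rule ccontr)
  assume "infinite {x. e \<le> f x}"
  define n where "n = Suc (nat \<lceil>infsum f UNIV / e\<rceil>)"
  obtain B where B: "finite B" "card B = n" "B \<subseteq> {x. e \<le> f x}"
    using infinite_arbitrarily_large[OF \<open>infinite _\<close>] by blast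
  have "real n * e = (\<Sum>x\<in>B. e)" using B by simp
  also have "\<dots> \<le> sum f B" using B(3) by (intro sum_mono) auto
  also have "\<dots> \<le> infsum f UNIV" using assms B(1) by (intro finite_sum_le_infsum) auto
  finally have "real n \<le> infsum f UNIV / e" using \<open>0 < e\<close> by (simp add: le_divide_eq)
  then show False unfolding n_def by linarith
qed

lemma lat_norm_ge_1:
  assumes "x \<noteq> 0"
  shows "1 \<le> lat_norm x"
proof -
  obtain i where "x$i \<noteq> 0" using assms by (auto simp: vec_eq_iff)
  then have "1 \<le> \<bar>real_of_int (x$i)\<bar>" by linarith
  also have "\<dots> \<le> lat_norm x"
    unfolding lat_norm_def using component_le_norm_cart[of "\<chi> i. real_of_int (x$i)" i] by simp
  finally show ?thesis .
qed

lemma young_weighted: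
  fixes a r \<eta> :: real
  assumes "0 < \<eta>"
  shows "2 * a * r \<le> \<eta> * a\<^sup>2 + r\<^sup>2 / \<eta>"
proof -
  have "0 \<le> (\<eta> * a - r)\<^sup>2 / \<eta>" using assms by simp
  also have "\<dots> = \<eta> * a\<^sup>2 - 2 * a * r + r\<^sup>2 / \<eta>"
    using assms by (simp add: power2_diff field_simps power2_eq_square)
  finally show ?thesis by simp
qed

text \<open>All that is used here about the maximum point is condensed into
  \<open>oscillation\<close>. The trial sequence is not part of the locale; the lemmas that need one
  assume it.\<close>

locale decaying_potential = dispersion eh for eh :: "int^'d \<Rightarrow> complex" +
  fixes v :: "int^'d \<Rightarrow> real" and \<alpha> C :: real and p :: "real^'d"
  assumes \<alpha>: "0 \<le> \<alpha>"
    and v_moment: "(\<lambda>x. lat_norm x powr \<alpha> * \<bar>v x\<bar>) summable_on UNIV"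
    and C: "0 \<le> C"
    and oscillation: "\<And>f x. (cmod (coord f x - cis (phase x p) * coord f 0))\<^sup>2 \<le> C * lat_norm x powr \<alpha> * Q f"
begin

text \<open>Away from \<open>0\<close> the moment weight is at least \<open>1\<close>. At
  \<open>0\<close> it is zero, since \<open>0 powr \<alpha> = 0\<close>, so the term
  \<open>v 0\<close> is added by hand.\<close>

lemma v_abs_summable: "(\<lambda>x. \<bar>v x\<bar>) summable_on UNIV"
proof -
  have "(\<lambda>x. if x = 0 then \<bar>v 0\<bar> else 0) summable_on UNIV"
    by (rule finite_nonzero_values_imp_summable_on) (auto intro: finite_subset[of _ "{0}"])
  from summable_on_add[OF this v_moment] show ?thesis
  proof (rule summable_on_comparison_test)
    fix x
    show "\<bar>v x\<bar> \<le> (if x = 0 then \<bar>v 0\<bar> else 0) + lat_norm x powr \<alpha> * \<bar>v x\<bar>"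
    proof (cases "x = 0")
      case False
      have "1 * \<bar>v x\<bar> \<le> lat_norm x powr \<alpha> * \<bar>v x\<bar>"
        using lat_norm_ge_1[OF False] \<alpha> by (intro mult_right_mono ge_one_powr_ge_zero) auto
      with False show ?thesis by simp
    qed simp
  qed simp
qed

lemma v_has_sum: "(v has_sum (\<Sum>\<^sub>\<infinity>x. v x)) UNIV"
  by (rule has_sum_infsum[OF abs_summable_summable]) (simp add: v_abs_summable)

definition V :: "(int^'d) ell2 \<Rightarrow> real" where
  "V f = (\<Sum>\<^sub>\<infinity>x. v x * (cmod (coord f x))\<^sup>2)"

definition A :: real where "A = (\<Sum>\<^sub>\<infinity>x. \<bar>v x\<bar>)"

definition D :: real where "D = C * (\<Sum>\<^sub>\<infinity>x. lat_norm x powr \<alpha> * \<bar>v x\<bar>)"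

lemma A_nonneg: "0 \<le> A" unfolding A_def by (intro infsum_nonneg) simp

lemma D_nonneg: "0 \<le> D" unfolding D_def using C by (intro mult_nonneg_nonneg infsum_nonneg) auto

lemma v_form_summable: "(\<lambda>x. v x * (cmod (coord f x))\<^sup>2) summable_on UNIV"
proof (rule abs_summable_summable, rule Infinite_Sum.abs_summable_on_comparison_test')
  show "(\<lambda>x. \<bar>v x\<bar> * (norm f)\<^sup>2) summable_on UNIV"
    by (rule summable_on_cmult_left[OF v_abs_summable])
  show "norm (v x * (cmod (coord f x))\<^sup>2) \<le> \<bar>v x\<bar> * (norm f)\<^sup>2" for x
    by (auto simp: abs_mult intro!: mult_left_mono power_mono norm_coord_le)
qed

text \<open>With \<open>r\<close> the deviation from the plane wave, \<open>|f(x)|^2\<close> and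
  \<open>|f(0)|^2\<close> differ by at most \<open>2 |f(0)| |r| + |r|^2\<close>. The free
  \<open>\<eta>\<close> decides how the cross term is shared: small \<open>\<eta>\<close> protects
  the sign of the sum of \<open>v\<close>, at the cost of a larger multiple of
  \<open>Q\<close>.\<close>

lemma V_close_to_sum:
  assumes \<eta>: "0 < \<eta>"
  shows "\<bar>V f - (\<Sum>\<^sub>\<infinity>x. v x) * (cmod (coord f 0))\<^sup>2\<bar> \<le> \<eta> * A * (cmod (coord f 0))\<^sup>2 + (1 + 1 / \<eta>) * D * Q f"
proof -
  let ?a = "cmod (coord f 0)"
  let ?l = "\<lambda>x. v x * (cmod (coord f x))\<^sup>2 - v x * ?a\<^sup>2"
  let ?u = "\<lambda>x. \<bar>v x\<bar> * (\<eta> * ?a\<^sup>2) + (lat_norm x powr \<alpha> * \<bar>v x\<bar>) * ((1 + 1 / \<eta>) * C * Q f)"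
  have l: "(?l has_sum (V f - (\<Sum>\<^sub>\<infinity>x. v x) * ?a\<^sup>2)) UNIV"
    using has_sum_add[OF has_sum_infsum[OF v_form_summable[of f]] has_sum_uminusI[OF has_sum_cmult_left[OF v_has_sum, of "?a\<^sup>2"]]]
    by (simp add: V_def)
  have u: "(?u has_sum (A * (\<eta> * ?a\<^sup>2) + (\<Sum>\<^sub>\<infinity>x. lat_norm x powr \<alpha> * \<bar>v x\<bar>) * ((1 + 1 / \<eta>) * C * Q f))) UNIV"
    unfolding A_def by (intro has_sum_add has_sum_cmult_left has_sum_infsum v_abs_summable v_moment)
  have le: "\<bar>?l x\<bar> \<le> ?u x" for x
  proof -
    define w where "w = cis (phase x p) * coord f 0"
    define r where "r = coord f x - w"
    have w: "cmod w = ?a" by (simp add: w_def norm_mult)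
    have r: "(cmod r)\<^sup>2 \<le> C * lat_norm x powr \<alpha> * Q f" unfolding r_def w_def by (rule oscillation)
    have "\<bar>(cmod (coord f x))\<^sup>2 - ?a\<^sup>2\<bar> \<le> 2 * ?a * cmod r + (cmod r)\<^sup>2"
    proof -
      have 1: "\<bar>cmod (coord f x) - ?a\<bar> \<le> cmod r"
        using norm_triangle_ineq3[of "coord f x" w] by (simp add: w r_def)
      have 2: "cmod (coord f x) + ?a \<le> 2 * ?a + cmod r" using 1 by linarith
      have "\<bar>(cmod (coord f x))\<^sup>2 - ?a\<^sup>2\<bar> = \<bar>cmod (coord f x) - ?a\<bar> * (cmod (coord f x) + ?a)"
        by (simp add: power2_eq_square square_diff_square_factored abs_mult mult.commute)
      also have "\<dots> \<le> cmod r * (2 * ?a + cmod r)" by (intro mult_mono 1 2) auto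
      finally show ?thesis by (simp add: power2_eq_square algebra_simps)
    qed
    also have "\<dots> \<le> \<eta> * ?a\<^sup>2 + (1 + 1 / \<eta>) * (cmod r)\<^sup>2"
      using young_weighted[OF \<eta>, of ?a "cmod r"] by (simp add: algebra_simps)
    also have "\<dots> \<le> \<eta> * ?a\<^sup>2 + (1 + 1 / \<eta>) * (C * lat_norm x powr \<alpha> * Q f)"
      using r \<eta> by (intro add_left_mono mult_left_mono) auto
    finally have "\<bar>v x\<bar> * \<bar>(cmod (coord f x))\<^sup>2 - ?a\<^sup>2\<bar> \<le> \<bar>v x\<bar> * (\<eta> * ?a\<^sup>2 + (1 + 1 / \<eta>) * (C * lat_norm x powr \<alpha> * Q f))"
      by (rule mult_left_mono) simp
    then show ?thesis
      unfolding right_diff_distrib[symmetric] abs_mult by (simp add: algebra_simps)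
  qed
  have "V f - (\<Sum>\<^sub>\<infinity>x. v x) * ?a\<^sup>2 \<le> A * (\<eta> * ?a\<^sup>2) + (\<Sum>\<^sub>\<infinity>x. lat_norm x powr \<alpha> * \<bar>v x\<bar>) * ((1 + 1 / \<eta>) * C * Q f)"
    using le by (intro has_sum_mono[OF l u]) (simp add: abs_le_iff)
  moreover have "- (V f - (\<Sum>\<^sub>\<infinity>x. v x) * ?a\<^sup>2) \<le> A * (\<eta> * ?a\<^sup>2) + (\<Sum>\<^sub>\<infinity>x. lat_norm x powr \<alpha> * \<bar>v x\<bar>) * ((1 + 1 / \<eta>) * C * Q f)"
    using le by (intro has_sum_mono[OF has_sum_uminusI[OF l] u]) (simp add: abs_le_iff)
  ultimately show ?thesis by (simp add: D_def mult_ac abs_le_iff)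
qed

text \<open>\<open>ell2_of\<close> is meaningful here because \<open>h_op\<close> preserves
  square-summability, which is established within \<open>coord_H\<close>.\<close>

definition H :: "real \<Rightarrow> (int^'d) ell2 \<Rightarrow> (int^'d) ell2" where
  "H \<mu> f = ell2_of (h_op eh v \<mu> (coord f))"

lemma coord_H: "coord (H \<mu> f) x = coord (hop f) x + complex_of_real (\<mu> * v x) * coord f x"
proof -
  have eq: "h_op eh v \<mu> (coord f) = (\<lambda>x. coord (hop f) x + complex_of_real (\<mu> * v x) * coord f x)"
    by (simp add: h_op_def coord_hop)
  have "\<bar>v x\<bar> \<le> A" for x
    using finite_sum_le_infsum[OF v_abs_summable, of "{x}"] by (simp add: A_def)
  then have "(\<lambda>x. complex_of_real (\<mu> * v x) * coord f x) \<in> l2"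
    by (intro l2_dominated[OF coord_l2[of f], where c = "\<bar>\<mu>\<bar> * A"])
       (auto simp: norm_mult abs_mult intro!: mult_right_mono mult_left_mono)
  then have "h_op eh v \<mu> (coord f) \<in> l2" unfolding eq by (intro l2_add coord_l2)
  then show ?thesis by (simp add: H_def coord_ell2_of eq)
qed

lemma compact_perturbation_h_op: "compact_perturbation hop (H \<mu>) (\<lambda>x. \<mu> * v x) (disp_max eh) (h_op eh v \<mu>)"
proof (rule compact_perturbation.intro)
  show "bounded_linear hop" by (rule bl_hop)
  show "hop f \<bullet> g = f \<bullet> hop g" for f g by (rule sym_hop)
  show "hop (cmul c f) = cmul c (hop f)" for c f by (rule cmul_hop)
  show "hop f \<bullet> f \<le> disp_max eh * (norm f)\<^sup>2" for f using Q_nonneg[of f] by (simp add: Q_def)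
  show "finite {x. e \<le> \<bar>\<mu> * v x\<bar>}" if "0 < e" for e
    using that summable_on_cmult_right[OF v_abs_summable, of "\<bar>\<mu>\<bar>"]
    by (intro finite_ge_of_summable) (auto simp: abs_mult)
  show "coord (H \<mu> f) x = coord (hop f) x + complex_of_real (\<mu> * v x) * coord f x" for f x by (rule coord_H)
  have "h_op eh v \<mu> (coord f) x = coord (hop f) x + complex_of_real (\<mu> * v x) * coord f x" for f x
    by (simp add: h_op_def coord_hop)
  then show "h_op eh v \<mu> (coord f) = coord (H \<mu> f)" for f
    by (simp add: fun_eq_iff coord_H)
qed

lemma H_form: "H \<mu> f \<bullet> f = disp_max eh * (norm f)\<^sup>2 - Q f + \<mu> * V f"
proof -
  interpret cp: compact_perturbation hop "H \<mu>" "\<lambda>x. \<mu> * v x" "disp_max eh" "h_op eh v \<mu>"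
    by (rule compact_perturbation_h_op)
  have "((\<lambda>x. \<mu> * (v x * (cmod (coord f x))\<^sup>2)) has_sum \<mu> * V f) UNIV"
    unfolding V_def by (intro has_sum_cmult_right has_sum_infsum v_form_summable)
  then have "H \<mu> f \<bullet> f - hop f \<bullet> f = \<mu> * V f"
    using cp.v_form_has_sum[of f] has_sum_unique by (auto simp: mult.assoc)
  then show ?thesis by (simp add: Q_def)
qed

text \<open>Eigenvectors to different eigenvalues are orthogonal, so the form exceeds the band edge
  on their whole span, while some nonzero combination vanishes at \<open>0\<close>. There
  \<open>V_close_to_sum\<close> with \<open>\<eta> = 1\<close> leaves only \<open>2 D Q\<close>,
  whence the smallness condition.\<close>

lemma at_most_one_eigenvalue_above:
  assumes \<mu>: "0 < \<mu>" "\<mu> * (2 * D) \<le> 1"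
    and E: "disp_max eh < E" "complex_of_real E \<in> disc_spectrum (h_op eh v \<mu>)"
    and E': "disp_max eh < E'" "complex_of_real E' \<in> disc_spectrum (h_op eh v \<mu>)"
  shows "E = E'"
proof (rule ccontr)
  assume ne: "E \<noteq> E'"
  interpret cp: compact_perturbation hop "H \<mu>" "\<lambda>x. \<mu> * v x" "disp_max eh" "h_op eh v \<mu>"
    by (rule compact_perturbation_h_op)
  have le: "H \<mu> f \<bullet> f \<le> disp_max eh * (norm f)\<^sup>2" if "coord f 0 = 0" for f
  proof -
    have "\<bar>V f\<bar> \<le> 2 * D * Q f" using V_close_to_sum[of 1 f] that by simp
    then have "\<mu> * V f \<le> \<mu> * (2 * D * Q f)" using \<mu> by (intro mult_left_mono) auto
    also have "\<dots> = (\<mu> * (2 * D)) * Q f" by simp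
    also have "\<dots> \<le> 1 * Q f" by (intro mult_right_mono \<mu> Q_nonneg)
    finally show ?thesis by (simp add: H_form)
  qed
  obtain f where f: "f \<noteq> 0" "H \<mu> f = E *\<^sub>R f" using cp.disc_spectrum_above_iff[OF E(1)] E(2) by blast
  obtain g where g: "g \<noteq> 0" "H \<mu> g = E' *\<^sub>R g" using cp.disc_spectrum_above_iff[OF E'(1)] E'(2) by blast
  have eig_cmul: "H \<mu> (cmul c h) = l *\<^sub>R cmul c h" if "H \<mu> h = l *\<^sub>R h" for c h l
    by (simp add: cp.cmul_H that) (auto intro: ell2_eqI)
  have gt: "disp_max eh * (norm (cmul c f + cmul k g))\<^sup>2 < H \<mu> (cmul c f + cmul k g) \<bullet> (cmul c f + cmul k g)"
    if "c \<noteq> 0 \<or> k \<noteq> 0" for c k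
  proof -
    define F where "F = cmul c f"
    define G where "G = cmul k g"
    have F: "H \<mu> F = E *\<^sub>R F" unfolding F_def by (rule eig_cmul[OF f(2)])
    have G: "H \<mu> G = E' *\<^sub>R G" unfolding G_def by (rule eig_cmul[OF g(2)])
    have FG: "F \<bullet> G = 0" by (rule cp.eigenvectors_orthogonal[OF F G ne])
    have n: "(norm (F + G))\<^sup>2 = (norm F)\<^sup>2 + (norm G)\<^sup>2"
      unfolding power2_norm_eq_inner by (simp add: inner_add_left inner_add_right FG inner_commute[of G F])
    have h: "H \<mu> (F + G) \<bullet> (F + G) = E * (norm F)\<^sup>2 + E' * (norm G)\<^sup>2"
      by (simp add: cp.H.add F G inner_add_left inner_add_right FG inner_commute[of G F] dot_square_norm)
    have "0 < norm F \<or> 0 < norm G" using that f(1) g(1) by (auto simp: F_def G_def norm_cmul)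
    then have "0 < (norm F)\<^sup>2 \<or> 0 < (norm G)\<^sup>2" by auto
    then have "0 < (E - disp_max eh) * (norm F)\<^sup>2 + (E' - disp_max eh) * (norm G)\<^sup>2"
      using E(1) E'(1) by (auto intro: add_pos_nonneg add_nonneg_pos)
    then show ?thesis unfolding F_def[symmetric] G_def[symmetric] n h by (simp add: algebra_simps)
  qed
  show False
  \<comment> \<open>If \<open>f\<close> vanishes at \<open>0\<close> it contradicts by itself;
    otherwise the coefficient of \<open>g\<close> in \<open>g(0) f - f(0) g\<close> is nonzero, so
    the combination is nontrivial.\<close>
  proof (cases "coord f 0 = 0")
    case True
    then show ?thesis using gt[of 1 0] le[of "cmul 1 f + cmul 0 g"] by simp
  next
    case False
    then show ?thesis
      using gt[of "coord g 0" "- coord f 0"] le[of "cmul (coord g 0) f + cmul (- coord f 0) g"] by simp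
  qed
qed

text \<open>The negative sum swallows the \<open>\<eta>\<close> part of the error, and small
  \<open>\<mu>\<close> lets \<open>Q\<close> swallow the rest, so the form never exceeds the band
  edge.\<close>

lemma no_eigenvalue_above:
  assumes neg: "(\<Sum>\<^sub>\<infinity>x. v x) < 0" and \<eta>: "0 < \<eta>" "\<eta> * A \<le> - (\<Sum>\<^sub>\<infinity>x. v x)"
    and \<mu>: "0 < \<mu>" "\<mu> * ((1 + 1 / \<eta>) * D) \<le> 1"
    and E: "disp_max eh < E"
  shows "complex_of_real E \<notin> disc_spectrum (h_op eh v \<mu>)"
proof
  assume "complex_of_real E \<in> disc_spectrum (h_op eh v \<mu>)"
  interpret cp: compact_perturbation hop "H \<mu>" "\<lambda>x. \<mu> * v x" "disp_max eh" "h_op eh v \<mu>"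
    by (rule compact_perturbation_h_op)
  obtain f where f: "f \<noteq> 0" "H \<mu> f = E *\<^sub>R f"
    using cp.disc_spectrum_above_iff[OF E] \<open>complex_of_real E \<in> _\<close> by blast
  let ?a = "(cmod (coord f 0))\<^sup>2"
  have "\<eta> * A * ?a \<le> - (\<Sum>\<^sub>\<infinity>x. v x) * ?a" by (intro mult_right_mono \<eta>) simp
  then have "V f \<le> (1 + 1 / \<eta>) * D * Q f"
    using V_close_to_sum[OF \<eta>(1), of f] by (simp add: abs_le_iff)
  then have "\<mu> * V f \<le> \<mu> * ((1 + 1 / \<eta>) * D * Q f)" using \<mu> by (intro mult_left_mono) auto
  also have "\<dots> = (\<mu> * ((1 + 1 / \<eta>) * D)) * Q f" by simp
  also have "\<dots> \<le> 1 * Q f" by (intro mult_right_mono \<mu> Q_nonneg)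
  finally have "H \<mu> f \<bullet> f \<le> disp_max eh * (norm f)\<^sup>2" by (simp add: H_form)
  then have "(E - disp_max eh) * (norm f)\<^sup>2 \<le> 0" by (simp add: f(2) dot_square_norm algebra_simps)
  moreover have "0 < (E - disp_max eh) * (norm f)\<^sup>2" using E f(1) by simp
  ultimately show False by simp
qed

lemma V_tendsto_sum:
  assumes f: "\<And>n::nat. coord (f n) 0 = 1" "(\<lambda>n. Q (f n)) \<longlonglongrightarrow> 0"
  shows "(\<lambda>n. V (f n)) \<longlonglongrightarrow> (\<Sum>\<^sub>\<infinity>x. v x)"
proof (rule LIMSEQ_I)
  fix e :: real assume e: "0 < e"
  define \<eta> where "\<eta> = e / (2 * (A + 1))"
  have \<eta>: "0 < \<eta>" using e A_nonneg by (simp add: \<eta>_def)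
  have "\<eta> * A \<le> \<eta> * (A + 1)" using \<eta> by simp
  also have "\<dots> = e / 2" using A_nonneg by (simp add: \<eta>_def add_nonneg_eq_0_iff del: distrib_left_numeral)
  finally have \<eta>A: "\<eta> * A \<le> e / 2" .
  have "(\<lambda>n. (1 + 1 / \<eta>) * D * Q (f n)) \<longlonglongrightarrow> (1 + 1 / \<eta>) * D * 0" by (intro tendsto_intros f)
  then obtain N where N: "\<And>n. n \<ge> N \<Longrightarrow> norm ((1 + 1 / \<eta>) * D * Q (f n) - (1 + 1 / \<eta>) * D * 0) < e / 2"
    using LIMSEQ_D[of _ _ "e / 2"] e by (metis half_gt_zero)
  have "norm (V (f n) - (\<Sum>\<^sub>\<infinity>x. v x)) < e" if "n \<ge> N" for n
  proof -
    have "(1 + 1 / \<eta>) * D * Q (f n) < e / 2" using N[OF that] by (simp add: abs_less_iff)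
    moreover have "\<bar>V (f n) - (\<Sum>\<^sub>\<infinity>x. v x)\<bar> \<le> \<eta> * A + (1 + 1 / \<eta>) * D * Q (f n)"
      using V_close_to_sum[OF \<eta>, of "f n"] by (simp add: f(1))
    ultimately show ?thesis using \<eta>A unfolding real_norm_def by linarith
  qed
  then show "\<exists>N. \<forall>n\<ge>N. norm (V (f n) - (\<Sum>\<^sub>\<infinity>x. v x)) < e" by blast
qed

text \<open>Along the trial sequence the excess \<open>G\<close> of the form tends to
  \<open>\<mu>\<close> times the sum of \<open>v\<close>, which settles the positive case. For zero
  sum, \<open>Q (f n) \<rightarrow> 0\<close> forces \<open>P (f n) \<rightarrow> 0\<close> in norm,
  so in the cross term with a delta at \<open>x0\<close> only the potential survives.\<close>

lemma eigenvalue_above_exists: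
  assumes f: "\<And>n::nat. coord (f n) 0 = 1" "(\<lambda>n. Q (f n)) \<longlonglongrightarrow> 0"
    and \<mu>: "0 < \<mu>" and S: "0 \<le> (\<Sum>\<^sub>\<infinity>x. v x)" and x0: "v x0 \<noteq> 0"
  obtains E where "disp_max eh < E" "complex_of_real E \<in> disc_spectrum (h_op eh v \<mu>)"
proof -
  interpret cp: compact_perturbation hop "H \<mu>" "\<lambda>x. \<mu> * v x" "disp_max eh" "h_op eh v \<mu>"
    by (rule compact_perturbation_h_op)
  define G where "G f = H \<mu> f \<bullet> f - disp_max eh * (norm f)\<^sup>2" for f
  have G: "G f = \<mu> * V f - Q f" for f by (simp add: G_def H_form)
  have Glim: "(\<lambda>n. G (f n)) \<longlonglongrightarrow> \<mu> * (\<Sum>\<^sub>\<infinity>x. v x)"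
    unfolding G using tendsto_diff[OF tendsto_mult[OF tendsto_const V_tendsto_sum[OF f]] f(2)] by simp
  have "\<exists>g. 0 < G g"
  proof (cases "(\<Sum>\<^sub>\<infinity>x. v x) = 0")
    case False
    then have "0 < \<mu> * (\<Sum>\<^sub>\<infinity>x. v x)" using S \<mu> by simp
    then have "\<forall>\<^sub>F n in sequentially. 0 < G (f n)" using order_tendstoD(1)[OF Glim] by blast
    then show ?thesis by (auto simp: eventually_sequentially)
  next
    case True
    \<comment> \<open>The plane-wave value to which \<open>f n\<close> converges at
      \<open>x0\<close>; with this phase the cross term tends to exactly
      \<open>\<mu> * v x0\<close>.\<close>
    define w where "w = cis (phase x0 p)"
    define \<delta> where "\<delta> = ell2_of (\<lambda>x. if x = x0 then w else 0)"
    have "(\<lambda>x. if x = x0 then w else 0) \<in> l2"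
      unfolding l2_def mem_Collect_eq
      by (rule finite_nonzero_values_imp_summable_on) (auto intro: finite_subset[of _ "{x0}"])
    then have \<delta>: "coord \<delta> x = (if x = x0 then w else 0)" for x by (simp add: \<delta>_def coord_ell2_of)
    have inner_\<delta>: "g \<bullet> \<delta> = coord g x0 \<bullet> w" for g
      by (rule has_sum_unique[OF inner_ell2_has_sum has_sum_finite_neutralI[of "{x0}"]]) (auto simp: \<delta>)
    define P where "P f = disp_max eh *\<^sub>R f - hop f" for f
    have PQ: "P f \<bullet> f = Q f" for f by (simp add: P_def Q_def inner_diff_left dot_square_norm)
    have "bounded_linear P" unfolding P_def by (intro bounded_linear_sub bl_hop bounded_linear_scaleR_right)
    moreover have "P f \<bullet> g = f \<bullet> P g" for f g by (simp add: P_def inner_diff_left inner_diff_right sym_hop)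
    moreover have "0 \<le> P f \<bullet> f" for f unfolding PQ by (rule Q_nonneg)
    ultimately obtain M where M: "0 < M" "\<And>f. (norm (P f))\<^sup>2 \<le> M * (P f \<bullet> f)"
      using positive_operator_norm_le by blast
    have "(\<lambda>n. M * Q (f n)) \<longlonglongrightarrow> 0" using tendsto_mult_right_zero[OF f(2)] .
    then have "(\<lambda>n. (norm (P (f n)))\<^sup>2) \<longlonglongrightarrow> 0"
      by (rule tendsto_sandwich[OF _ _ tendsto_const, rotated 2]) (use M PQ in \<open>auto intro!: always_eventually\<close>)
    from tendsto_real_sqrt[OF this] have "(\<lambda>n. P (f n)) \<longlonglongrightarrow> 0" by (simp add: tendsto_norm_zero_iff)
    from tendsto_inner[OF this tendsto_const[of \<delta>]] have P0: "(\<lambda>n. P (f n) \<bullet> \<delta>) \<longlonglongrightarrow> 0" by simp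
    have "(\<lambda>n. C * lat_norm x0 powr \<alpha> * Q (f n)) \<longlonglongrightarrow> 0" using tendsto_mult_right_zero[OF f(2)] .
    then have "(\<lambda>n. (cmod (coord (f n) x0 - w))\<^sup>2) \<longlonglongrightarrow> 0"
      by (rule tendsto_sandwich[OF _ _ tendsto_const, rotated 2])
         (use oscillation[of "f _" x0] f(1) in \<open>auto intro!: always_eventually simp: w_def\<close>)
    from tendsto_real_sqrt[OF this] have "(\<lambda>n. coord (f n) x0 - w) \<longlonglongrightarrow> 0" by (simp add: tendsto_norm_zero_iff)
    then have fw: "(\<lambda>n. coord (f n) x0) \<longlonglongrightarrow> w" by (simp add: LIM_zero_iff)
    define B where "B n = (H \<mu> (f n) - disp_max eh *\<^sub>R f n) \<bullet> \<delta>" for n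
    have "B = (\<lambda>n. \<mu> * v x0 * (coord (f n) x0 \<bullet> w) - P (f n) \<bullet> \<delta>)"
      unfolding fun_eq_iff B_def inner_\<delta> P_def coord_simps coord_H
      by (simp add: inner_add_left inner_diff_left scaleR_conv_of_real[symmetric] algebra_simps)
    moreover have "(\<lambda>n. \<mu> * v x0 * (coord (f n) x0 \<bullet> w) - P (f n) \<bullet> \<delta>) \<longlonglongrightarrow> \<mu> * v x0 * (w \<bullet> w) - 0"
      by (intro tendsto_intros fw P0)
    moreover have "w \<bullet> w = 1" by (simp add: w_def dot_square_norm)
    ultimately have Blim: "B \<longlonglongrightarrow> \<mu> * v x0" by simp
    define \<beta> where "\<beta> = \<mu> * v x0"
    have \<beta>: "\<beta> \<noteq> 0" using \<mu> x0 by (simp add: \<beta>_def)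
    \<comment> \<open>\<open>t\<close> has the sign of \<open>\<beta>\<close>, and
      \<open>t \<beta> = t^2 (1 + |G \<delta>|)\<close>, so the linear gain
      \<open>2 t \<beta>\<close> exceeds the quadratic cost even if \<open>G \<delta>\<close> is
      negative.\<close>
    define t where "t = \<beta> / (1 + \<bar>G \<delta>\<bar>)"
    have exp: "G (f n + t *\<^sub>R \<delta>) = G (f n) + 2 * t * B n + t\<^sup>2 * G \<delta>" for n
    proof -
      have s: "H \<mu> \<delta> \<bullet> f n = H \<mu> (f n) \<bullet> \<delta>" using cp.sym_H[of \<delta> "f n"] by (simp add: inner_commute)
      show ?thesis
        unfolding G_def B_def power2_norm_eq_inner
        by (simp add: cp.H.add cp.H.scaleR inner_add_left inner_add_right inner_diff_left s inner_commute[of \<delta> "f n"] power2_eq_square algebra_simps)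
    qed
    have lim: "(\<lambda>n. G (f n + t *\<^sub>R \<delta>)) \<longlonglongrightarrow> 0 + 2 * t * \<beta> + t\<^sup>2 * G \<delta>"
      unfolding exp using Glim Blim True by (intro tendsto_intros) (simp_all add: \<beta>_def)
    have "0 < 0 + 2 * t * \<beta> + t\<^sup>2 * G \<delta>"
    proof -
      have k: "0 < 1 + \<bar>G \<delta>\<bar>" by simp
      have "t * (1 + \<bar>G \<delta>\<bar>) = \<beta>" using k by (simp add: t_def)
      then have "t * \<beta> = t\<^sup>2 + t\<^sup>2 * \<bar>G \<delta>\<bar>" by (metis power2_eq_square distrib_left mult.right_neutral mult.assoc)
      moreover have "t\<^sup>2 * - \<bar>G \<delta>\<bar> \<le> t\<^sup>2 * G \<delta>" by (intro mult_left_mono) auto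
      moreover have "0 < t\<^sup>2" using \<beta> k by (simp add: t_def)
      moreover have "0 \<le> t\<^sup>2 * \<bar>G \<delta>\<bar>" by simp
      ultimately show ?thesis unfolding mult_minus_right by linarith
    qed
    then have "\<forall>\<^sub>F n in sequentially. 0 < G (f n + t *\<^sub>R \<delta>)" using order_tendstoD(1)[OF lim] by blast
    then show ?thesis by (auto simp: eventually_sequentially)
  qed
  then obtain g where "disp_max eh * (norm g)\<^sup>2 < H \<mu> g \<bullet> g" by (auto simp: G_def)
  then obtain l u where "disp_max eh < l" "u \<noteq> 0" "H \<mu> u = l *\<^sub>R u" by (rule cp.eigenvalue_above)
  then show thesis using that[of l] cp.disc_spectrum_above_iff[of l] by blast
qed

end

text \<open>Stated for one edge and for potentials of either sign, so that it applies both to the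
  given data and to their negatives.\<close>

lemma spectrum_above_max:
  fixes eh :: "int^'d \<Rightarrow> complex" and v :: "int^'d \<Rightarrow> real"
  assumes dim: "CARD('d) \<le> 2"
    and eh_l1: "(\<lambda>x. cmod (eh x)) summable_on UNIV"
    and eh_sym: "\<And>x. cnj (eh (- x)) = eh x"
    and max_unique: "\<exists>!p1. p1 \<in> torus \<and> disp eh p1 = disp_max eh"
    and max_nondeg: "\<forall>p1\<in>torus. disp eh p1 = disp_max eh \<longrightarrow> C2_nondeg_at (disp eh) p1"
    and gam: "0 < \<gamma>" "\<gamma> < 1"
    and v_summ: "(\<lambda>x. lat_norm x powr (2 - real CARD('d) + \<gamma>) * \<bar>v x\<bar>) summable_on UNIV"
    and v_nonzero: "v y \<noteq> 0"
  shows "\<And>\<mu>. 0 < \<mu> \<Longrightarrow> 0 \<le> (\<Sum>\<^sub>\<infinity>x. v x) \<Longrightarrow>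
      \<exists>E>disp_max eh. complex_of_real E \<in> disc_spectrum (h_op eh v \<mu>)"
    and "\<exists>\<mu>o>0. \<forall>\<mu>. 0 < \<mu> \<and> \<mu> < \<mu>o \<longrightarrow>
      (\<forall>E E'. disp_max eh < E \<and> complex_of_real E \<in> disc_spectrum (h_op eh v \<mu>) \<and>
        disp_max eh < E' \<and> complex_of_real E' \<in> disc_spectrum (h_op eh v \<mu>) \<longrightarrow> E = E') \<and>
      ((\<Sum>\<^sub>\<infinity>x. v x) < 0 \<longrightarrow> (\<forall>E>disp_max eh. complex_of_real E \<notin> disc_spectrum (h_op eh v \<mu>)))"
proof -
  interpret dispersion eh by standard (use eh_l1 eh_sym in auto)
  obtain p where p: "p \<in> torus" "disp eh p = disp_max eh"
    and p_unique: "\<And>p'. p' \<in> torus \<Longrightarrow> disp eh p' = disp_max eh \<Longrightarrow> p' = p"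
    using max_unique by blast
  obtain c C where c: "0 < c" "\<And>q. (\<And>i. \<bar>q$i\<bar> \<le> pi) \<Longrightarrow> c * (norm q)\<^sup>2 \<le> disp_max eh - disp eh (p + q)"
    and upper: "0 < C" "\<And>q. disp_max eh - disp eh (p + q) \<le> C * (norm q)\<^sup>2"
    using disp_quadratic_at_max[OF p p_unique max_nondeg[rule_format, OF p]] by metis
  obtain K where K: "0 \<le> K" "\<And>f x. (cmod (coord f x - cis (phase x p) * coord f 0))\<^sup>2
      \<le> K * lat_norm x powr (2 - real CARD('d) + \<gamma>) * Q f"
    using oscillation_le_Q[OF c gam dim] by blast
  interpret decaying_potential eh v "2 - real CARD('d) + \<gamma>" K p
  proof
    have "real CARD('d) \<le> 2" using dim by linarith
    then show "0 \<le> 2 - real CARD('d) + \<gamma>" using gam by linarith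
  qed (use v_summ K in auto)
  obtain f where f: "\<And>n::nat. coord (f n) 0 = 1" "(\<lambda>n. Q (f n)) \<longlonglongrightarrow> 0"
    using trial_functions[OF upper dim] by blast
  show "\<exists>E>disp_max eh. complex_of_real E \<in> disc_spectrum (h_op eh v \<mu>)" if "0 < \<mu>" "0 \<le> (\<Sum>\<^sub>\<infinity>x. v x)" for \<mu>
    using eigenvalue_above_exists[OF f that v_nonzero] by blast
  define S where "S = (\<Sum>\<^sub>\<infinity>x. v x)"
  \<comment> \<open>For negative \<open>S\<close> this achieves \<open>\<eta> A \<le> - S\<close>;
    the \<open>1\<close> in the denominator covers \<open>A = 0\<close>.\<close>
  define \<eta> where "\<eta> = (if S < 0 then - S / (A + 1) else 1)"
  have \<eta>: "0 < \<eta>" using A_nonneg by (simp add: \<eta>_def divide_neg_pos)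
  have \<eta>A: "\<eta> * A \<le> - S" if "S < 0"
  proof -
    have "\<eta> * A \<le> \<eta> * (A + 1)" using \<eta> by simp
    also have "\<dots> = - S" using that A_nonneg by (simp add: \<eta>_def)
    finally show ?thesis .
  qed
  \<comment> \<open>Dominates the constants of uniqueness and of absence at once; the final
    \<open>1\<close> keeps it positive when \<open>D = 0\<close>.\<close>
  define R where "R = 2 * D + (1 + 1 / \<eta>) * D + 1"
  have D': "0 \<le> (1 + 1 / \<eta>) * D" using \<eta> D_nonneg by simp
  have R: "0 < R" using D' D_nonneg by (simp add: R_def)
  show "\<exists>\<mu>o>0. \<forall>\<mu>. 0 < \<mu> \<and> \<mu> < \<mu>o \<longrightarrow>
      (\<forall>E E'. disp_max eh < E \<and> complex_of_real E \<in> disc_spectrum (h_op eh v \<mu>) \<and>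
        disp_max eh < E' \<and> complex_of_real E' \<in> disc_spectrum (h_op eh v \<mu>) \<longrightarrow> E = E') \<and>
      ((\<Sum>\<^sub>\<infinity>x. v x) < 0 \<longrightarrow> (\<forall>E>disp_max eh. complex_of_real E \<notin> disc_spectrum (h_op eh v \<mu>)))"
  proof (intro exI[of _ "1 / R"] conjI allI impI)
    show "0 < 1 / R" using R by simp
  next
    fix \<mu> E E'
    assume \<mu>: "0 < \<mu> \<and> \<mu> < 1 / R"
    then have \<mu>R: "\<mu> * R \<le> 1" using R by (simp add: less_divide_eq)
    have le: "\<mu> * k \<le> 1" if "k \<le> R" for k
      by (rule order_trans[OF mult_left_mono[OF that] \<mu>R]) (use \<mu> in simp)
    show "E = E'" if "disp_max eh < E \<and> complex_of_real E \<in> disc_spectrum (h_op eh v \<mu>) \<and>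
        disp_max eh < E' \<and> complex_of_real E' \<in> disc_spectrum (h_op eh v \<mu>)"
      using \<mu> that D' by (intro at_most_one_eigenvalue_above[of \<mu>] le) (auto simp: R_def)
    show "complex_of_real E \<notin> disc_spectrum (h_op eh v \<mu>)" if "(\<Sum>\<^sub>\<infinity>x. v x) < 0" "disp_max eh < E"
      using \<mu> that D_nonneg \<eta> \<eta>A
      by (intro no_eigenvalue_above[of \<eta>] le) (auto simp: R_def S_def)
  qed
qed

section \<open>Negation of the data exchanges the two band edges\<close>

lemma op_spectrum_uminus: "z \<in> op_spectrum (\<lambda>f x. - H f x) \<longleftrightarrow> - z \<in> op_spectrum H"
proof -
  have neg: "g \<in> l2 \<Longrightarrow> (\<lambda>x. - g x) \<in> l2" for g :: "'a \<Rightarrow> complex"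
    by (erule l2_dominated[where c = 1]) simp
  have all: "(\<forall>g\<in>l2. R g) \<longleftrightarrow> (\<forall>g\<in>l2. R (\<lambda>x. - g x))" for R :: "('a \<Rightarrow> complex) \<Rightarrow> bool"
  proof
    assume R: "\<forall>g\<in>l2. R (\<lambda>x. - g x)"
    show "\<forall>g\<in>l2. R g" using R[rule_format, OF neg] by simp
  qed (use neg in blast)
  have "(- H f x - z * f x = - g x) \<longleftrightarrow> (H f x - (- z) * f x = g x)" for f g x
    by (auto simp: algebra_simps)
  then show ?thesis
    unfolding op_spectrum_def mem_Collect_eq by (subst all) simp
qed

lemma disc_spectrum_uminus: "z \<in> disc_spectrum (\<lambda>f x. - H f x) \<longleftrightarrow> - z \<in> disc_spectrum H"
proof -
  have eig: "op_eigenspace (\<lambda>f x. - H f x) z = op_eigenspace H (- z)"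
  proof -
    have "- H f x = z * f x \<longleftrightarrow> H f x = - z * f x" for f x
      by (metis add.inverse_inverse mult_minus_left)
    then show ?thesis by (simp add: op_eigenspace_def)
  qed
  have spec: "op_spectrum (\<lambda>f x. - H f x) = uminus ` op_spectrum H"
  proof (rule set_eqI)
    fix y
    have "y \<in> uminus ` T \<longleftrightarrow> - y \<in> T" for T :: "complex set"
      by (metis add.inverse_inverse image_iff)
    then show "y \<in> op_spectrum (\<lambda>f x. - H f x) \<longleftrightarrow> y \<in> uminus ` op_spectrum H"
      by (simp only: op_spectrum_uminus)
  qed
  have "op_spectrum (\<lambda>f x. - H f x) \<inter> ball z e = uminus ` (op_spectrum H \<inter> ball (- z) e)" for e
  proof -
    have "ball z e = uminus ` ball (- z) e"
    proof (intro equalityI subsetI)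
      fix x assume "x \<in> ball z e"
      then have "- x \<in> ball (- z) e" by (simp add: dist_minus)
      then show "x \<in> uminus ` ball (- z) e" by (rule rev_image_eqI) simp
    next
      fix x assume "x \<in> uminus ` ball (- z) e"
      then show "x \<in> ball z e" by (metis (no_types, lifting) add.inverse_inverse dist_minus image_iff mem_ball)
    qed
    then show ?thesis unfolding spec by (simp add: image_Int)
  qed
  moreover have "uminus ` T = {z} \<longleftrightarrow> T = {- z}" for T :: "complex set"
    using inj_image_eq_iff[OF inj_uminus, of T "{- z}"] by simp
  ultimately show ?thesis
    unfolding disc_spectrum_def mem_Collect_eq eig op_spectrum_uminus by simp
qed

lemma h_op_uminus: "h_op (\<lambda>x. - eh x) (\<lambda>x. - v x) \<mu> = (\<lambda>f x. - h_op eh v \<mu> f x)"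
  by (simp add: h_op_def fun_eq_iff infsum_uminus)

lemma disp_uminus: "disp (\<lambda>x. - eh x) = (\<lambda>p. - disp eh p)"
  by (simp add: disp_def fun_eq_iff infsum_uminus)

lemma disp_max_uminus: "disp_max (\<lambda>x. - eh x) = - disp_min eh"
  unfolding disp_max_def disp_min_def disp_uminus Inf_real_def by (simp add: image_image)

lemma C2_nondeg_at_uminus:
  assumes "C2_nondeg_at f p"
  shows "C2_nondeg_at (\<lambda>x. - f x) p"
proof -
  obtain U D D2 where U: "open U" "p \<in> U"
    and D: "\<And>q. q \<in> U \<Longrightarrow> (f has_derivative blinfun_apply (D q)) (at q)"
    and D2: "\<And>q. q \<in> U \<Longrightarrow> (D has_derivative blinfun_apply (D2 q)) (at q)"
    and cont: "continuous_on U D2"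
    and nd: "\<And>u. (\<forall>w. blinfun_apply (blinfun_apply (D2 p) u) w = 0) \<Longrightarrow> u = 0"
    using assms unfolding C2_nondeg_at_def by blast
  show ?thesis
    unfolding C2_nondeg_at_def
  proof (intro exI[of _ U] exI[of _ "\<lambda>q. - D q"] exI[of _ "\<lambda>q. - D2 q"] conjI ballI allI impI)
    fix q assume q: "q \<in> U"
    show "((\<lambda>x. - f x) has_derivative blinfun_apply (- D q)) (at q)"
      using has_derivative_minus[OF D[OF q]] by (simp add: uminus_blinfun.rep_eq)
    show "((\<lambda>q. - D q) has_derivative blinfun_apply (- D2 q)) (at q)"
      using has_derivative_minus[OF D2[OF q]] by (simp add: uminus_blinfun.rep_eq)
  next
    show "u = 0" if "\<forall>w. blinfun_apply (blinfun_apply (- D2 p) u) w = 0" for u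
      using that by (intro nd) (simp add: blinfun.minus_left)
  qed (use U cont in \<open>auto intro: continuous_intros\<close>)
qed

theorem theorem1p2:
  fixes eh :: "int^'d \<Rightarrow> complex" and v :: "int^'d \<Rightarrow> real"
  assumes dim: "CARD('d) \<le> 2"
    and eh_l1: "(\<lambda>x. cmod (eh x)) summable_on UNIV"
    and eh_sym: "\<And>x. cnj (eh (- x)) = eh x"
    and min_unique: "\<exists>!p0. p0 \<in> torus \<and> disp eh p0 = disp_min eh"
    and max_unique: "\<exists>!p1. p1 \<in> torus \<and> disp eh p1 = disp_max eh"
    and min_nondeg: "\<And>p0. p0 \<in> torus \<Longrightarrow> disp eh p0 = disp_min eh \<Longrightarrow> C2_nondeg_at (disp eh) p0"
    and max_nondeg: "\<And>p1. p1 \<in> torus \<Longrightarrow> disp eh p1 = disp_max eh \<Longrightarrow> C2_nondeg_at (disp eh) p1"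
    and gam: "0 < \<gamma>" "\<gamma> < 1"
    and v_summ: "(\<lambda>x. lat_norm x powr (2 - real CARD('d) + \<gamma>) * \<bar>v x\<bar>) summable_on UNIV"
    and v_pos: "0 < (\<Sum>\<^sub>\<infinity>x. lat_norm x powr (2 - real CARD('d) + \<gamma>) * \<bar>v x\<bar>)"
  shows
    "(\<forall>\<mu>>0.
        ((\<Sum>\<^sub>\<infinity>x. v x) \<ge> 0 \<longrightarrow>
           {E::real. complex_of_real E \<in> disc_spectrum (h_op eh v \<mu>)} \<inter> {disp_max eh<..} \<noteq> {}) \<and>
        ((\<Sum>\<^sub>\<infinity>x. v x) \<le> 0 \<longrightarrow>
           {E::real. complex_of_real E \<in> disc_spectrum (h_op eh v \<mu>)} \<inter> {..<disp_min eh} \<noteq> {}))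
     \<and>
     (\<exists>\<mu>o>0. \<forall>\<mu>. 0 < \<mu> \<and> \<mu> < \<mu>o \<longrightarrow>
        ((\<Sum>\<^sub>\<infinity>x. v x) > 0 \<longrightarrow>
           (\<exists>E. {E'::real. complex_of_real E' \<in> disc_spectrum (h_op eh v \<mu>)} \<inter> {disp_max eh<..} = {E}) \<and>
           {e::real. complex_of_real e \<in> disc_spectrum (h_op eh v \<mu>)} \<inter> {..<disp_min eh} = {}) \<and>
        ((\<Sum>\<^sub>\<infinity>x. v x) < 0 \<longrightarrow>
           (\<exists>e. {e'::real. complex_of_real e' \<in> disc_spectrum (h_op eh v \<mu>)} \<inter> {..<disp_min eh} = {e}) \<and>
           {E::real. complex_of_real E \<in> disc_spectrum (h_op eh v \<mu>)} \<inter> {disp_max eh<..} = {}) \<and>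
        ((\<Sum>\<^sub>\<infinity>x. v x) = 0 \<longrightarrow>
           (\<exists>E. {E'::real. complex_of_real E' \<in> disc_spectrum (h_op eh v \<mu>)} \<inter> {disp_max eh<..} = {E}) \<and>
           (\<exists>e. {e'::real. complex_of_real e' \<in> disc_spectrum (h_op eh v \<mu>)} \<inter> {..<disp_min eh} = {e})))"
proof -
  let ?S = "\<Sum>\<^sub>\<infinity>x. v x"
  obtain x0 where x0: "v x0 \<noteq> 0"
    using v_pos by (metis (no_types, lifting) abs_zero infsum_0 less_irrefl mult_zero_right)
  have "\<forall>p1\<in>torus. disp eh p1 = disp_max eh \<longrightarrow> C2_nondeg_at (disp eh) p1" using max_nondeg by blast
  note above = spectrum_above_max[OF dim eh_l1 eh_sym max_unique this gam v_summ x0]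
  have mirror: "complex_of_real E \<in> disc_spectrum (h_op (\<lambda>x. - eh x) (\<lambda>x. - v x) \<mu>)
      \<longleftrightarrow> complex_of_real (- E) \<in> disc_spectrum (h_op eh v \<mu>)" for E \<mu>
    unfolding h_op_uminus disc_spectrum_uminus by simp
  have sum_neg: "(\<Sum>\<^sub>\<infinity>x. - v x) = - ?S" by (simp add: infsum_uminus)
  \<comment> \<open>The upper-edge result for \<open>- eh\<close> and \<open>- v\<close>: the
    maximum of the negated dispersion is minus the old minimum, the sum of the potential changes
    sign, and eigenvalues are reflected by \<open>mirror\<close>.\<close>
  have below: "\<And>\<mu>. 0 < \<mu> \<Longrightarrow> 0 \<le> (\<Sum>\<^sub>\<infinity>x. - v x) \<Longrightarrow>
      \<exists>E>disp_max (\<lambda>x. - eh x). complex_of_real E \<in> disc_spectrum (h_op (\<lambda>x. - eh x) (\<lambda>x. - v x) \<mu>)"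
    and below': "\<exists>\<mu>o>0. \<forall>\<mu>. 0 < \<mu> \<and> \<mu> < \<mu>o \<longrightarrow>
      (\<forall>E E'. disp_max (\<lambda>x. - eh x) < E \<and> complex_of_real E \<in> disc_spectrum (h_op (\<lambda>x. - eh x) (\<lambda>x. - v x) \<mu>) \<and>
        disp_max (\<lambda>x. - eh x) < E' \<and> complex_of_real E' \<in> disc_spectrum (h_op (\<lambda>x. - eh x) (\<lambda>x. - v x) \<mu>) \<longrightarrow> E = E') \<and>
      ((\<Sum>\<^sub>\<infinity>x. - v x) < 0 \<longrightarrow> (\<forall>E>disp_max (\<lambda>x. - eh x). complex_of_real E \<notin> disc_spectrum (h_op (\<lambda>x. - eh x) (\<lambda>x. - v x) \<mu>)))"
  proof (goal_cases)
    case 1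
    then show ?case
      by (intro spectrum_above_max(1)[where v = "\<lambda>x. - v x" and y = x0, OF dim _ _ _ _ gam])
         (use eh_l1 eh_sym min_unique min_nondeg v_summ x0 in \<open>auto simp: disp_uminus disp_max_uminus intro: C2_nondeg_at_uminus\<close>)
  next
    case 2
    then show ?case
      by (intro spectrum_above_max(2)[where v = "\<lambda>x. - v x" and y = x0, OF dim _ _ _ _ gam])
         (use eh_l1 eh_sym min_unique min_nondeg v_summ x0 in \<open>auto simp: disp_uminus disp_max_uminus intro: C2_nondeg_at_uminus\<close>)
  qed
  obtain \<mu>1 where \<mu>1: "0 < \<mu>1"
    "\<And>\<mu> E E'. 0 < \<mu> \<Longrightarrow> \<mu> < \<mu>1 \<Longrightarrow> disp_max eh < E \<Longrightarrow> complex_of_real E \<in> disc_spectrum (h_op eh v \<mu>) \<Longrightarrow>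
        disp_max eh < E' \<Longrightarrow> complex_of_real E' \<in> disc_spectrum (h_op eh v \<mu>) \<Longrightarrow> E = E'"
    "\<And>\<mu> E. 0 < \<mu> \<Longrightarrow> \<mu> < \<mu>1 \<Longrightarrow> ?S < 0 \<Longrightarrow> disp_max eh < E \<Longrightarrow> complex_of_real E \<notin> disc_spectrum (h_op eh v \<mu>)"
    using above(2) by (elim exE conjE) (rule that; blast)
  obtain \<mu>2 where \<mu>2: "0 < \<mu>2"
    "\<And>\<mu> E E'. 0 < \<mu> \<Longrightarrow> \<mu> < \<mu>2 \<Longrightarrow> - disp_min eh < E \<Longrightarrow> complex_of_real (- E) \<in> disc_spectrum (h_op eh v \<mu>) \<Longrightarrow>
        - disp_min eh < E' \<Longrightarrow> complex_of_real (- E') \<in> disc_spectrum (h_op eh v \<mu>) \<Longrightarrow> E = E'"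
    "\<And>\<mu> E. 0 < \<mu> \<Longrightarrow> \<mu> < \<mu>2 \<Longrightarrow> 0 < ?S \<Longrightarrow> - disp_min eh < E \<Longrightarrow> complex_of_real (- E) \<notin> disc_spectrum (h_op eh v \<mu>)"
    using below' unfolding mirror sum_neg disp_max_uminus neg_less_0_iff_less
    by (elim exE conjE) (rule that; blast)
  define up where "up \<mu> = {E::real. complex_of_real E \<in> disc_spectrum (h_op eh v \<mu>)} \<inter> {disp_max eh<..}" for \<mu>
  define dn where "dn \<mu> = {E::real. complex_of_real E \<in> disc_spectrum (h_op eh v \<mu>)} \<inter> {..<disp_min eh}" for \<mu>
  have up_ex: "up \<mu> \<noteq> {}" if "0 < \<mu>" "0 \<le> ?S" for \<mu>
    using above(1)[OF that] by (auto simp: up_def)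
  have dn_ex: "dn \<mu> \<noteq> {}" if \<mu>: "0 < \<mu>" "?S \<le> 0" for \<mu>
  proof -
    obtain E where "- disp_min eh < E" "complex_of_real (- E) \<in> disc_spectrum (h_op eh v \<mu>)"
      using below[of \<mu>] \<mu> unfolding mirror sum_neg disp_max_uminus by auto
    then have "- E \<in> dn \<mu>" by (auto simp: dn_def)
    then show ?thesis by blast
  qed
  have up_uni: "E = E'" if "0 < \<mu>" "\<mu> < \<mu>1" "E \<in> up \<mu>" "E' \<in> up \<mu>" for \<mu> E E'
    using \<mu>1(2)[of \<mu> E E'] that by (auto simp: up_def)
  have dn_uni: "E = E'" if "0 < \<mu>" "\<mu> < \<mu>2" "E \<in> dn \<mu>" "E' \<in> dn \<mu>" for \<mu> E E'
    using \<mu>2(2)[of \<mu> "- E" "- E'"] that by (auto simp: dn_def)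
  have up_none: "up \<mu> = {}" if "0 < \<mu>" "\<mu> < \<mu>1" "?S < 0" for \<mu>
    using \<mu>1(3) that by (auto simp: up_def)
  have dn_none: "dn \<mu> = {}" if "0 < \<mu>" "\<mu> < \<mu>2" "0 < ?S" for \<mu>
  proof -
    have "E \<notin> dn \<mu>" for E using \<mu>2(3)[of \<mu> "- E"] that by (auto simp: dn_def)
    then show ?thesis by blast
  qed
  have up_one: "\<exists>E. up \<mu> = {E}" if "0 < \<mu>" "\<mu> < \<mu>1" "0 \<le> ?S" for \<mu>
    using up_ex[of \<mu>] up_uni[of \<mu>] that by blast
  have dn_one: "\<exists>E. dn \<mu> = {E}" if "0 < \<mu>" "\<mu> < \<mu>2" "?S \<le> 0" for \<mu>
    using dn_ex[of \<mu>] dn_uni[of \<mu>] that by blast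
  show ?thesis
    unfolding up_def[symmetric] dn_def[symmetric]
  proof (rule conjI)
    show "\<forall>\<mu>>0. (0 \<le> ?S \<longrightarrow> up \<mu> \<noteq> {}) \<and> (?S \<le> 0 \<longrightarrow> dn \<mu> \<noteq> {})"
      using up_ex dn_ex by blast
    show "\<exists>\<mu>o>0. \<forall>\<mu>. 0 < \<mu> \<and> \<mu> < \<mu>o \<longrightarrow>
        (0 < ?S \<longrightarrow> (\<exists>E. up \<mu> = {E}) \<and> dn \<mu> = {}) \<and>
        (?S < 0 \<longrightarrow> (\<exists>e. dn \<mu> = {e}) \<and> up \<mu> = {}) \<and>
        (?S = 0 \<longrightarrow> (\<exists>E. up \<mu> = {E}) \<and> (\<exists>e. dn \<mu> = {e}))"
      using \<mu>1(1) \<mu>2(1)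
      by (intro exI[of _ "min \<mu>1 \<mu>2"]) (simp add: up_none dn_none up_one dn_one)
  qed
qed

end
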